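(* Let $(M,H)$ be a contact manifold of dimension $2n+1$, and let $H^R\subset H$ be an integrable Lagrangian subbundle. Then locally $M$ is contact diffeomorphic to the projectivized cotangent bundle $\mathcal P(T^*\mathbb R^{n+1})$ in such a way that $H^R$ is mapped to the vertical subbundle; i.e. every point of $M$ has an open neighborhood $U$ and a diffeomorphism from $U$ onto an open subset of $\mathcal P(T^*\mathbb R^{n+1})$ mapping $H$ to the canonical contact distribution and $H^R$ to the vertical subbundle of $\mathcal P(T^*\mathbb R^{n+1})\to\mathbb R^{n+1}$.
   Context: A contact structure on a manifold $M$ of dimension $2n+1$ is a subbundle $H\subset TM$ of rank $2n$ such that the skew-symmetric bundle map $\mathcal L:H\times H\to TM/H$ induced by the Lie bracket of vector fields is non-degenerate. A subbundle $F\subset H$ is Lagrangian if it has rank $n$ and $\mathcal L$ vanishes on $F\times F$. The canonical contact distribution on $\pi:\mathcal P(T^*N)\to N$ is $H_\ell=\{\xi\in T_\ell\mathcal P(T^*N):\ell(T\pi\cdot\xi)=0\}$, where $\ell$ is a line in $T^*_{\pi(\ell)}N$; the vertical subbundle is $\ker T\pi$. *)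

theory Defs
  imports "HOL-Analysis.Analysis"
begin

text \<open>In finite dimension, f is k+1 times continuously differentiable on an open set iff it is
  differentiable there and each directional derivative is k times continuously differentiable.
  Both notions are meant for open S.\<close>

primrec Ck_on :: "nat \<Rightarrow> 'e::euclidean_space set \<Rightarrow> ('e \<Rightarrow> 'f::real_normed_vector) \<Rightarrow> bool" where
  "Ck_on 0 S f \<longleftrightarrow> continuous_on S f"
| "Ck_on (Suc k) S f \<longleftrightarrow>
     (\<forall>x\<in>S. f differentiable (at x)) \<and>
     (\<forall>v. Ck_on k S (\<lambda>x. frechet_derivative f (at x) v))"

definition smooth_on :: "'e::euclidean_space set \<Rightarrow> ('e \<Rightarrow> 'f::real_normed_vector) \<Rightarrow> bool" where
  "smooth_on S f \<longleftrightarrow> (\<forall>k. Ck_on k S f)"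

text \<open>A chart is a pair of its domain and its coordinate map; values of the coordinate map outside
  the domain are irrelevant. The smooth structure is given by a (not necessarily maximal) atlas.\<close>

type_synonym ('a, 'e) chart = "'a set \<times> ('a \<Rightarrow> 'e)"

datatype ('a, 'e) mfd = Mfd (mtop: "'a topology") (atlas: "('a, 'e) chart set")

definition chart_inv :: "('a, 'e) chart \<Rightarrow> 'e \<Rightarrow> 'a" where
  "chart_inv c = inv_into (fst c) (snd c)"

definition transition :: "('a, 'e) chart \<Rightarrow> ('a, 'e) chart \<Rightarrow> 'e \<Rightarrow> 'e" where
  "transition c d = snd d \<circ> chart_inv c"

definition is_chart :: "'a topology \<Rightarrow> ('a, 'e::euclidean_space) chart \<Rightarrow> bool" where
  "is_chart T c \<longleftrightarrow> openin T (fst c) \<and> open (snd c ` fst c) \<and>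
     homeomorphic_map (subtopology T (fst c)) (top_of_set (snd c ` fst c)) (snd c)"

definition smooth_manifold :: "('a, 'e::euclidean_space) mfd \<Rightarrow> bool" where
  "smooth_manifold M \<longleftrightarrow>
     Hausdorff_space (mtop M) \<and> second_countable (mtop M) \<and>
     (\<forall>c\<in>atlas M. is_chart (mtop M) c) \<and>
     (\<Union>c\<in>atlas M. fst c) = topspace (mtop M) \<and>
     (\<forall>c\<in>atlas M. \<forall>d\<in>atlas M. smooth_on (snd c ` (fst c \<inter> fst d)) (transition c d))"

definition charts_at :: "('a, 'e) mfd \<Rightarrow> 'a \<Rightarrow> ('a, 'e) chart set" where
  "charts_at M p = {c \<in> atlas M. p \<in> fst c}"

definition smooth_map_on ::
  "('a, 'e::euclidean_space) mfd \<Rightarrow> 'a set \<Rightarrow> ('b, 'f::euclidean_space) mfd \<Rightarrow> ('a \<Rightarrow> 'b) \<Rightarrow> bool"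
where
  "smooth_map_on M U N f \<longleftrightarrow>
     continuous_map (subtopology (mtop M) U) (mtop N) f \<and>
     (\<forall>c\<in>atlas M. \<forall>d\<in>atlas N.
        smooth_on (snd c ` {p \<in> U \<inter> fst c. f p \<in> fst d}) (snd d \<circ> f \<circ> chart_inv c))"

definition diffeo_on ::
  "('a, 'e::euclidean_space) mfd \<Rightarrow> 'a set \<Rightarrow> ('b, 'f::euclidean_space) mfd \<Rightarrow> 'b set \<Rightarrow> ('a \<Rightarrow> 'b) \<Rightarrow> bool"
where
  "diffeo_on M U N V f \<longleftrightarrow>
     openin (mtop M) U \<and> openin (mtop N) V \<and> bij_betw f U V \<and>
     smooth_map_on M U N f \<and> smooth_map_on N V M (inv_into U f)"

text \<open>A tangent vector at p is the family of its coordinate representations in all charts around p,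
  related to each other by the derivatives of the transition maps. Entries at the other indices
  are set to 0, so that equality of tangent vectors is equality of functions. For each chart c at p,
  evaluation at c is a bijection from the tangent space onto the model space 'e; the vector space
  structure of the tangent space is the pointwise one.\<close>

type_synonym ('a, 'e) tvec = "('a, 'e) chart \<Rightarrow> 'e"

definition tangent_space :: "('a, 'e::euclidean_space) mfd \<Rightarrow> 'a \<Rightarrow> ('a, 'e) tvec set" where
  "tangent_space M p =
     {\<xi>. (\<forall>c\<in>charts_at M p. \<forall>d\<in>charts_at M p.
            \<xi> d = frechet_derivative (transition c d) (at (snd c p)) (\<xi> c)) \<and>
         (\<forall>c. c \<notin> charts_at M p \<longrightarrow> \<xi> c = 0)}"

text \<open>The tangent map of f at p, computed in some chart around p; for f smooth near p
  and a tangent vector at p, the choice does not matter.\<close>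

definition tangent_map ::
  "('a, 'e::euclidean_space) mfd \<Rightarrow> ('b, 'f::euclidean_space) mfd \<Rightarrow> ('a \<Rightarrow> 'b) \<Rightarrow> 'a
     \<Rightarrow> ('a, 'e) tvec \<Rightarrow> ('b, 'f) tvec"
where
  "tangent_map M N f p \<xi> =
     (let c = (SOME c. c \<in> charts_at M p) in
      (\<lambda>d. if d \<in> charts_at N (f p)
           then frechet_derivative (snd d \<circ> f \<circ> chart_inv c) (at (snd c p)) (\<xi> c) else 0))"

definition vf_rep :: "('a, 'e) chart \<Rightarrow> ('a \<Rightarrow> ('a, 'e) tvec) \<Rightarrow> 'e \<Rightarrow> 'e" where
  "vf_rep c X = (\<lambda>y. X (chart_inv c y) c)"

definition smooth_vector_field ::
  "('a, 'e::euclidean_space) mfd \<Rightarrow> 'a set \<Rightarrow> ('a \<Rightarrow> ('a, 'e) tvec) \<Rightarrow> bool"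
where
  "smooth_vector_field M U X \<longleftrightarrow>
     openin (mtop M) U \<and> (\<forall>p\<in>U. X p \<in> tangent_space M p) \<and>
     (\<forall>c\<in>atlas M. smooth_on (snd c ` (U \<inter> fst c)) (vf_rep c X))"

text \<open>In coordinates, [X,Y] = DY(X) - DX(Y).\<close>

definition lie_bracket ::
  "('a, 'e::euclidean_space) mfd \<Rightarrow> ('a \<Rightarrow> ('a, 'e) tvec) \<Rightarrow> ('a \<Rightarrow> ('a, 'e) tvec)
     \<Rightarrow> 'a \<Rightarrow> ('a, 'e) tvec"
where
  "lie_bracket M X Y p =
     (\<lambda>c. if c \<in> charts_at M p
          then frechet_derivative (vf_rep c Y) (at (snd c p)) (X p c)
             - frechet_derivative (vf_rep c X) (at (snd c p)) (Y p c)
          else 0)"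

type_synonym ('a, 'e) distrib = "'a \<Rightarrow> ('a, 'e) tvec set"

text \<open>A subbundle of rank r: its fibres are r-dimensional linear subspaces of the tangent spaces
  (read off in charts), and it is locally spanned by r smooth vector fields.\<close>

definition subbundle :: "('a, 'e::euclidean_space) mfd \<Rightarrow> nat \<Rightarrow> ('a, 'e) distrib \<Rightarrow> bool" where
  "subbundle M r F \<longleftrightarrow>
     (\<forall>p\<in>topspace (mtop M).
        F p \<subseteq> tangent_space M p \<and>
        (\<forall>c\<in>charts_at M p. subspace ((\<lambda>\<xi>. \<xi> c) ` F p) \<and> dim ((\<lambda>\<xi>. \<xi> c) ` F p) = r)) \<and>
     (\<forall>p\<in>topspace (mtop M). \<exists>U X. p \<in> U \<and>
        (\<forall>i<r. smooth_vector_field M U (X i)) \<and> openin (mtop M) U \<and>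
        (\<forall>q\<in>U. \<forall>c\<in>charts_at M q. (\<lambda>\<xi>. \<xi> c) ` F q = span ((\<lambda>i. X i q c) ` {..<r})))"

definition section_on ::
  "('a, 'e::euclidean_space) mfd \<Rightarrow> ('a, 'e) distrib \<Rightarrow> 'a set \<Rightarrow> ('a \<Rightarrow> ('a, 'e) tvec) \<Rightarrow> bool"
where
  "section_on M F U X \<longleftrightarrow> smooth_vector_field M U X \<and> (\<forall>p\<in>U. X p \<in> F p)"

text \<open>Integrability in the sense of involutivity. The existence of an integral submanifold through every
  point implies this condition by the elementary direction of the Frobenius theorem.\<close>

definition integrable_subbundle :: "('a, 'e::euclidean_space) mfd \<Rightarrow> ('a, 'e) distrib \<Rightarrow> bool" where
  "integrable_subbundle M F \<longleftrightarrow>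
     (\<forall>U X Y. section_on M F U X \<and> section_on M F U Y \<longrightarrow>
        (\<forall>p\<in>U. lie_bracket M X Y p \<in> F p))"

text \<open>The value at tangent vectors in H p of the map induced by the Lie bracket, as an element of the
  quotient of the tangent space by H p, i.e. as a coset of H p: the class of [X,Y](p) for any local
  sections X, Y of H extending the two vectors. The set below collects the elements of
  these cosets over all X, Y; as the induced map is tensorial, they are all the same coset. The zero
  of the quotient is the coset H p.\<close>

definition levi_bracket ::
  "('a, 'e::euclidean_space) mfd \<Rightarrow> ('a, 'e) distrib \<Rightarrow> 'a \<Rightarrow> ('a, 'e) tvec \<Rightarrow> ('a, 'e) tvec
     \<Rightarrow> ('a, 'e) tvec set"
where
  "levi_bracket M H p \<xi> \<eta> =
     {(\<lambda>c. lie_bracket M X Y p c + \<zeta> c) | U X Y \<zeta>.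
        p \<in> U \<and> section_on M H U X \<and> section_on M H U Y \<and> X p = \<xi> \<and> Y p = \<eta> \<and> \<zeta> \<in> H p}"

definition contact_manifold ::
  "nat \<Rightarrow> ('a, 'e::euclidean_space) mfd \<Rightarrow> ('a, 'e) distrib \<Rightarrow> bool"
where
  "contact_manifold n M H \<longleftrightarrow>
     smooth_manifold M \<and> DIM('e) = 2 * n + 1 \<and> subbundle M (2 * n) H \<and>
     (\<forall>p\<in>topspace (mtop M). \<forall>\<xi>\<in>H p.
        (\<forall>\<eta>\<in>H p. levi_bracket M H p \<xi> \<eta> = H p) \<longrightarrow> \<xi> = (\<lambda>_. 0))"

definition lagrangian_subbundle ::
  "nat \<Rightarrow> ('a, 'e::euclidean_space) mfd \<Rightarrow> ('a, 'e) distrib \<Rightarrow> ('a, 'e) distrib \<Rightarrow> bool"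
where
  "lagrangian_subbundle n M H F \<longleftrightarrow>
     subbundle M n F \<and>
     (\<forall>p\<in>topspace (mtop M). F p \<subseteq> H p \<and> (\<forall>\<xi>\<in>F p. \<forall>\<eta>\<in>F p. levi_bracket M H p \<xi> \<eta> = H p))"

text \<open>Every tangent space of N = \<open>real^'k\<close> is identified with \<open>real^'k\<close> through the identity chart.
  A point of the projectivized cotangent bundle is a pair of a base point x and a line
  in the dual space of the tangent space at x.\<close>

definition eucl_mfd :: "('b::euclidean_space, 'b) mfd" where
  "eucl_mfd = Mfd euclidean {(UNIV, id)}"

type_synonym 'k pcot = "(real^'k) \<times> ((real^'k) \<Rightarrow>\<^sub>L real) set"

definition pcot_of :: "(real^'k) \<times> ((real^'k) \<Rightarrow>\<^sub>L real) \<Rightarrow> 'k::finite pcot" where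
  "pcot_of = (\<lambda>(x, \<alpha>). (x, span {\<alpha>}))"

definition pcot_carrier :: "'k::finite pcot set" where
  "pcot_carrier = {(x, l). subspace l \<and> dim l = 1}"

text \<open>The quotient topology with respect to \<open>pcot_of\<close>, defined on pairs whose covector is nonzero.\<close>

definition pcot_top :: "'k::finite pcot topology" where
  "pcot_top = topology (\<lambda>W. W \<subseteq> pcot_carrier \<and> open {z. snd z \<noteq> 0 \<and> pcot_of z \<in> W})"

lemma openin_pcot_top:
  fixes W :: "'k::finite pcot set"
  shows "openin pcot_top W \<longleftrightarrow> W \<subseteq> pcot_carrier \<and> open {z. snd z \<noteq> 0 \<and> pcot_of z \<in> W}"
proof -
  let ?P = "\<lambda>W :: 'k pcot set. {z. snd z \<noteq> 0 \<and> pcot_of z \<in> W}"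
  have "istopology (\<lambda>W :: 'k pcot set. W \<subseteq> pcot_carrier \<and> open (?P W))"
    unfolding istopology_def
  proof (intro conjI allI impI)
    fix S T :: "'k::finite pcot set"
    assume S: "S \<subseteq> pcot_carrier \<and> open (?P S)" and T: "T \<subseteq> pcot_carrier \<and> open (?P T)"
    have "?P (S \<inter> T) = ?P S \<inter> ?P T" by auto
    then show "open (?P (S \<inter> T))" using S T by auto
    show "S \<inter> T \<subseteq> pcot_carrier" using S by auto
  next
    fix K :: "'k::finite pcot set set"
    assume K: "\<forall>S\<in>K. S \<subseteq> pcot_carrier \<and> open (?P S)"
    have "?P (\<Union>K) = (\<Union>S\<in>K. ?P S)" by auto
    then show "open (?P (\<Union>K))" using K by auto
    show "\<Union>K \<subseteq> pcot_carrier" using K by auto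
  qed
  then show ?thesis by (simp add: pcot_top_def)
qed

text \<open>The affine chart number i: on the lines not annihilating the i-th basis vector
  \<open>axis i 1\<close>, normalize the i-th component of a spanning covector to 1 and use its remaining
  components as fibre coordinates. These form the hyperplane of vectors with vanishing i-th
  component, of dimension one less than \<open>CARD('k)\<close>; the linear map A identifies the product of
  \<open>real^'k\<close> and this hyperplane with the model space 'e. The atlas contains the charts for all i and
  all such A (which exist iff the dimension of 'e is \<open>2 * CARD('k) - 1\<close>); all of them are
  smoothly compatible.\<close>

definition pcot_chart_dom :: "'k \<Rightarrow> 'k::finite pcot set" where
  "pcot_chart_dom i = {(x, l) \<in> pcot_carrier. \<exists>\<alpha>\<in>l. blinfun_apply \<alpha> (axis i 1) \<noteq> 0}"

definition pcot_coords :: "'k \<Rightarrow> 'k::finite pcot \<Rightarrow> (real^'k) \<times> (real^'k)" where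
  "pcot_coords i = (\<lambda>(x, l).
     let \<alpha> = (THE \<alpha>. \<alpha> \<in> l \<and> blinfun_apply \<alpha> (axis i 1) = 1)
     in (x, \<chi> j. if j = i then 0 else blinfun_apply \<alpha> (axis j 1)))"

definition pcot_mfd :: "('k::finite pcot, 'e::euclidean_space) mfd" where
  "pcot_mfd = Mfd pcot_top
     {(pcot_chart_dom i, A \<circ> pcot_coords i) | i A.
        linear A \<and> bij_betw A (UNIV \<times> {v. v $ i = 0}) UNIV}"

definition pcot_proj_tangent :: "'k::finite pcot \<Rightarrow> ('k pcot, 'e::euclidean_space) tvec \<Rightarrow> real^'k"
where
  "pcot_proj_tangent z \<xi> = tangent_map pcot_mfd eucl_mfd fst z \<xi> (UNIV, id)"

definition canonical_contact :: "('k::finite pcot, 'e::euclidean_space) distrib" where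
  "canonical_contact z =
     {\<xi> \<in> tangent_space pcot_mfd z. \<forall>\<alpha>\<in>snd z. blinfun_apply \<alpha> (pcot_proj_tangent z \<xi>) = 0}"

definition vertical_subbundle :: "('k::finite pcot, 'e::euclidean_space) distrib" where
  "vertical_subbundle z = {\<xi> \<in> tangent_space pcot_mfd z. pcot_proj_tangent z \<xi> = 0}"

end

theory Submission
  imports Defs
begin

text \<open>In a chart, an involutive distribution of rank \<open>n\<close> is the family of ranges of linear maps
  \<open>Gam y\<close> that are inverse to a fixed linear projection \<open>pr\<close>. Its leaves are swept out by the rays
  \<open>u' = Gam u p\<close>, \<open>u 0 = y0 + p - pr p\<close>: the time-1 map \<open>\<phi>\<close> is a local diffeomorphism, and by
  involutivity its derivative maps the range of \<open>pr\<close> onto the distribution. Instead of the flow of an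
  ordinary differential equation one works with the equation
  \<open>\<phi> p = \<integral>\<^sub>0\<^sup>1 (y0 + p - pr p + Gam (\<phi> (sig s p)) p) ds\<close>, a contraction for small \<open>p\<close> whose
  differentiated equations are of the same kind; this gives smoothness.

  Applied to the Lagrangian subbundle, this yields a submersion \<open>f\<close> to \<open>real^'k\<close> whose fibres are the
  leaves. A 1-form with kernel the contact distribution vanishes on the leaves, so it is \<open>lam \<bullet> Df\<close>
  for a function \<open>lam\<close>, normalized by one component being 1. The map \<open>(f, lam)\<close> to the projectivized
  cotangent bundle is immersive: a vector killed by \<open>Df\<close> and \<open>D lam\<close> lies in the contact
  distribution and is annihilated by \<open>d (lam \<bullet> Df)\<close>, hence 0 by non-degeneracy.\<close>

section \<open>Calculus of continuously differentiable maps\<close>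

text \<open>The obstacle is smooth dependence of the leaves on parameters. One equation in
  \<open>p\<close> alone governs all rays, because \<open>sig t (sig s p) = sig (t * s) p\<close>:
  the ray of a point on a ray is a piece of that ray. So estimates close up on each ray by a maximum
  argument, in place of Gronwall's inequality. The factor 1/2 is a Lipschitz constant in the unknown
  and hence also bounds the partial derivative, so the differentiated equation is again a
  contraction. That equation contains \<open>sig s v\<close>; it becomes an equation for a single
  directional derivative exactly when \<open>v\<close> is an eigenvector of every
  \<open>sig s\<close>, and the range and the kernel of \<open>pr\<close> supply enough of these.
  Choosing \<open>pr\<close> orthogonal makes each \<open>sig s\<close> nonexpansive, so balls
  around 0 are invariant. Non-degeneracy is given by brackets of sections, whereas the immersion
  argument needs it for a 1-form; it is translated into the statement that a vector of the contact
  hyperplane on which the differential of a defining form vanishes, against the whole hyperplane, is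
  0. Since the dimensions agree, the inverse function theorem turns the immersion into a local
  diffeomorphism.\<close>

lemma Ck_on_subset: "Ck_on k T f \<Longrightarrow> S \<subseteq> T \<Longrightarrow> Ck_on k S f"
  by (induction k arbitrary: f) (auto intro: continuous_on_subset)

lemma Ck_on_cong:
  assumes "open S" "Ck_on k S f" "\<And>x. x \<in> S \<Longrightarrow> f x = g x"
  shows "Ck_on k S g"
  using assms(2,3)
proof (induction k arbitrary: f g)
  case 0
  then show ?case using continuous_on_cong by force
next
  case (Suc k)
  have d: "(g has_derivative frechet_derivative f (at x)) (at x)" if "x \<in> S" for x
    using Suc.prems that \<open>open S\<close>
    by (metis Ck_on.simps(2) frechet_derivative_works has_derivative_transform_within_open)
  have "Ck_on k S (\<lambda>x. frechet_derivative g (at x) v)" for v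
  proof (rule Suc.IH)
    show "Ck_on k S (\<lambda>x. frechet_derivative f (at x) v)" using Suc.prems by simp
  qed (use d frechet_derivative_at in metis)
  then show ?case using d by (auto simp: differentiable_def)
qed

lemma Ck_on_SucI:
  assumes "open S" "\<And>x. x \<in> S \<Longrightarrow> (f has_derivative f' x) (at x)"
    and "\<And>v. Ck_on k S (\<lambda>x. f' x v)"
  shows "Ck_on (Suc k) S f"
proof -
  have "Ck_on k S (\<lambda>x. frechet_derivative f (at x) v)" for v
    by (rule Ck_on_cong[OF assms(1) assms(3)[of v]]) (use assms(2) frechet_derivative_at in metis)
  then show ?thesis using assms(2) by (auto simp: differentiable_def)
qed

lemma Ck_on_SucE:
  assumes "Ck_on (Suc k) S f" "x \<in> S"
  shows "(f has_derivative frechet_derivative f (at x)) (at x)"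
  using assms by (simp add: frechet_derivative_works)

lemma Ck_on_Suc_imp: "Ck_on (Suc k) S f \<Longrightarrow> Ck_on k S f"
proof (induction k arbitrary: f)
  case 0
  then show ?case
    by (simp add: continuous_at_imp_continuous_on differentiable_imp_continuous_within)
next
  case (Suc k)
  then show ?case by simp
qed

lemma Ck_on_le: "Ck_on k S f \<Longrightarrow> j \<le> k \<Longrightarrow> Ck_on j S f"
  by (induction k) (auto simp: le_Suc_eq dest: Ck_on_Suc_imp simp del: Ck_on.simps)

lemma Ck_on_imp_continuous: "Ck_on k S f \<Longrightarrow> continuous_on S f"
  using Ck_on_le[of k S f 0] by simp

lemma Ck_on_const: "open S \<Longrightarrow> Ck_on k S (\<lambda>x. c)"
proof (induction k arbitrary: c)
  case (Suc k)
  show ?case by (rule Ck_on_SucI[where f'="\<lambda>x v. 0"]) (use Suc in \<open>auto intro!: derivative_eq_intros\<close>)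
qed simp

lemma Ck_on_linear:
  assumes "open S" "bounded_linear L" shows "Ck_on k S L"
proof (cases k)
  case 0
  then show ?thesis using assms by (simp add: linear_continuous_on)
next
  case (Suc j)
  show ?thesis unfolding Suc
    by (rule Ck_on_SucI[where f'="\<lambda>x. L"])
      (use assms in \<open>auto intro!: Ck_on_const bounded_linear_imp_has_derivative\<close>)
qed

lemma Ck_on_bounded_linear:
  assumes "open S" "bounded_linear L" "Ck_on k S f" shows "Ck_on k S (\<lambda>x. L (f x))"
  using assms(3)
proof (induction k arbitrary: f)
  case 0
  then show ?case using assms by (simp add: bounded_linear.continuous_on)
next
  case (Suc k)
  show ?case
    by (rule Ck_on_SucI[OF assms(1) bounded_linear.has_derivative[OF assms(2) Ck_on_SucE[OF Suc.prems]]])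
      (use Suc in auto)
qed

lemma Ck_on_add:
  assumes "open S" "Ck_on k S f" "Ck_on k S g" shows "Ck_on k S (\<lambda>x. f x + g x)"
  using assms(2,3)
proof (induction k arbitrary: f g)
  case 0
  then show ?case by (simp add: continuous_on_add)
next
  case (Suc k)
  show ?case
    by (rule Ck_on_SucI[OF assms(1) has_derivative_add[OF Ck_on_SucE[OF Suc.prems(1)] Ck_on_SucE[OF Suc.prems(2)]]])
      (use Suc in auto)
qed

lemma Ck_on_minus: "open S \<Longrightarrow> Ck_on k S f \<Longrightarrow> Ck_on k S (\<lambda>x. - f x)"
  by (rule Ck_on_bounded_linear[OF _ bounded_linear_minus[OF bounded_linear_ident]])

lemma Ck_on_diff:
  assumes "open S" "Ck_on k S f" "Ck_on k S g" shows "Ck_on k S (\<lambda>x. f x - g x)"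
  using Ck_on_add[OF assms(1,2) Ck_on_minus[OF assms(1,3)]] by simp

lemma Ck_on_sum:
  assumes "open S" "\<And>i. i \<in> I \<Longrightarrow> Ck_on k S (f i)" shows "Ck_on k S (\<lambda>x. \<Sum>i\<in>I. f i x)"
  using assms(2)
proof (induction I rule: infinite_finite_induct)
  case (insert i I)
  then show ?case using Ck_on_add[OF assms(1), of k "f i" "\<lambda>x. \<Sum>i\<in>I. f i x"] by simp
qed (auto simp: Ck_on_const assms(1))

lemma Ck_on_bilinear:
  assumes "open S" "bounded_bilinear B" "Ck_on k S f" "Ck_on k S g"
  shows "Ck_on k S (\<lambda>x. B (f x) (g x))"
  using assms(3,4)
proof (induction k arbitrary: f g)
  case 0
  then show ?case using assms by (simp add: bounded_bilinear.continuous_on)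
next
  case (Suc k)
  have "Ck_on k S f" "Ck_on k S g" using Suc.prems by (auto dest: Ck_on_Suc_imp simp del: Ck_on.simps)
  then show ?case
    by (rule_tac Ck_on_SucI[OF assms(1) bounded_bilinear.FDERIV[OF assms(2) Ck_on_SucE[OF Suc.prems(1)] Ck_on_SucE[OF Suc.prems(2)]]])
      (use Suc assms in \<open>auto intro!: Ck_on_add\<close>)
qed

lemmas Ck_on_scaleR = Ck_on_bilinear[OF _ bounded_bilinear_scaleR]
lemmas Ck_on_inner = Ck_on_bilinear[OF _ bounded_bilinear_inner]
lemmas Ck_on_mult = Ck_on_bilinear[OF _ bounded_bilinear_mult]

lemma Ck_on_Pair:
  assumes "open S" "Ck_on k S f" "Ck_on k S g" shows "Ck_on k S (\<lambda>x. (f x, g x))"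
proof -
  have "Ck_on k S (\<lambda>x. (f x, 0) + (0, g x))"
    by (intro Ck_on_add assms Ck_on_bounded_linear[OF _ _ assms(2), where L="\<lambda>y. (y, 0)"]
          Ck_on_bounded_linear[OF _ _ assms(3), where L="\<lambda>y. (0, y)"]
          bounded_linear_Pair bounded_linear_ident bounded_linear_zero)
  then show ?thesis by simp
qed

lemma Ck_on_componentwise:
  fixes f :: "'a::euclidean_space \<Rightarrow> 'b::euclidean_space"
  assumes "open S" "\<And>b. b \<in> Basis \<Longrightarrow> Ck_on k S (\<lambda>x. f x \<bullet> b)" shows "Ck_on k S f"
proof -
  have "Ck_on k S (\<lambda>x. \<Sum>b\<in>Basis. (f x \<bullet> b) *\<^sub>R b)"
    by (intro Ck_on_sum Ck_on_scaleR assms Ck_on_const) auto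
  then show ?thesis by (simp add: euclidean_representation)
qed

lemma linear_sum_Basis:
  fixes L :: "'a::euclidean_space \<Rightarrow> 'b::real_vector"
  assumes "linear L" shows "L v = (\<Sum>b\<in>Basis. (v \<bullet> b) *\<^sub>R L b)"
  using linear_sum[OF assms, of "\<lambda>b. (v \<bullet> b) *\<^sub>R b" Basis]
  by (simp add: euclidean_representation linear_scale[OF assms])

lemma Ck_on_compose:
  fixes g :: "'a::euclidean_space \<Rightarrow> 'b::euclidean_space"
  assumes "open S" "open T" "Ck_on k T f" "Ck_on k S g" "\<And>x. x \<in> S \<Longrightarrow> g x \<in> T"
  shows "Ck_on k S (\<lambda>x. f (g x))"
  using assms(3,4)
proof (induction k arbitrary: f)
  case 0
  then show ?case using assms(5) continuous_on_compose2[of T f S g] by force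
next
  case (Suc k)
  have g: "Ck_on k S g" using Suc.prems by (auto dest: Ck_on_Suc_imp simp del: Ck_on.simps)
  let ?f' = "\<lambda>x v. frechet_derivative f (at (g x)) (frechet_derivative g (at x) v)"
  have der: "((\<lambda>x. f (g x)) has_derivative ?f' x) (at x)" if "x \<in> S" for x
    using has_derivative_compose[OF Ck_on_SucE[OF Suc.prems(2) that], of f]
      Ck_on_SucE[OF Suc.prems(1) assms(5)[OF that]] by (simp add: o_def)
  \<comment> \<open>The direction in which \<open>f\<close> is differentiated moves with
    \<open>x\<close>, while the induction hypothesis speaks of fixed directions; hence the expansion
    in \<open>Basis\<close>.\<close>
  have eq: "?f' x v = (\<Sum>b\<in>Basis. (frechet_derivative g (at x) v \<bullet> b) *\<^sub>R frechet_derivative f (at (g x)) b)"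
    if "x \<in> S" for x v
    using Ck_on_SucE[OF Suc.prems(1) assms(5)[OF that]]
    by (intro linear_sum_Basis has_derivative_linear)
  show ?case
  proof (rule Ck_on_SucI[OF assms(1) der])
    fix v
    have "Ck_on k S (\<lambda>x. \<Sum>b\<in>Basis. (frechet_derivative g (at x) v \<bullet> b) *\<^sub>R frechet_derivative f (at (g x)) b)"
      using Suc.prems g by (intro Ck_on_sum Ck_on_scaleR Ck_on_inner Suc.IH Ck_on_const assms(1)) auto
    then show "Ck_on k S (\<lambda>x. ?f' x v)"
      by (rule Ck_on_cong[OF assms(1)]) (simp add: eq)
  qed
qed

text \<open>Lets regularity on an open ball be assembled from smaller balls, where compactness is
  available.\<close>

lemma Ck_on_local:
  assumes "open S" "\<And>x. x \<in> S \<Longrightarrow> \<exists>U. open U \<and> x \<in> U \<and> Ck_on k U f"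
  shows "Ck_on k S f"
  using assms(2)
proof (induction k arbitrary: f)
  case 0
  then show ?case
    by (auto intro!: continuous_at_imp_continuous_on dest: continuous_on_interior simp: interior_open)
      (metis continuous_on_interior interior_open)
next
  case (Suc k)
  have "Ck_on k S (\<lambda>x. frechet_derivative f (at x) v)" for v
    by (rule Suc.IH) (use Suc.prems in fastforce)
  moreover have "f differentiable at x" if "x \<in> S" for x
    using Suc.prems[OF that] by auto
  ultimately show ?case by simp
qed

text \<open>The derivative is a product of copies of the function itself, so each order of
  differentiability yields the next.\<close>

lemma Ck_on_inverse_real: "Ck_on k (- {0}) (inverse :: real \<Rightarrow> real)"
proof (induction k)
  case 0
  show ?case by (auto intro!: continuous_intros)
next
  case (Suc k)
  have "Ck_on k (- {0}) (\<lambda>x. - (inverse x * v * inverse x))" for v :: real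
    by (intro Ck_on_minus Ck_on_mult Suc.IH Ck_on_const) auto
  then show ?case
    by (intro Ck_on_SucI[where f'="\<lambda>x v. - (inverse x * v * inverse x)"] has_derivative_inverse') auto
qed

lemma Ck_on_inverse:
  fixes f :: "'a::euclidean_space \<Rightarrow> real"
  assumes "open S" "Ck_on k S f" "\<And>x. x \<in> S \<Longrightarrow> f x \<noteq> 0"
  shows "Ck_on k S (\<lambda>x. inverse (f x))"
  by (rule Ck_on_compose[OF assms(1) _ Ck_on_inverse_real assms(2)]) (use assms(3) in auto)

text \<open>The inverse of \<open>(y, v) \<mapsto> (y, A y v)\<close> is \<open>(y, v) \<mapsto> (y, I y v)\<close>.\<close>

lemma has_derivative_operator_inverse:
  fixes A I :: "'a::euclidean_space \<Rightarrow> 'b::euclidean_space \<Rightarrow> 'b"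
  assumes S: "open S" "y \<in> S" and lin: "\<And>y. y \<in> S \<Longrightarrow> linear (A y)" "\<And>y. y \<in> S \<Longrightarrow> linear (I y)"
    and inv: "\<And>y v. y \<in> S \<Longrightarrow> A y (I y v) = v" "\<And>y v. y \<in> S \<Longrightarrow> I y (A y v) = v"
    and bd: "\<And>y v. y \<in> S \<Longrightarrow> norm v \<le> C * norm (A y v)"
    and der: "\<And>v. ((\<lambda>y. A y v) has_derivative (\<lambda>h. A' v h)) (at y)"
  shows "((\<lambda>y. I y v) has_derivative (\<lambda>h. - I y (A' (I y v) h))) (at y)"
proof -
  \<comment> \<open>\<open>A\<close> is differentiable for each fixed vector only; expanded in
    \<open>Basis\<close>, the value \<open>A (fst z) (snd z)\<close> becomes differentiable in both
    arguments jointly.\<close>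
  let ?f = "\<lambda>z. (fst z, \<Sum>b\<in>Basis. (snd z \<bullet> b) *\<^sub>R A (fst z) b)"
  let ?g = "\<lambda>z. (fst z, I (fst z) (snd z))"
  let ?f' = "\<lambda>z. (fst z, A' (I y v) (fst z) + (\<Sum>b\<in>Basis. (snd z \<bullet> b) *\<^sub>R A y b))"
  let ?g' = "\<lambda>z. (fst z, I y (snd z - A' (I y v) (fst z)))"
  have Aeq: "(\<Sum>b\<in>Basis. (v \<bullet> b) *\<^sub>R A y b) = A y v" if "y \<in> S" for y v
    using linear_sum_Basis[OF lin(1)[OF that]] by metis
  have Ader: "A' w h = (\<Sum>b\<in>Basis. (w \<bullet> b) *\<^sub>R A' b h)" for w h
  proof -
    have "((\<lambda>y. \<Sum>b\<in>Basis. (w \<bullet> b) *\<^sub>R A y b) has_derivative (\<lambda>h. \<Sum>b\<in>Basis. (w \<bullet> b) *\<^sub>R A' b h)) (at y)"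
      by (auto intro!: derivative_eq_intros der)
    then have "((\<lambda>y. A y w) has_derivative (\<lambda>h. \<Sum>b\<in>Basis. (w \<bullet> b) *\<^sub>R A' b h)) (at y)"
      by (rule has_derivative_transform_within_open[OF _ S]) (simp add: Aeq)
    from has_derivative_unique[OF this der[of w]] show ?thesis by metis
  qed
  have linA': "linear (A' w)" for w using der has_derivative_linear by blast
  have derA: "((\<lambda>z. A (fst z) w) has_derivative (\<lambda>h. A' w (fst h))) (at (y, u))" for w u
    using has_derivative_compose[OF has_derivative_fst[OF has_derivative_ident, of "at (y, u)"], of "\<lambda>y. A y w" "A' w"] der
    by simp
  have g: "(?g has_derivative ?g') (at (y, v))"
  proof (rule has_derivative_inverse_basic)
    show "(?f has_derivative ?f') (at (?g (y, v)))"
      unfolding Ader[of "I y v"]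
      by (auto intro!: derivative_eq_intros derA simp: sum.distrib algebra_simps)
    have "linear (\<lambda>z. (fst z, I y (snd z - A' (I y v) (fst z))))"
      using linear_compose[OF linear_compose_sub[OF linear_snd linear_compose[OF linear_fst linA'[of "I y v"]]] lin(2)[OF S(2)]]
      by (intro bounded_linear_Pair[THEN bounded_linear.linear] bounded_linear_fst)
        (simp add: o_def linear_conv_bounded_linear)
    then show "bounded_linear ?g'"
      by (simp add: linear_conv_bounded_linear)
    show "?g' \<circ> ?f' = id"
      by (auto simp: Aeq S(2) inv)
    show "open (S \<times> UNIV)" using S by (auto intro: open_Times)
    show "?f (?g z) = z" if "z \<in> S \<times> UNIV" for z
      using that by (auto simp: Aeq inv)
    have "((\<lambda>z. I (fst z) (snd z)) \<longlongrightarrow> I y v) (at (y, v))"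
    proof -
      \<comment> \<open>The rule for inverses asks for continuity of the inverse beforehand. The
        bound \<open>bd\<close>, uniform in \<open>y'\<close>, reduces it to continuity of
        \<open>A\<close> at the fixed vector \<open>I y v\<close>.\<close>
      have nb: "norm (I y' v' - I y v) \<le> C * norm (v' - A y' (I y v))" if "y' \<in> S" for y' v'
        using bd[OF that, of "I y' v' - I y v"] lin(1)[OF that] inv(1)[OF that]
        by (simp add: linear_diff)
      have cA2: "isCont (\<lambda>y'. A y' (I y v)) y"
        using has_derivative_continuous[OF der[of "I y v"]] by simp
      have "isCont (\<lambda>z. A (fst z) (I y v)) (y, v)"
        using isCont_o2[of "(y, v)" fst "\<lambda>y'. A y' (I y v)"] cA2 by (simp add: continuous_fst)
      then have "((\<lambda>z. C * norm (snd z - A (fst z) (I y v))) \<longlongrightarrow> C * norm (v - A y (I y v))) (at (y, v))"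
        unfolding continuous_at by (intro tendsto_intros) (auto intro!: tendsto_eq_intros)
      then have "((\<lambda>z. C * norm (snd z - A (fst z) (I y v))) \<longlongrightarrow> 0) (at (y, v))"
        by (simp add: inv S)
      moreover have "\<forall>\<^sub>F z in at (y, v). norm (I (fst z) (snd z) - I y v) \<le> C * norm (snd z - A (fst z) (I y v))"
        unfolding eventually_at_topological
        by (rule exI[of _ "S \<times> UNIV"]) (use S nb in \<open>auto intro: open_Times\<close>)
      ultimately have "((\<lambda>z. I (fst z) (snd z) - I y v) \<longlongrightarrow> 0) (at (y, v))"
        by (rule_tac Lim_null_comparison)
      then show ?thesis by (rule LIM_zero_cancel)
    qed
    then show "continuous (at (y, v)) ?g"
      unfolding continuous_at by (auto intro!: tendsto_eq_intros)
  qed (use S in auto)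
  have p: "((\<lambda>z. (z, v)) has_derivative (\<lambda>h. (h, 0))) (at y)"
    by (auto intro!: derivative_eq_intros)
  have "((\<lambda>z. snd (?g (z, v))) has_derivative (\<lambda>h. snd (?g' (h, 0)))) (at y)"
    by (intro has_derivative_snd has_derivative_compose[OF p g])
  then show ?thesis
    using lin(2)[OF S(2)] by (simp add: linear_neg)
qed

text \<open>Bootstrap: the derivative of \<open>I\<close> is minus \<open>I\<close> after
  \<open>A'\<close> after \<open>I\<close>, so \<open>I\<close> being k times continuously
  differentiable makes it k+1 times so.\<close>

lemma smooth_on_operator_inverse:
  fixes A I :: "'a::euclidean_space \<Rightarrow> 'b::euclidean_space \<Rightarrow> 'b"
  assumes S: "open S" and lin: "\<And>y. y \<in> S \<Longrightarrow> linear (A y)" "\<And>y. y \<in> S \<Longrightarrow> linear (I y)"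
    and inv: "\<And>y v. y \<in> S \<Longrightarrow> A y (I y v) = v" "\<And>y v. y \<in> S \<Longrightarrow> I y (A y v) = v"
    and bd: "\<And>y v. y \<in> S \<Longrightarrow> norm v \<le> C * norm (A y v)"
    and A: "\<And>v. smooth_on S (\<lambda>y. A y v)"
  shows "smooth_on S (\<lambda>y. I y v)"
proof -
  let ?A' = "\<lambda>y w h. frechet_derivative (\<lambda>y. A y w) (at y) h"
  have A': "((\<lambda>y. A y w) has_derivative ?A' y w) (at y)" if "y \<in> S" for y w
    using A[of w] that Ck_on_SucE unfolding smooth_on_def by blast
  have der: "((\<lambda>y. I y v) has_derivative (\<lambda>h. - I y (?A' y (I y v) h))) (at y)" if "y \<in> S" for y v
    by (rule has_derivative_operator_inverse[OF S that lin inv bd A'[OF that]])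
  have A'sum: "?A' y w h = (\<Sum>b\<in>Basis. (w \<bullet> b) *\<^sub>R ?A' y b h)" if y: "y \<in> S" for y w h
  proof -
    have "((\<lambda>y. \<Sum>b\<in>Basis. (w \<bullet> b) *\<^sub>R A y b) has_derivative (\<lambda>h. \<Sum>b\<in>Basis. (w \<bullet> b) *\<^sub>R ?A' y b h)) (at y)"
      by (auto intro!: derivative_eq_intros A' y)
    then have "((\<lambda>y. A y w) has_derivative (\<lambda>h. \<Sum>b\<in>Basis. (w \<bullet> b) *\<^sub>R ?A' y b h)) (at y)"
      by (rule has_derivative_transform_within_open[OF _ S y]) (metis linear_sum_Basis lin(1))
    from has_derivative_unique[OF this A'[OF y]] show ?thesis by metis
  qed
  \<comment> \<open>The induction hypothesis covers \<open>I\<close> at fixed vectors only, so both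
    the inner and the outer application of \<open>I\<close> are expanded in
    \<open>Basis\<close>.\<close>
  have Isum: "- I y (?A' y (I y v) h) =
      (\<Sum>c\<in>Basis. - ((\<Sum>b\<in>Basis. (I y v \<bullet> b) *\<^sub>R ?A' y b h) \<bullet> c) *\<^sub>R I y c)" if y: "y \<in> S" for y v h
  proof -
    have "- I y u = (\<Sum>c\<in>Basis. - (u \<bullet> c) *\<^sub>R I y c)" for u
      by (subst linear_sum_Basis[OF lin(2)[OF y]]) (simp add: sum_negf)
    then show ?thesis unfolding A'sum[OF y, of "I y v"] .
  qed
  have "Ck_on k S (\<lambda>y. I y v)" for k v
  proof (induction k arbitrary: v)
    case 0
    show ?case
      using der by (auto intro!: continuous_at_imp_continuous_on dest: has_derivative_continuous)
  next
    case (Suc k)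
    have "Ck_on k S (\<lambda>y. ?A' y b h)" for b h
      using A[of b] unfolding smooth_on_def by (metis Ck_on.simps(2))
    then have "Ck_on k S (\<lambda>y. \<Sum>c\<in>Basis. - ((\<Sum>b\<in>Basis. (I y v \<bullet> b) *\<^sub>R ?A' y b h) \<bullet> c) *\<^sub>R I y c)" for h
      by (intro Ck_on_sum Ck_on_scaleR Ck_on_minus Ck_on_inner Ck_on_const S Suc.IH)
    then have "Ck_on k S (\<lambda>y. - I y (?A' y (I y v) h))" for h
      by (rule Ck_on_cong[OF S]) (simp add: Isum)
    then show ?case
      using Ck_on_SucI[OF S der] by blast
  qed
  then show ?thesis by (simp add: smooth_on_def)
qed

section \<open>Smooth maps and operator fields given pointwise\<close>

lemma smooth_onD: "smooth_on S f \<Longrightarrow> x \<in> S \<Longrightarrow> (f has_derivative frechet_derivative f (at x)) (at x)"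
  unfolding smooth_on_def using Ck_on_SucE by blast

lemma smooth_on_frechet_derivative:
  "smooth_on S f \<Longrightarrow> smooth_on S (\<lambda>x. frechet_derivative f (at x) v)"
  unfolding smooth_on_def by (metis Ck_on.simps(2))

lemma smooth_on_imp_continuous: "smooth_on S f \<Longrightarrow> continuous_on S f"
  unfolding smooth_on_def using Ck_on_imp_continuous by blast

lemma smooth_on_subset: "smooth_on T f \<Longrightarrow> S \<subseteq> T \<Longrightarrow> smooth_on S f"
  by (auto simp: smooth_on_def intro: Ck_on_subset)

lemma smooth_on_cong: "open S \<Longrightarrow> smooth_on S f \<Longrightarrow> (\<And>x. x \<in> S \<Longrightarrow> f x = g x) \<Longrightarrow> smooth_on S g"
  by (metis Ck_on_cong smooth_on_def)

lemma smooth_on_compose: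
  fixes g :: "'a::euclidean_space \<Rightarrow> 'b::euclidean_space"
  assumes "open S" "open T" "smooth_on T f" "smooth_on S g" "\<And>x. x \<in> S \<Longrightarrow> g x \<in> T"
  shows "smooth_on S (\<lambda>x. f (g x))"
  using assms by (auto simp: smooth_on_def intro: Ck_on_compose)

lemma smooth_on_const: "open S \<Longrightarrow> smooth_on S (\<lambda>x. c)"
  by (simp add: smooth_on_def Ck_on_const)

lemma smooth_on_linear: "open S \<Longrightarrow> bounded_linear L \<Longrightarrow> smooth_on S L"
  by (simp add: smooth_on_def Ck_on_linear)

lemma smooth_on_bounded_linear:
  "open S \<Longrightarrow> bounded_linear L \<Longrightarrow> smooth_on S f \<Longrightarrow> smooth_on S (\<lambda>x. L (f x))"
  by (simp add: smooth_on_def Ck_on_bounded_linear)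

lemma smooth_on_add: "open S \<Longrightarrow> smooth_on S f \<Longrightarrow> smooth_on S g \<Longrightarrow> smooth_on S (\<lambda>x. f x + g x)"
  by (simp add: smooth_on_def Ck_on_add)

lemma smooth_on_diff: "open S \<Longrightarrow> smooth_on S f \<Longrightarrow> smooth_on S g \<Longrightarrow> smooth_on S (\<lambda>x. f x - g x)"
  by (simp add: smooth_on_def Ck_on_diff)

lemma smooth_on_sum:
  "open S \<Longrightarrow> (\<And>i. i \<in> I \<Longrightarrow> smooth_on S (f i)) \<Longrightarrow> smooth_on S (\<lambda>x. \<Sum>i\<in>I. f i x)"
  by (simp add: smooth_on_def Ck_on_sum)

lemma smooth_on_scaleR: "open S \<Longrightarrow> smooth_on S f \<Longrightarrow> smooth_on S g \<Longrightarrow> smooth_on S (\<lambda>x. f x *\<^sub>R g x)"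
  by (simp add: smooth_on_def Ck_on_scaleR)

lemma smooth_on_inner: "open S \<Longrightarrow> smooth_on S f \<Longrightarrow> smooth_on S g \<Longrightarrow> smooth_on S (\<lambda>x. f x \<bullet> g x)"
  by (simp add: smooth_on_def Ck_on_inner)

lemma smooth_on_mult:
  fixes f g :: "'a::euclidean_space \<Rightarrow> real"
  shows "open S \<Longrightarrow> smooth_on S f \<Longrightarrow> smooth_on S g \<Longrightarrow> smooth_on S (\<lambda>x. f x * g x)"
  by (simp add: smooth_on_def Ck_on_mult)

lemma smooth_on_Pair: "open S \<Longrightarrow> smooth_on S f \<Longrightarrow> smooth_on S g \<Longrightarrow> smooth_on S (\<lambda>x. (f x, g x))"
  by (simp add: smooth_on_def Ck_on_Pair)

lemma smooth_on_componentwise: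
  fixes f :: "'a::euclidean_space \<Rightarrow> 'b::euclidean_space"
  shows "open S \<Longrightarrow> (\<And>b. b \<in> Basis \<Longrightarrow> smooth_on S (\<lambda>x. f x \<bullet> b)) \<Longrightarrow> smooth_on S f"
  by (simp add: smooth_on_def Ck_on_componentwise)

lemma smooth_on_inverse:
  fixes f :: "'a::euclidean_space \<Rightarrow> real"
  shows "open S \<Longrightarrow> smooth_on S f \<Longrightarrow> (\<And>x. x \<in> S \<Longrightarrow> f x \<noteq> 0) \<Longrightarrow> smooth_on S (\<lambda>x. inverse (f x))"
  by (simp add: smooth_on_def Ck_on_inverse)

lemma smooth_on_apply:
  fixes A :: "'a::euclidean_space \<Rightarrow> 'b::euclidean_space \<Rightarrow> 'c::real_normed_vector"
  assumes "open S" "\<And>y. y \<in> S \<Longrightarrow> linear (A y)" "\<And>v. smooth_on S (\<lambda>y. A y v)" "smooth_on S w"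
  shows "smooth_on S (\<lambda>y. A y (w y))"
proof -
  have "smooth_on S (\<lambda>y. \<Sum>b\<in>Basis. (w y \<bullet> b) *\<^sub>R A y b)"
    by (intro smooth_on_sum smooth_on_scaleR smooth_on_inner smooth_on_const assms)
  then show ?thesis
    by (rule smooth_on_cong[OF assms(1)]) (metis linear_sum_Basis assms(2))
qed

text \<open>The product rule for evaluating an operator field at a moving vector, with the operator
  field differentiated at fixed vectors only.\<close>

lemma has_derivative_apply:
  fixes A :: "'a::euclidean_space \<Rightarrow> 'b::euclidean_space \<Rightarrow> 'c::real_normed_vector"
  assumes "open S" "y \<in> S" "\<And>y. y \<in> S \<Longrightarrow> linear (A y)" "\<And>v. ((\<lambda>y. A y v) has_derivative A' v) (at y)"
    "(w has_derivative w') (at y)"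
  shows "((\<lambda>y. A y (w y)) has_derivative (\<lambda>h. A' (w y) h + A y (w' h))) (at y)"
proof -
  have eq: "(\<Sum>b\<in>Basis. (w \<bullet> b) *\<^sub>R A y b) = A y w" if "y \<in> S" for y w
    using linear_sum_Basis[OF assms(3)[OF that]] by metis
  have Asum: "A' w h = (\<Sum>b\<in>Basis. (w \<bullet> b) *\<^sub>R A' b h)" for w h
  proof -
    have "((\<lambda>y. \<Sum>b\<in>Basis. (w \<bullet> b) *\<^sub>R A y b) has_derivative (\<lambda>h. \<Sum>b\<in>Basis. (w \<bullet> b) *\<^sub>R A' b h)) (at y)"
      by (auto intro!: derivative_eq_intros assms)
    then have "((\<lambda>y. A y w) has_derivative (\<lambda>h. \<Sum>b\<in>Basis. (w \<bullet> b) *\<^sub>R A' b h)) (at y)"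
      by (rule has_derivative_transform_within_open[OF _ assms(1,2)]) (simp add: eq)
    from has_derivative_unique[OF this assms(4)] show ?thesis by metis
  qed
  have "((\<lambda>y. \<Sum>b\<in>Basis. (w y \<bullet> b) *\<^sub>R A y b) has_derivative
      (\<lambda>h. \<Sum>b\<in>Basis. (w y \<bullet> b) *\<^sub>R A' b h + (w' h \<bullet> b) *\<^sub>R A y b)) (at y)"
    by (auto intro!: derivative_eq_intros assms)
  then have "((\<lambda>y. A y (w y)) has_derivative
      (\<lambda>h. \<Sum>b\<in>Basis. (w y \<bullet> b) *\<^sub>R A' b h + (w' h \<bullet> b) *\<^sub>R A y b)) (at y)"
    by (rule has_derivative_transform_within_open[OF _ assms(1,2)]) (simp add: eq)
  then show ?thesis
    unfolding Asum[of "w y"] by (simp add: sum.distrib eq assms)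
qed

text \<open>In finite dimension, pointwise continuity of operators is continuity in norm. This links
  \<open>Ck_on\<close>, which is stated by directional derivatives, to results about operator-valued
  derivatives.\<close>

lemma continuous_on_Blinfun_derivative:
  fixes f' :: "'c::t2_space \<Rightarrow> 'a::euclidean_space \<Rightarrow> 'b::real_normed_vector"
  assumes "\<And>x. x \<in> S \<Longrightarrow> linear (f' x)" "\<And>v. continuous_on S (\<lambda>x. f' x v)"
  shows "continuous_on S (\<lambda>x. Blinfun (f' x) :: 'a \<Rightarrow>\<^sub>L 'b)"
    and "x \<in> S \<Longrightarrow> blinfun_apply (Blinfun (f' x) :: 'a \<Rightarrow>\<^sub>L 'b) = f' x"
proof -
  show ap: "blinfun_apply (Blinfun (f' x) :: 'a \<Rightarrow>\<^sub>L 'b) = f' x" if "x \<in> S" for x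
    using assms(1)[OF that] by (simp add: bounded_linear_Blinfun_apply linear_conv_bounded_linear)
  show "continuous_on S (\<lambda>x. Blinfun (f' x) :: 'a \<Rightarrow>\<^sub>L 'b)"
    by (rule continuous_on_blinfun_componentwise)
      (rule continuous_on_eq[OF assms(2)], simp add: ap)
qed

text \<open>The C1 theorem yields \<open>g\<close> with derivative \<open>I (g y)\<close>, where
  \<open>I x\<close> inverts the derivative of \<open>f\<close> at \<open>x\<close>. As
  \<open>I\<close> is smooth by \<open>smooth_on_operator_inverse\<close>, each order of regularity
  of \<open>g\<close> gives the next one.\<close>

lemma smooth_inverse_function_theorem:
  fixes f :: "'a::euclidean_space \<Rightarrow> 'a"
  assumes "open U" "smooth_on U f" "x0 \<in> U"
    and inj: "\<And>v. frechet_derivative f (at x0) v = 0 \<Longrightarrow> v = 0"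
  obtains U' V g where "open U'" "U' \<subseteq> U" "x0 \<in> U'" "open V" "homeomorphism U' V f g" "smooth_on V g"
    "\<And>x v. x \<in> U' \<Longrightarrow> frechet_derivative g (at (f x)) (frechet_derivative f (at x) v) = v"
    "\<And>x v. x \<in> U' \<Longrightarrow> frechet_derivative f (at x) (frechet_derivative g (at (f x)) v) = v"
proof -
  let ?D = "\<lambda>x. frechet_derivative f (at x)"
  define f' where "f' x = Blinfun (?D x)" for x
  have der: "(f has_derivative ?D x) (at x)" if "x \<in> U" for x
    using smooth_onD[OF assms(2) that] .
  have lin: "linear (?D x)" if "x \<in> U" for x using der[OF that] has_derivative_linear by blast
  have cont: "continuous_on U (\<lambda>x. ?D x v)" for v
    by (intro smooth_on_imp_continuous smooth_on_frechet_derivative assms)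
  have ap: "blinfun_apply (f' x) = ?D x" if "x \<in> U" for x
    unfolding f'_def using continuous_on_Blinfun_derivative(2)[OF lin cont that] .
  have cf': "continuous_on U f'"
    unfolding f'_def using continuous_on_Blinfun_derivative(1)[OF lin cont] .
  have inj0: "inj (?D x0)"
    using inj lin[OF assms(3)] linear_injective_0 by blast
  obtain B where B: "B > 0" "\<And>v. B * norm v \<le> norm (?D x0 v)"
    using linear_inj_bounded_below_pos[OF lin[OF assms(3)] inj0] by blast
  \<comment> \<open>Staying within half of the lower bound \<open>B\<close> keeps the lower bound
    \<open>B / 2\<close> on all of \<open>U0\<close>; this is the uniform estimate that inverting
    the operators smoothly requires.\<close>
  obtain U0 where U0: "open U0" "x0 \<in> U0" "U0 \<subseteq> U" "\<And>x. x \<in> U0 \<Longrightarrow> norm (f' x - f' x0) < B / 2"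
  proof -
    have "open (U \<inter> f' -` ball (f' x0) (B/2))"
      using cf' assms(1) by (intro continuous_open_preimage) auto
    moreover have "x0 \<in> U \<inter> f' -` ball (f' x0) (B/2)" using assms(3) B by simp
    ultimately show ?thesis
      by (intro that[of "U \<inter> f' -` ball (f' x0) (B/2)"]) (auto simp: dist_norm norm_minus_commute)
  qed
  have bd: "norm v \<le> (2 / B) * norm (?D x v)" if "x \<in> U0" for x v
  proof -
    have "norm ((f' x - f' x0) v) \<le> (B/2) * norm v"
      using norm_blinfun[of "f' x - f' x0" v] U0(4)[OF that]
      by (meson less_eq_real_def mult_right_mono norm_ge_zero order_trans)
    moreover have "(f' x - f' x0) v = ?D x v - ?D x0 v"
      using ap U0 that assms(3) by (auto simp: blinfun.diff_left)
    ultimately have "norm (?D x v - ?D x0 v) \<le> (B/2) * norm v" by simp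
    then have "B / 2 * norm v \<le> norm (?D x v)"
      using B(2)[of v] norm_triangle_ineq2[of "?D x0 v" "?D x v"] by (simp add: norm_minus_commute)
    then show ?thesis using B(1) by (simp add: field_simps)
  qed
  define I where "I x = inv (?D x)" for x
  have bij: "bij (?D x)" if "x \<in> U0" for x
  proof -
    have l: "linear (?D x)" using lin U0 that by blast
    have "inj (?D x)" unfolding linear_injective_0[OF l]
      using bd[OF that] by (metis norm_zero mult_zero_right norm_le_zero_iff)
    then show ?thesis using linear_injective_imp_surjective[OF l] by (simp add: bij_def)
  qed
  have DI: "?D x (I x v) = v" "I x (?D x v) = v" if "x \<in> U0" for x v
    using bij[OF that] unfolding I_def by (simp_all add: bij_is_surj surj_f_inv_f bij_is_inj inv_f_f)
  have linI: "linear (I x)" if "x \<in> U0" for x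
  proof -
    have l: "linear (?D x)" using lin U0 that by blast
    show ?thesis
      by (intro linearI) (metis DI that linear_add[OF l], metis DI that linear_scale[OF l])
  qed
  have sI: "smooth_on U0 (\<lambda>x. I x v)" for v
    by (rule smooth_on_operator_inverse[OF U0(1) lin linI DI bd])
      (use U0 assms in \<open>auto intro: smooth_on_subset smooth_on_frechet_derivative\<close>)
  have invf: "Blinfun (I x0) o\<^sub>L f' x0 = id_blinfun"
    by (rule blinfun_eqI)
      (use DI U0 linI ap assms in \<open>auto simp: bounded_linear_Blinfun_apply linear_conv_bounded_linear\<close>)
  obtain U' V g g' where g: "open U'" "U' \<subseteq> U0" "x0 \<in> U'" "open V" "f x0 \<in> V" "homeomorphism U' V f g"
    "\<And>y. y \<in> V \<Longrightarrow> (g has_derivative (g' y)) (at y)"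
    "\<And>y. y \<in> V \<Longrightarrow> g' y = inv (blinfun_apply (f'(g y)))"
  proof (rule inverse_function_theorem[where f=f and f'=f' and invf="Blinfun (I x0)", OF U0(1) _ _ U0(2) invf])
    show "(f has_derivative blinfun_apply (f' x)) (at x)" if "x \<in> U0" for x
      using that U0(3) ap der by (metis subsetD)
    show "continuous_on U0 f'" using cf' U0(3) continuous_on_subset by blast
  qed (use that in blast)
  have gV: "g y \<in> U'" if "y \<in> V" for y using g(6) that unfolding homeomorphism_def by blast
  have g'I: "g' y = I (g y)" if "y \<in> V" for y
    using g(8)[OF that] gV[OF that] ap g(2) U0(3) unfolding I_def by (metis subsetD)
  have "Ck_on k V g" for k
  proof (induction k)
    case 0
    show ?case using g(6) by (simp add: homeomorphism_def)
  next
    case (Suc k)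
    have "Ck_on k V (\<lambda>y. I (g y) v)" for v
      by (rule Ck_on_compose[OF g(4) U0(1) _ Suc.IH]) (use sI gV g(2) in \<open>auto simp: smooth_on_def\<close>)
    then have "Ck_on k V (\<lambda>y. g' y v)" for v
      by (rule Ck_on_cong[OF g(4)]) (simp add: g'I)
    then show ?case using Ck_on_SucI[OF g(4) g(7)] by blast
  qed
  then have sg: "smooth_on V g" by (simp add: smooth_on_def)
  have Dg: "frechet_derivative g (at (f x)) = I x" if "x \<in> U'" for x
  proof -
    have "f x \<in> V" "g (f x) = x" using g(6) that unfolding homeomorphism_def by blast+
    then show ?thesis using g'I g(7) frechet_derivative_at by metis
  qed
  show ?thesis
    by (rule that[OF g(1) _ g(3,4,6) sg]) (use g(2) U0(3) Dg DI in auto)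
qed

text \<open>Mean value inequality in the direction \<open>w\<close>: both base points stay close to
  \<open>x\<close>, where the first-order expansion of the \<open>w\<close>-derivative applies, and
  its linear part contributes exactly \<open>A v\<close>.\<close>

lemma second_difference_limit:
  fixes f :: "'a::euclidean_space \<Rightarrow> 'b::real_normed_vector"
  assumes "open S" "x \<in> S" "\<And>y. y \<in> S \<Longrightarrow> (f has_derivative f' y) (at y)"
    and A: "((\<lambda>y. f' y w) has_derivative A) (at x)" and "e > 0"
  shows "\<exists>d>0. \<forall>h. 0 < h \<and> h < d \<longrightarrow>
    norm (f (x + h *\<^sub>R v + h *\<^sub>R w) - f (x + h *\<^sub>R v) - f (x + h *\<^sub>R w) + f x - (h * h) *\<^sub>R A v) \<le> e * (h * h)"
proof -
  interpret A: bounded_linear A using A has_derivative_bounded_linear by blast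
  \<comment> \<open>\<open>h * M\<close> dominates each of the two displacements from
    \<open>x\<close> as well as the sum of their norms; the summand 1 keeps \<open>M\<close>
    positive.\<close>
  define M where "M = 2 * norm v + 2 * norm w + 1"
  have M: "M > 0" unfolding M_def using norm_ge_zero[of v] norm_ge_zero[of w] by linarith
  have "\<exists>d>0. \<forall>y. norm (y - x) < d \<longrightarrow> norm (f' y w - f' x w - A (y - x)) \<le> (e / M) * norm (y - x)"
    using A divide_pos_pos[OF \<open>e > 0\<close> M] unfolding has_derivative_at_alt by blast
  then obtain d1 where d1: "d1 > 0"
    "\<And>y. norm (y - x) < d1 \<Longrightarrow> norm (f' y w - f' x w - A (y - x)) \<le> (e / M) * norm (y - x)"
    by blast
  obtain d2 where d2: "d2 > 0" "ball x d2 \<subseteq> S" using assms open_contains_ball by metis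
  define d where "d = min d1 d2 / M"
  have "d > 0" unfolding d_def using d1 d2 M by simp
  moreover have "norm (f (x + h *\<^sub>R v + h *\<^sub>R w) - f (x + h *\<^sub>R v) - f (x + h *\<^sub>R w) + f x - (h * h) *\<^sub>R A v) \<le> e * (h * h)"
    if h: "0 < h" "h < d" for h
  proof -
    have hM: "h * M < min d1 d2" using h M unfolding d_def by (simp add: field_simps)
    have small: "norm (h *\<^sub>R u + (t * h) *\<^sub>R w) \<le> h * (norm u + norm w)" if "0 \<le> t" "t \<le> 1" for t u
    proof -
      have "norm (h *\<^sub>R u + (t * h) *\<^sub>R w) \<le> norm (h *\<^sub>R u) + norm ((t * h) *\<^sub>R w)" by (rule norm_triangle_ineq)
      also have "\<dots> \<le> h * norm u + 1 * h * norm w"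
        using that h by (auto intro!: add_mono mult_right_mono mult_left_le_one_le)
      finally show ?thesis by (simp add: algebra_simps)
    qed
    have near: "norm (h *\<^sub>R u + (t * h) *\<^sub>R w) < d1" "norm (h *\<^sub>R u + (t * h) *\<^sub>R w) < d2"
      if "0 \<le> t" "t \<le> 1" "u = v \<or> u = 0" for t u
    proof -
      have "h * (norm u + norm w) \<le> h * M" unfolding M_def using that h
        using norm_ge_zero[of v] norm_ge_zero[of w] by (intro mult_left_mono) auto
      then show "norm (h *\<^sub>R u + (t * h) *\<^sub>R w) < d1" "norm (h *\<^sub>R u + (t * h) *\<^sub>R w) < d2"
        using small[OF that(1,2), of u] hM by auto
    qed
    have inS: "x + (h *\<^sub>R u + (t * h) *\<^sub>R w) \<in> S" if "0 \<le> t" "t \<le> 1" "u = v \<or> u = 0" for t u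
      by (rule subsetD[OF d2(2)]) (simp only: mem_ball dist_norm norm_minus_commute[of x] add_diff_cancel_left' near(2)[OF that])
    \<comment> \<open>The summand \<open>h *\<^sub>R 0\<close> gives both base points the common
      form treated by \<open>small\<close>, \<open>near\<close> and \<open>inS\<close>, with
      \<open>u = v\<close> or \<open>u = 0\<close>.\<close>
    let ?k = "\<lambda>t. f (x + (h *\<^sub>R v + (t * h) *\<^sub>R w)) - f (x + (h *\<^sub>R 0 + (t * h) *\<^sub>R w)) - t *\<^sub>R (h * h) *\<^sub>R A v"
    let ?k' = "\<lambda>t s. f' (x + (h *\<^sub>R v + (t * h) *\<^sub>R w)) ((s * h) *\<^sub>R w)
        - f' (x + (h *\<^sub>R 0 + (t * h) *\<^sub>R w)) ((s * h) *\<^sub>R w) - s *\<^sub>R (h * h) *\<^sub>R A v"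
    have dk: "(?k has_derivative ?k' t) (at t within {0..1})" if "t \<in> {0..1}" for t
    proof -
      have c: "((\<lambda>t. f (x + (h *\<^sub>R u + (t * h) *\<^sub>R w))) has_derivative
          (\<lambda>s. f' (x + (h *\<^sub>R u + (t * h) *\<^sub>R w)) ((s * h) *\<^sub>R w))) (at t within {0..1})"
        if "u = v \<or> u = 0" for u
        by (rule has_derivative_compose[of "\<lambda>t. x + (h *\<^sub>R u + (t * h) *\<^sub>R w)"])
           (use \<open>t \<in> {0..1}\<close> that assms(3) inS in \<open>auto intro!: derivative_eq_intros\<close>)
      show ?thesis by (intro has_derivative_diff c) (auto intro!: derivative_eq_intros)
    qed
    have onk: "onorm (?k' t) \<le> e * (h * h)" if "t \<in> {0..1}" for t
    proof (rule onorm_le)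
      fix s :: real
      let ?a = "h *\<^sub>R v + (t * h) *\<^sub>R w" and ?b = "h *\<^sub>R 0 + (t * h) *\<^sub>R w"
      have t: "0 \<le> t" "t \<le> 1" using that by auto
      have lin: "linear (f' (x + ?a))" "linear (f' (x + ?b))"
        using assms(3) inS[OF t] has_derivative_linear by blast+
      have 1: "norm (f' (x + ?a) w - f' x w - A ?a) \<le> e / M * norm ?a"
        using d1(2)[of "x + ?a"] near(1)[OF t, of v] by simp
      have 2: "norm (f' (x + ?b) w - f' x w - A ?b) \<le> e / M * norm ?b"
        using d1(2)[of "x + ?b"] near(1)[OF t, of 0] by simp
      define P where "P = f' (x + ?a) w - f' x w - A ?a"
      define Q where "Q = f' (x + ?b) w - f' x w - A ?b"
      have PQ: "norm (P - Q) \<le> e / M * norm ?a + e / M * norm ?b"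
        using norm_triangle_ineq4[of P Q] 1 2 unfolding P_def Q_def by linarith
      have "?k' t s = (s * h) *\<^sub>R (P - Q)"
        unfolding P_def Q_def
        using lin by (simp only: linear_scale A.add A.scaleR A.zero) (simp add: algebra_simps A.scaleR)
      then have "norm (?k' t s) \<le> \<bar>s * h\<bar> * (e / M * norm ?a + e / M * norm ?b)"
        using PQ by (simp only: norm_scaleR) (rule mult_left_mono, auto)
      also have "\<dots> \<le> \<bar>s * h\<bar> * (e / M * (h * M))"
      proof -
        have "norm ?a + norm ?b \<le> h * (norm v + norm w) + h * (norm (0::'a) + norm w)"
          using small[OF t, of v] small[OF t, of 0] by (rule add_mono)
        also have "\<dots> = h * (norm v + 2 * norm w)" by (simp add: algebra_simps)
        also have "\<dots> \<le> h * M" unfolding M_def using h by (intro mult_left_mono) auto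
        finally have "e / M * (norm ?a + norm ?b) \<le> e / M * (h * M)"
          using \<open>e > 0\<close> M by (intro mult_left_mono) auto
        then have "e / M * norm ?a + e / M * norm ?b \<le> e / M * (h * M)" by (simp only: distrib_left)
        then show ?thesis by (rule mult_left_mono) simp
      qed
      also have "\<dots> = e * (h * h) * norm s" using M h by (simp add: abs_mult)
      finally show "norm (?k' t s) \<le> e * (h * h) * norm s" .
    qed
    have "norm (?k 1 - ?k 0) \<le> e * (h * h) * norm (1 - 0 :: real)"
      by (rule differentiable_bound[OF convex_real_interval(5) dk onk]) auto
    then show ?thesis by (simp add: algebra_simps)
  qed
  ultimately show ?thesis by blast
qed

text \<open>Exchanging \<open>v\<close> and \<open>w\<close> leaves the second difference unchanged,
  and divided by \<open>h * h\<close> it approaches both \<open>A v\<close> and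
  \<open>B w\<close>.\<close>

lemma second_derivative_symmetric:
  fixes f :: "'a::euclidean_space \<Rightarrow> 'b::real_normed_vector"
  assumes S: "open S" "x \<in> S" and f: "\<And>y. y \<in> S \<Longrightarrow> (f has_derivative f' y) (at y)"
    and A: "((\<lambda>y. f' y w) has_derivative A) (at x)" and B: "((\<lambda>y. f' y v) has_derivative B) (at x)"
  shows "A v = B w"
proof (rule ccontr)
  assume "A v \<noteq> B w"
  \<comment> \<open>A third of the gap: two errors of size \<open>e\<close> add up to less than the
    gap.\<close>
  define e where "e = norm (A v - B w) / 3"
  have e: "e > 0" using \<open>A v \<noteq> B w\<close> by (simp add: e_def)
  obtain d1 where d1: "d1 > 0" "\<And>h. 0 < h \<and> h < d1 \<Longrightarrow>
    norm (f (x + h *\<^sub>R v + h *\<^sub>R w) - f (x + h *\<^sub>R v) - f (x + h *\<^sub>R w) + f x - (h * h) *\<^sub>R A v) \<le> e * (h * h)"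
    using second_difference_limit[OF S f A e, of v] by blast
  obtain d2 where d2: "d2 > 0" "\<And>h. 0 < h \<and> h < d2 \<Longrightarrow>
    norm (f (x + h *\<^sub>R w + h *\<^sub>R v) - f (x + h *\<^sub>R w) - f (x + h *\<^sub>R v) + f x - (h * h) *\<^sub>R B w) \<le> e * (h * h)"
    using second_difference_limit[OF S f B e, of w] by blast
  define h where "h = min d1 d2 / 2"
  have h: "0 < h" "h < d1" "h < d2" using d1 d2 by (auto simp: h_def)
  define \<Delta> where "\<Delta> = f (x + h *\<^sub>R v + h *\<^sub>R w) - f (x + h *\<^sub>R v) - f (x + h *\<^sub>R w) + f x"
  have 1: "norm (\<Delta> - (h * h) *\<^sub>R A v) \<le> e * (h * h)" unfolding \<Delta>_def using d1(2) h by blast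
  have 2: "norm (\<Delta> - (h * h) *\<^sub>R B w) \<le> e * (h * h)"
    unfolding \<Delta>_def using d2(2)[of h] h by (simp add: algebra_simps)
  have "(h * h) *\<^sub>R (A v - B w) = (\<Delta> - (h * h) *\<^sub>R B w) - (\<Delta> - (h * h) *\<^sub>R A v)"
    by (simp add: algebra_simps)
  then have "norm ((h * h) *\<^sub>R (A v - B w)) \<le> e * (h * h) + e * (h * h)"
    using norm_triangle_ineq4[of "\<Delta> - (h * h) *\<^sub>R B w" "\<Delta> - (h * h) *\<^sub>R A v"] 1 2
      \<open>(h * h) *\<^sub>R (A v - B w) = _\<close> by simp
  then have "(h * h) * norm (A v - B w) \<le> (h * h) * (2 * e)" using h by simp
  then have "norm (A v - B w) \<le> 2 * e" using h by (simp only: mult_le_cancel_left_pos[OF mult_pos_pos[OF h(1) h(1)]])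
  then show False using e by (simp add: e_def)
qed

section \<open>Smoothness of fixed points of radial integral equations\<close>

text \<open>Evaluate the hypothesis at a maximum point, with the maximum as \<open>M\<close>, and
  absorb the half. This replaces Gronwall's inequality in all estimates along rays.\<close>

lemma sup_half_bound:
  fixes h :: "real \<Rightarrow> real"
  assumes "continuous_on {0..1} h"
    and "\<And>s M. s \<in> {0..1} \<Longrightarrow> (\<And>t. t \<in> {0..1} \<Longrightarrow> h t \<le> M) \<Longrightarrow> h s \<le> c + M / 2"
    and "s \<in> {0..1}"
  shows "h s \<le> 2 * c"
proof -
  obtain m where m: "m \<in> {0..1}" "\<And>t. t \<in> {0..1} \<Longrightarrow> h t \<le> h m"
    using continuous_attains_sup[OF _ _ assms(1)] by auto
  have "h m \<le> c + h m / 2" using assms(2)[OF m] .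
  then show ?thesis using m(2)[OF assms(3)] by simp
qed

text \<open>Compare \<open>f\<close> at \<open>x\<close> and at \<open>x + t h\<close> for one small
  \<open>t\<close>: the linear part dominates up to an error proportional to \<open>t\<close>. It
  turns Lipschitz constants of kernels into bounds on their partial derivatives.\<close>

lemma has_derivative_lipschitz_bound:
  fixes f :: "'a::real_normed_vector \<Rightarrow> 'b::real_normed_vector"
  assumes f: "(f has_derivative f') (at x)" and "open S" "x \<in> S"
    and lip: "\<And>y. y \<in> S \<Longrightarrow> norm (f y - f x) \<le> C * norm (y - x)"
  shows "norm (f' h) \<le> C * norm h"
proof (rule field_le_epsilon)
  fix e :: real assume e: "e > 0"
  interpret f': bounded_linear f' using f has_derivative_bounded_linear by blast
  define e' where "e' = e / (norm h + 1)"
  have e': "e' > 0" "e' * norm h \<le> e"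
    using e by (auto simp: e'_def field_simps add_pos_nonneg)
  obtain d where d: "d > 0" "\<And>y. norm (y - x) < d \<Longrightarrow> norm (f y - f x - f' (y - x)) \<le> e' * norm (y - x)"
    using f e' unfolding has_derivative_at_alt by blast
  obtain d2 where d2: "d2 > 0" "ball x d2 \<subseteq> S" using assms(2,3) open_contains_ball by metis
  define t where "t = min d d2 / (2 * (norm h + 1))"
  have t: "t > 0" unfolding t_def using d d2 by (simp add: add_nonneg_pos)
  have "t * norm h < min d d2"
  proof -
    have "t * norm h \<le> t * (norm h + 1)" using t by simp
    also have "\<dots> = min d d2 / 2"
    proof -
      have "norm h + 1 \<noteq> 0" using norm_ge_zero[of h] by linarith
      then show ?thesis unfolding t_def by (simp add: divide_simps)
    qed
    finally show ?thesis using d d2 by linarith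
  qed
  then have th: "norm ((x + t *\<^sub>R h) - x) < d" "x + t *\<^sub>R h \<in> S"
    using t d2 by (auto simp: dist_norm subset_iff)
  have "norm (t *\<^sub>R f' h) \<le> norm (f (x + t *\<^sub>R h) - f x) + norm (f (x + t *\<^sub>R h) - f x - t *\<^sub>R f' h)"
    by (metis add.commute diff_add_cancel norm_minus_commute norm_triangle_sub)
  also have "\<dots> \<le> C * norm (t *\<^sub>R h) + e' * norm (t *\<^sub>R h)"
    using d(2)[OF th(1)] lip[OF th(2)] by (simp add: f'.scaleR)
  finally have "t * norm (f' h) \<le> t * (C * norm h + e' * norm h)"
    using t by (simp add: algebra_simps)
  then have "norm (f' h) \<le> C * norm h + e' * norm h" using t by simp
  then show "norm (f' h) \<le> C * norm h + e" using e' by linarith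
qed

text \<open>One radius \<open>d\<close> serves all base points in \<open>K\<close>, since the
  derivative is uniformly continuous near \<open>K\<close>. This makes the remainder small
  simultaneously for all integration parameters.\<close>

lemma uniform_linear_approximation:
  fixes f :: "'a::euclidean_space \<Rightarrow> 'b::real_normed_vector"
  assumes "open S" "Ck_on 1 S f" "compact K" "K \<subseteq> S" "e > 0"
  obtains d where "d > 0"
    "\<And>x y. x \<in> K \<Longrightarrow> norm (y - x) < d \<Longrightarrow> norm (f y - f x - frechet_derivative f (at x) (y - x)) \<le> e * norm (y - x)"
proof -
  let ?D = "\<lambda>x. frechet_derivative f (at x)"
  have der: "(f has_derivative ?D x) (at x)" if "x \<in> S" for x
    using Ck_on_SucE[of 0 S f x] assms(2) that unfolding One_nat_def by blast
  have lin: "linear (?D x)" if "x \<in> S" for x using der[OF that] has_derivative_linear by blast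
  have cont: "continuous_on S (\<lambda>x. ?D x v)" for v using assms(2) by simp
  let ?f' = "\<lambda>x. Blinfun (?D x) :: 'a \<Rightarrow>\<^sub>L 'b"
  have cf': "continuous_on S ?f'" by (rule continuous_on_Blinfun_derivative(1)[OF lin cont])
  have ap: "blinfun_apply (?f' x) = ?D x" if "x \<in> S" for x
    by (rule continuous_on_Blinfun_derivative(2)[OF lin cont that])
  show ?thesis
  proof (cases "K = {}")
    case True
    then show ?thesis using that[of 1] by simp
  next
    case False
    \<comment> \<open>The second point \<open>y\<close> may leave \<open>K\<close>, so uniform
      continuity is taken on a closed neighbourhood of \<open>K\<close>, which is still compact and
      inside \<open>S\<close>.\<close>
    obtain d0 where d0: "d0 > 0" "(\<Union>x\<in>K. cball x d0) \<subseteq> S"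
      using compact_subset_open_imp_cball_epsilon_subset[OF assms(3,1,4)] by blast
    let ?K' = "\<Union>x\<in>K. cball x d0"
    have "compact ?K'" by (rule compact_minkowski_sum_cball[OF assms(3)])
    then have "uniformly_continuous_on ?K' ?f'"
      using compact_uniformly_continuous continuous_on_subset[OF cf' d0(2)] by blast
    then obtain d1 where d1: "d1 > 0"
      "\<And>x y. x \<in> ?K' \<Longrightarrow> y \<in> ?K' \<Longrightarrow> dist y x < d1 \<Longrightarrow> dist (?f' y) (?f' x) < e"
      unfolding uniformly_continuous_on_def using assms(5) by metis
    define d where "d = min d0 d1"
    have "norm (f y - f x - ?D x (y - x)) \<le> e * norm (y - x)" if x: "x \<in> K" and y: "norm (y - x) < d" for x y
    proof -
      let ?B = "ball x d"
      have B: "?B \<subseteq> ?K'" using x unfolding d_def by (force simp: dist_commute)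
      have "norm (f y - f x - ?D x (y - x)) \<le> norm (y - x) * e"
      proof (rule differentiable_bound_linearization[where S="?B"])
        show "x + t *\<^sub>R (y - x) \<in> ?B" if "t \<in> {0..1}" for t
        proof -
          have "norm (t *\<^sub>R (y - x)) \<le> norm (y - x)" using that by (simp add: mult_left_le_one_le)
          then show ?thesis using y by (simp add: dist_norm norm_minus_commute)
        qed
        show "(f has_derivative ?D z) (at z within ?B)" if "z \<in> ?B" for z
          using der that B d0 by (meson has_derivative_at_withinI subsetD)
        show "onorm (?D z - ?D x) \<le> e" if "z \<in> ?B" for z
        proof -
          have zx: "z \<in> ?K'" "x \<in> ?K'" using that B x d0(1) by (blast, force)
          have "norm (?f' z - ?f' x) < e"
            using d1(2)[OF zx(2,1)] that unfolding d_def by (simp add: dist_norm norm_minus_commute)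
          moreover have "onorm (?D z - ?D x) = norm (?f' z - ?f' x)"
            using ap[OF subsetD[OF d0(2) zx(1)]] ap[OF subsetD[OF d0(2) zx(2)]]
            unfolding norm_blinfun.rep_eq
            by (intro arg_cong[where f=onorm] ext) (simp add: blinfun.diff_left)
          ultimately show ?thesis by simp
        qed
        show "x \<in> ?B" using d0 d1 by (simp add: d_def)
      qed
      then show ?thesis by (simp add: mult.commute)
    qed
    then show ?thesis using that[of d] d0 d1 by (simp add: d_def)
  qed
qed

text \<open>The projection \<open>pr\<close> singles out the directions along which the equation is integrated:
  \<open>sig s p\<close> scales the component of \<open>p\<close> in the range of \<open>pr\<close> by \<open>s\<close>.\<close>

locale radial =
  fixes pr :: "'e::euclidean_space \<Rightarrow> 'e"
  assumes lin_pr: "linear pr" and pr_pr [simp]: "pr (pr v) = pr v"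
    and norm_compl: "norm (v - pr v) \<le> norm v"
begin

definition sig :: "real \<Rightarrow> 'e \<Rightarrow> 'e" where
  "sig s p = p - pr p + s *\<^sub>R pr p"

lemma pr_simps: "pr (v + w) = pr v + pr w" "pr (v - w) = pr v - pr w" "pr (c *\<^sub>R v) = c *\<^sub>R pr v" "pr 0 = 0"
  by (simp_all add: linear_add linear_diff linear_scale linear_0 lin_pr)

lemma bl_pr: "bounded_linear pr"
  using lin_pr by (simp add: linear_conv_bounded_linear)

lemma sig_1 [simp]: "sig 1 p = p" by (simp add: sig_def)

text \<open>Scalings compose, so the integral equation at a point of a ray involves values on that
  same ray only.\<close>

lemma sig_sig: "sig s (sig t p) = sig (s * t) p"
  by (simp add: sig_def pr_simps algebra_simps)

lemma sig_diff: "sig s (p - q) = sig s p - sig s q"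
  by (simp add: sig_def pr_simps algebra_simps)

text \<open>\<open>sig s p\<close> is a convex combination of \<open>p - pr p\<close> and
  \<open>p\<close>, neither longer than \<open>p\<close> by \<open>norm_compl\<close>. Hence balls
  around 0 contain the rays of their points.\<close>

lemma norm_sig: assumes "s \<in> {0..1}" shows "norm (sig s p) \<le> norm p"
proof -
  have "sig s p = (1 - s) *\<^sub>R (p - pr p) + s *\<^sub>R p"
    by (simp add: sig_def algebra_simps)
  then have "norm (sig s p) \<le> (1 - s) * norm (p - pr p) + s * norm p"
    using norm_triangle_ineq[of "(1 - s) *\<^sub>R (p - pr p)" "s *\<^sub>R p"] assms by simp
  also have "\<dots> \<le> (1 - s) * norm p + s * norm p"
    using assms norm_compl by (intro add_mono mult_left_mono) auto
  finally show ?thesis by (simp add: algebra_simps)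
qed

lemma continuous_on_sig:
  "continuous_on S f \<Longrightarrow> continuous_on S g \<Longrightarrow> continuous_on S (\<lambda>x. sig (f x) (g x))"
  unfolding sig_def by (intro continuous_intros bounded_linear.continuous_on[OF bl_pr])

lemma Ck_on_sig:
  "open S \<Longrightarrow> Ck_on k S f \<Longrightarrow> Ck_on k S g \<Longrightarrow> Ck_on k S (\<lambda>x. sig (f x) (g x))"
  unfolding sig_def by (intro Ck_on_add Ck_on_diff Ck_on_scaleR Ck_on_bounded_linear[OF _ bl_pr])

text \<open>Banach's theorem in the space of bounded continuous functions; the kernel has to be
  contractive for all values \<open>w\<close>, as the iterates are not confined to any
  subset.\<close>

lemma fixed_point_exists:
  fixes g :: "real \<Rightarrow> 'e \<Rightarrow> 'f::banach \<Rightarrow> 'f"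
  assumes r: "r \<ge> 0"
    and cont: "continuous_on ({0..1} \<times> cball 0 r \<times> UNIV) (\<lambda>(s, p, w). g s p w)"
    and lip: "\<And>s p w w'. s \<in> {0..1} \<Longrightarrow> p \<in> cball 0 r \<Longrightarrow> norm (g s p w - g s p w') \<le> norm (w - w') / 2"
  obtains u where "continuous_on (cball 0 r) u"
    "\<And>p. p \<in> cball 0 r \<Longrightarrow> u p = integral {0..1} (\<lambda>s. g s p (u (sig s p)))"
proof -
  \<comment> \<open>Bounded continuous functions live on the whole space; composing with this
    retraction extends a function on the closed ball without changing it there.\<close>
  define \<rho> where "\<rho> = closest_point (cball (0::'e) r)"
  have ne: "cball (0::'e) r \<noteq> {}" using r by simp
  have \<rho>: "continuous_on UNIV \<rho>" "\<And>p. \<rho> p \<in> cball 0 r" "\<And>p. p \<in> cball 0 r \<Longrightarrow> \<rho> p = p"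
    unfolding \<rho>_def using ne closest_point_in_set[OF closed_cball ne]
    by (auto intro!: continuous_on_closest_point closest_point_self convex_cball)
  define T where "T U p = integral {0..1} (\<lambda>s. g s p (U (sig s p)))" for U :: "'e \<Rightarrow> 'f" and p
  have cg: "continuous_on (cball 0 r \<times> cbox 0 1) (\<lambda>(p, s). g s p (U (sig s p)))"
    if "continuous_on (cball 0 r) U" for U
  proof -
    have cU: "continuous_on (cball 0 r \<times> cbox 0 1) (\<lambda>z. U (sig (snd z) (fst z)))"
      by (rule continuous_on_compose2[OF that, where f="\<lambda>z. sig (snd z) (fst z)"])
        (auto intro!: continuous_on_sig continuous_intros, meson atLeastAtMost_iff norm_sig order_trans)
    have "continuous_on (cball 0 r \<times> cbox 0 1) (\<lambda>z. (\<lambda>(s, p, w). g s p w) (snd z, fst z, U (sig (snd z) (fst z))))"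
      by (rule continuous_on_compose2[OF cont]) (use cU in \<open>auto intro!: continuous_intros\<close>)
    then show ?thesis by (simp add: split_beta)
  qed
  have cT: "continuous_on (cball 0 r) (T U)" if "continuous_on (cball 0 r) U" for U
    unfolding T_def using integral_continuous_on_param[OF cg[OF that]] by simp
  have bc: "(\<lambda>p. T U (\<rho> p)) \<in> bcontfun" if "continuous_on (cball 0 r) U" for U
  proof -
    have "continuous_on UNIV (\<lambda>p. T U (\<rho> p))"
      by (rule continuous_on_compose2[OF cT[OF that] \<rho>(1)]) (use \<rho>(2) in auto)
    moreover have "bounded (range (\<lambda>p. T U (\<rho> p)))"
      by (rule bounded_subset[OF compact_imp_bounded[OF compact_continuous_image[OF cT[OF that] compact_cball]]])
        (use \<rho>(2) in blast)
    ultimately show ?thesis by (simp add: bcontfun_def)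
  qed
  define F :: "('e \<Rightarrow>\<^sub>C 'f) \<Rightarrow> ('e \<Rightarrow>\<^sub>C 'f)" where "F U = Bcontfun (\<lambda>p. T U (\<rho> p))" for U
  have cU: "continuous_on S (apply_bcontfun U)" for U :: "'e \<Rightarrow>\<^sub>C 'f" and S
    by (rule continuous_on_apply_bcontfun)
  have F: "apply_bcontfun (F U) p = T U (\<rho> p)" for U p
    unfolding F_def using bc[OF cU] by (simp add: Bcontfun_inverse)
  have "dist (F U) (F U') \<le> 1/2 * dist U U'" for U U'
  proof (rule dist_bound)
    fix p
    let ?q = "\<rho> p"
    have c: "continuous_on {0..1} (\<lambda>s. g s ?q (U (sig s ?q)))" for U :: "'e \<Rightarrow>\<^sub>C 'f"
      using continuous_on_compose2[OF cg[OF cU], of "{0..1}" "\<lambda>s. (?q, s)"] \<rho>(2)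
      by (force intro: continuous_intros)
    have "T U ?q - T U' ?q = integral {0..1} (\<lambda>s. g s ?q (U (sig s ?q)) - g s ?q (U' (sig s ?q)))"
      unfolding T_def using c by (intro integral_diff[symmetric] integrable_continuous_interval)
    also have "norm \<dots> \<le> (dist U U' / 2) * (1 - 0)"
    proof (rule integral_bound)
      show "norm (g t ?q (U (sig t ?q)) - g t ?q (U' (sig t ?q))) \<le> dist U U' / 2" if "t \<in> {0..1}" for t
        using lip[OF that \<rho>(2), of p "U (sig t ?q)" "U' (sig t ?q)"] dist_bounded[of U "sig t ?q" U']
        by (simp add: dist_norm)
    qed (use c in \<open>auto intro: continuous_intros\<close>)
    finally show "dist (apply_bcontfun (F U) p) (apply_bcontfun (F U') p) \<le> 1/2 * dist U U'"
      by (simp add: F dist_norm)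
  qed
  then obtain U where U: "F U = U"
    using banach_fix_type[of "1/2" F] by auto
  show ?thesis
  proof (rule that[of U])
    show "apply_bcontfun U p = integral {0..1} (\<lambda>s. g s p (apply_bcontfun U (sig s p)))" if "p \<in> cball 0 r" for p
      using F[of U p] U \<rho>(3)[OF that] by (simp add: T_def)
  qed (rule cU)
qed

text \<open>The natural domain of a kernel \<open>g\<close> that is evaluated at \<open>(s, p, u (sig s p))\<close>, where \<open>u\<close> maps
  \<open>D\<close> to \<open>V\<close>.\<close>

definition Om :: "'e set \<Rightarrow> 'f set \<Rightarrow> (real \<times> 'e \<times> 'f) set" where
  "Om D V = {(s, p, w). p \<in> D \<and> sig s p \<in> D \<and> w \<in> V}"

lemma open_Om:
  fixes V :: "'f::topological_space set"
  assumes "open D" "open V" shows "open (Om D V)"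
proof -
  have "Om D V = (\<lambda>z. sig (fst z) (fst (snd z))) -` D \<inter> (UNIV \<times> D \<times> V)"
    by (auto simp: Om_def)
  moreover have "open ((\<lambda>z::real \<times> 'e \<times> 'f. sig (fst z) (fst (snd z))) -` D)"
    by (rule open_vimage[OF assms(1)]) (intro continuous_on_sig continuous_intros)
  ultimately show ?thesis using assms by (auto intro!: open_Int open_Times)
qed

text \<open>The derivative \<open>W\<close> is obtained as a solution of the formally differentiated equation. Its remainder
  is bounded, along rays, by a small term plus half of its own supremum.\<close>

lemma fixed_point_C1_closed_ball:
  fixes g :: "real \<times> 'e \<times> 'f::euclidean_space \<Rightarrow> 'f"
  assumes R: "0 < r" "r < R" and V: "open V"
    and g: "Ck_on 1 (Om (ball 0 R) V) g"
    and lip: "\<And>s p w w'. s \<in> {0..1} \<Longrightarrow> p \<in> ball 0 R \<Longrightarrow> w \<in> V \<Longrightarrow> w' \<in> V \<Longrightarrow>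
       norm (g (s, p, w) - g (s, p, w')) \<le> norm (w - w') / 2"
    and u: "continuous_on (ball 0 R) u" "u ` ball 0 R \<subseteq> V"
    and eq: "\<And>p. p \<in> ball 0 R \<Longrightarrow> u p = integral {0..1} (\<lambda>s. g (s, p, u (sig s p)))"
  obtains W :: "'e \<Rightarrow> 'e \<Rightarrow>\<^sub>L 'f" where "continuous_on (cball 0 r) W"
    "\<And>p. p \<in> ball 0 r \<Longrightarrow> (u has_derivative W p) (at p)"
    "\<And>p v. p \<in> cball 0 r \<Longrightarrow> W p v = integral {0..1} (\<lambda>s.
        frechet_derivative g (at (s, p, u (sig s p))) (0, v, W (sig s p) (sig s v)))"
proof -
  let ?Om = "Om (ball 0 R) V"
  let ?z = "\<lambda>s p. (s, p, u (sig s p))"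
  let ?D = "\<lambda>z. frechet_derivative g (at z)"
  have oOm: "open ?Om" using open_Om V by blast
  have der: "(g has_derivative ?D z) (at z)" if "z \<in> ?Om" for z
    using Ck_on_SucE[of 0 ?Om g z] g that unfolding One_nat_def by blast
  have linD: "linear (?D z)" if "z \<in> ?Om" for z using der[OF that] has_derivative_linear by blast
  have cD: "continuous_on ?Om (\<lambda>z. ?D z v)" for v
    using g unfolding One_nat_def Ck_on.simps by blast
  have cg: "continuous_on ?Om g" using Ck_on_imp_continuous g by blast
  have sigB: "sig s p \<in> cball 0 r" if "s \<in> {0..1}" "p \<in> cball 0 r" for s p
    using norm_sig[OF that(1), of p] that(2) by simp
  have cbB: "p \<in> ball 0 R" if "p \<in> cball 0 r" for p :: 'e using that R by simp
  have uV: "u p \<in> V" if "p \<in> cball 0 r" for p using u(2) cbB[OF that] by blast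
  have cu: "continuous_on (cball 0 r) u" using u(1) by (rule continuous_on_subset) (use cbB in auto)
  have zOm: "?z s p \<in> ?Om" if "s \<in> {0..1}" "p \<in> cball 0 r" for s p
    using that sigB[OF that] cbB uV unfolding Om_def by blast
  have zOm': "(s, p, w) \<in> ?Om" if "s \<in> {0..1}" "p \<in> cball 0 r" "w \<in> V" for s p w
    using that sigB[OF that(1,2)] cbB unfolding Om_def by blast
  have cz: "continuous_on ({0..1} \<times> cball 0 r) (\<lambda>x. ?z (fst x) (snd x))"
    by (intro continuous_intros continuous_on_compose2[OF cu] continuous_on_sig) (use sigB in auto)
  \<comment> \<open>Partial derivatives in \<open>p\<close> and in the unknown. The first slot is 0
    throughout because \<open>s\<close> is the integration variable.\<close>
  let ?a = "\<lambda>z v. ?D z (0, v, 0)" and ?b = "\<lambda>z h. ?D z (0, 0, h)"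
  have lina: "linear (?a z)" if "z \<in> ?Om" for z
    using linear_add[OF linD[OF that], of "(0, _, 0)" "(0, _, 0)"] linear_scale[OF linD[OF that], of _ "(0, _, 0)"]
    by (intro linearI) simp_all
  have linb: "linear (?b z)" if "z \<in> ?Om" for z
    using linear_add[OF linD[OF that], of "(0, 0, _)" "(0, 0, _)"] linear_scale[OF linD[OF that], of _ "(0, 0, _)"]
    by (intro linearI) simp_all
  define a where "a z = (Blinfun (?a z) :: 'e \<Rightarrow>\<^sub>L 'f)" for z
  define b where "b z = (Blinfun (?b z) :: 'f \<Rightarrow>\<^sub>L 'f)" for z
  have ca: "continuous_on ?Om a" unfolding a_def by (rule continuous_on_Blinfun_derivative(1)[OF lina cD])
  have cb: "continuous_on ?Om b" unfolding b_def by (rule continuous_on_Blinfun_derivative(1)[OF linb cD])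
  have a: "blinfun_apply (a z) = ?a z" if "z \<in> ?Om" for z
    unfolding a_def by (rule continuous_on_Blinfun_derivative(2)[OF lina cD that])
  have b: "blinfun_apply (b z) = ?b z" if "z \<in> ?Om" for z
    unfolding b_def by (rule continuous_on_Blinfun_derivative(2)[OF linb cD that])
  have D_split: "?D z (0, v, h) = a z v + b z h" if "z \<in> ?Om" for z v h
    using linear_add[OF linD[OF that], of "(0, v, 0)" "(0, 0, h)"] by (simp add: a b that)
  \<comment> \<open>The contraction factor in \<open>w\<close> passes to the partial derivative, so
    the equation for \<open>W\<close> is again contractive.\<close>
  have nb: "norm (b (s, p, w)) \<le> 1/2" if "s \<in> {0..1}" "p \<in> cball 0 r" "w \<in> V" for s p w
  proof (rule norm_blinfun_bound)
    fix h
    have "((\<lambda>w. g (s, p, w)) has_derivative (\<lambda>h. ?D (s, p, w) (0, 0, h))) (at w)"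
      using has_derivative_compose[OF has_derivative_Pair[OF has_derivative_const has_derivative_Pair[OF has_derivative_const has_derivative_ident]] der[OF zOm'[OF that]]]
      by simp
    then have "norm (?D (s, p, w) (0, 0, h)) \<le> 1/2 * norm h"
      by (rule has_derivative_lipschitz_bound[OF _ V that(3)])
        (use lip[OF that(1) cbB[OF that(2)] _ that(3)] in auto)
    then show "norm (b (s, p, w) h) \<le> 1/2 * norm h" using b[OF zOm'[OF that]] by simp
  qed simp
  define Sig where "Sig s = (Blinfun (\<lambda>p. p - pr p) + s *\<^sub>R Blinfun pr :: 'e \<Rightarrow>\<^sub>L 'e)" for s :: real
  have Sig: "blinfun_apply (Sig s) = sig s" for s
    unfolding Sig_def sig_def
    by (auto simp: blinfun.add_left blinfun.scaleR_left bounded_linear_Blinfun_apply bl_pr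
        bounded_linear_sub bounded_linear_ident)
  have nSig: "norm (Sig s) \<le> 1" if "s \<in> {0..1}" for s
    by (rule norm_blinfun_bound) (use norm_sig[OF that] Sig in auto)
  have cSig: "continuous_on S Sig" for S unfolding Sig_def by (intro continuous_intros)

  \<comment> \<open>Chain rule: \<open>p \<mapsto> u (sig s p)\<close> has the candidate derivative
    \<open>W (sig s p)\<close> composed with \<open>Sig s\<close>.\<close>
  define gW where "gW s p \<Lambda> = a (?z s p) + (b (?z s p) o\<^sub>L \<Lambda> o\<^sub>L Sig s)" for s p \<Lambda>
  obtain W where W: "continuous_on (cball 0 r) W"
    "\<And>p. p \<in> cball 0 r \<Longrightarrow> W p = integral {0..1} (\<lambda>s. gW s p (W (sig s p)))"
  proof (rule fixed_point_exists[of r gW])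
    have cz': "continuous_on ({0..1} \<times> cball 0 r \<times> UNIV) (\<lambda>x. ?z (fst x) (fst (snd x)))"
      by (rule continuous_on_compose2[OF cz, of _ "\<lambda>x. (fst x, fst (snd x))", simplified])
        (auto intro!: continuous_intros)
    show "continuous_on ({0..1} \<times> cball 0 r \<times> UNIV) (\<lambda>(s, p, \<Lambda>). gW s p \<Lambda>)"
      unfolding gW_def split_beta
      by (intro continuous_intros continuous_on_compose2[OF ca cz'] continuous_on_compose2[OF cb cz']
          continuous_on_compose2[OF cSig[of UNIV]]) (use zOm in auto)
    show "norm (gW s p \<Lambda> - gW s p \<Lambda>') \<le> norm (\<Lambda> - \<Lambda>') / 2" if "s \<in> {0..1}" "p \<in> cball 0 r" for s p \<Lambda> \<Lambda>'
    proof -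
      have "gW s p \<Lambda> - gW s p \<Lambda>' = b (?z s p) o\<^sub>L (\<Lambda> - \<Lambda>') o\<^sub>L Sig s"
        unfolding gW_def by (rule blinfun_eqI) (simp add: blinfun.diff_left blinfun.diff_right)
      also have "norm \<dots> \<le> norm (b (?z s p) o\<^sub>L (\<Lambda> - \<Lambda>')) * norm (Sig s)" by (rule norm_blinfun_compose)
      also have "\<dots> \<le> norm (b (?z s p)) * norm (\<Lambda> - \<Lambda>') * 1"
        by (intro mult_mono norm_blinfun_compose nSig that) auto
      also have "\<dots> \<le> 1/2 * norm (\<Lambda> - \<Lambda>')"
        using mult_right_mono[OF nb[OF that uV[OF sigB[OF that]]], of "norm (\<Lambda> - \<Lambda>')"] by simp
      finally show ?thesis by simp
    qed
  qed (use R in auto)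
  have cgW: "continuous_on {0..1} (\<lambda>s. gW s p (W (sig s p)))" if "p \<in> cball 0 r" for p
  proof -
    have cz': "continuous_on {0..1} (\<lambda>s. ?z s p)"
      by (rule continuous_on_compose2[OF cz, of _ "\<lambda>s. (s, p)", simplified])
        (use that in \<open>auto intro!: continuous_intros\<close>)
    show ?thesis unfolding gW_def
      by (intro continuous_intros continuous_on_compose2[OF ca cz'] continuous_on_compose2[OF cb cz'] cSig
          continuous_on_compose2[OF W(1)] continuous_on_sig) (use zOm sigB that in auto)
  qed
  have Wv: "W p v = integral {0..1} (\<lambda>s. ?D (?z s p) (0, v, W (sig s p) (sig s v)))"
    if p: "p \<in> cball 0 r" for p v
  proof -
    have "W p v = blinfun_apply (integral {0..1} (\<lambda>s. gW s p (W (sig s p)))) v" using W(2)[OF p] by simp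
    also have "\<dots> = integral {0..1} (\<lambda>s. gW s p (W (sig s p)) v)"
      by (rule blinfun_apply_integral) (rule integrable_continuous_interval[OF cgW[OF p]])
    also have "\<dots> = integral {0..1} (\<lambda>s. ?D (?z s p) (0, v, W (sig s p) (sig s v)))"
      by (rule integral_cong) (simp add: gW_def D_split[OF zOm[OF _ p]] blinfun.add_left Sig)
    finally show ?thesis .
  qed

  \<comment> \<open>All points at which the kernel is evaluated along rays in the closed ball;
    compactness gives one remainder estimate for all of them.\<close>
  let ?K = "(\<lambda>x. ?z (fst x) (snd x)) ` ({0..1} \<times> cball 0 r)"
  have cK: "compact ?K"
    by (rule compact_continuous_image[OF cz]) (intro compact_Times compact_cball compact_Icc)
  have KOm: "?K \<subseteq> ?Om" using zOm by auto
  have cig: "continuous_on {0..1} (\<lambda>s. g (?z s p))" if "p \<in> cball 0 r" for p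
  proof -
    have cz': "continuous_on {0..1} (\<lambda>s. ?z s p)"
      by (rule continuous_on_compose2[OF cz, of _ "\<lambda>s. (s, p)", simplified])
        (use that in \<open>auto intro!: continuous_intros\<close>)
    show ?thesis by (rule continuous_on_compose2[OF cg cz']) (use zOm that in auto)
  qed
  have cus: "continuous_on {0..1} (\<lambda>s. u (sig s p))" if "p \<in> cball 0 r" for p
    by (intro continuous_on_compose2[OF cu] continuous_on_sig continuous_intros) (use sigB that in auto)

  obtain C where C: "C \<ge> 0" "\<And>s p w. s \<in> {0..1} \<Longrightarrow> p \<in> cball 0 r \<Longrightarrow> w \<in> u ` cball 0 r \<Longrightarrow> norm (a (s, p, w)) \<le> C"
  proof -
    let ?L = "{0..1::real} \<times> cball (0::'e) r \<times> u ` cball 0 r"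
    have "compact ?L" by (rule compact_Times[OF compact_Icc compact_Times[OF compact_cball compact_continuous_image[OF cu compact_cball]]])
    moreover have "continuous_on ?L a"
      by (rule continuous_on_subset[OF ca]) (use zOm' uV in auto)
    ultimately have "bounded (a ` ?L)" using compact_continuous_image compact_imp_bounded by blast
    then obtain C where "C > 0" "\<And>y. y \<in> a ` ?L \<Longrightarrow> norm y \<le> C" unfolding bounded_pos by blast
    then show ?thesis by (intro that[of C]) auto
  qed
  have gp: "norm (g (s, q, w) - g (s, p, w)) \<le> C * norm (q - p)"
    if "s \<in> {0..1}" "p \<in> cball 0 r" "q \<in> cball 0 r" "w \<in> u ` cball 0 r" for s p q w
  proof (rule differentiable_bound[OF convex_cball[of 0 r], where f'="\<lambda>p v. ?D (s, p, w) (0, v, 0)"])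
    have wV: "w \<in> V" using that uV by blast
    fix x :: 'e assume x: "x \<in> cball 0 r"
    have "((\<lambda>p. g (s, p, w)) has_derivative (\<lambda>v. ?D (s, x, w) (0, v, 0))) (at x)"
      using has_derivative_compose[OF has_derivative_Pair[OF has_derivative_const has_derivative_Pair[OF has_derivative_ident has_derivative_const]] der[OF zOm'[OF that(1) x wV]]]
      by simp
    then show "((\<lambda>p. g (s, p, w)) has_derivative (\<lambda>v. ?D (s, x, w) (0, v, 0))) (at x within cball 0 r)"
      by (rule has_derivative_at_withinI)
    show "onorm (\<lambda>v. ?D (s, x, w) (0, v, 0)) \<le> C"
      using C(2)[OF that(1) x that(4)] a[OF zOm'[OF that(1) x wV]] by (simp add: norm_blinfun.rep_eq)
  qed (use that in auto)

  \<comment> \<open>\<open>C\<close> bounds the partial derivative in \<open>p\<close>; the factor 2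
    is the one of \<open>sup_half_bound\<close>.\<close>
  define L where "L = 2 * C"
  have L: "L \<ge> 0" using C by (simp add: L_def)
  have ulip: "norm (u (sig s q) - u (sig s p)) \<le> L * norm (q - p)"
    if pq: "p \<in> cball 0 r" "q \<in> cball 0 r" and s: "s \<in> {0..1}" for p q s
  proof -
    let ?h = "\<lambda>s. norm (u (sig s q) - u (sig s p))"
    \<comment> \<open>In the integral at \<open>sig s p\<close> the unknown occurs at
      \<open>sig (t * s) p\<close>, so its difference is a value of \<open>?h\<close> and enters
      with the factor 1/2.\<close>
    have "?h s \<le> 2 * (C * norm (q - p))"
    proof (rule sup_half_bound[OF _ _ s])
      show "continuous_on {0..1} ?h" by (intro continuous_intros cus pq)
      fix s M :: real assume s: "s \<in> {0..1}" and M: "\<And>t. t \<in> {0..1} \<Longrightarrow> ?h t \<le> M"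
      let ?p = "sig s p" and ?q = "sig s q"
      have p': "?p \<in> cball 0 r" "?q \<in> cball 0 r" using sigB s pq by blast+
      have "u ?q - u ?p = integral {0..1} (\<lambda>t. g (?z t ?q) - g (?z t ?p))"
        using eq[OF cbB[OF p'(1)]] eq[OF cbB[OF p'(2)]] cig[OF p'(1)] cig[OF p'(2)]
        by (simp add: integral_diff[OF integrable_continuous_interval integrable_continuous_interval])
      also have "norm \<dots> \<le> (C * norm (q - p) + M / 2) * (1 - 0)"
      proof (rule integral_bound)
        fix t :: real assume t: "t \<in> {0..1}"
        have ts: "t * s \<in> {0..1}" using t s by (auto intro: mult_le_one)
        have "norm (g (?z t ?q) - g (?z t ?p)) \<le>
            norm (g (t, ?q, u (sig t ?q)) - g (t, ?p, u (sig t ?q))) + norm (g (t, ?p, u (sig t ?q)) - g (t, ?p, u (sig t ?p)))"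
          using norm_triangle_ineq[of "g (t, ?q, u (sig t ?q)) - g (t, ?p, u (sig t ?q))" "g (t, ?p, u (sig t ?q)) - g (t, ?p, u (sig t ?p))"]
          by simp
        also have "\<dots> \<le> C * norm (?q - ?p) + norm (u (sig t ?q) - u (sig t ?p)) / 2"
          using sigB[OF t] p' by (intro add_mono gp lip t cbB uV) auto
        also have "\<dots> \<le> C * norm (q - p) + M / 2"
          using norm_sig[OF s, of "q - p"] C(1) M[OF ts]
          by (intro add_mono mult_left_mono divide_right_mono) (auto simp: sig_diff sig_sig)
        finally show "norm (g (?z t ?q) - g (?z t ?p)) \<le> C * norm (q - p) + M / 2" .
      qed (use cig p' in \<open>auto intro: continuous_intros\<close>)
      finally show "?h s \<le> C * norm (q - p) + M / 2" by simp
    qed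
    then show ?thesis by (simp add: L_def)
  qed

  have main: "(u has_derivative W p) (at p)" if p: "p \<in> ball 0 r" for p
    unfolding has_derivative_at_alt
  proof (intro conjI allI impI)
    show "bounded_linear (blinfun_apply (W p))" by (rule blinfun.bounded_linear_right)
    fix e :: real assume e: "e > 0"
    \<comment> \<open>The remainder of \<open>g\<close> is at most
      \<open>e' * ((1 + L) * norm (q - p))\<close>, and \<open>sup_half_bound\<close> doubles it;
      this choice makes the result \<open>e * norm (q - p)\<close>.\<close>
    define e' where "e' = e / (2 * (1 + L))"
    have e': "e' > 0" using e L by (simp add: e'_def)
    obtain d where d: "d > 0" "\<And>x y. x \<in> ?K \<Longrightarrow> norm (y - x) < d \<Longrightarrow> norm (g y - g x - ?D x (y - x)) \<le> e' * norm (y - x)"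
      using uniform_linear_approximation[OF oOm g cK KOm e'] by blast
    \<comment> \<open>The first bound on \<open>q - p\<close> keeps the increment of
      \<open>(t, p, u)\<close> below \<open>d\<close>, as \<open>u\<close> has Lipschitz constant
      \<open>L\<close>; the second keeps \<open>q\<close> in the ball.\<close>
    have "norm (u q - u p - W p (q - p)) \<le> e * norm (q - p)"
      if q: "norm (q - p) < min (d / (1 + L)) (r - norm p)" for q
    proof -
      have pc: "p \<in> cball 0 r" using p by simp
      have qc: "q \<in> cball 0 r" using q norm_triangle_sub[of q p] by simp
      have qd: "(1 + L) * norm (q - p) < d" using q L by (simp add: field_simps)
      let ?h = "\<lambda>s. norm (u (sig s q) - u (sig s p) - W (sig s p) (sig s (q - p)))"
      have "?h 1 \<le> 2 * (e' * ((1 + L) * norm (q - p)))"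
      proof (rule sup_half_bound[of ?h])
        have "continuous_on {0..1} (\<lambda>s. W (sig s p))"
          by (intro continuous_on_compose2[OF W(1)] continuous_on_sig continuous_intros) (use sigB pc in auto)
        then show "continuous_on {0..1} ?h" by (intro continuous_intros cus pc qc continuous_on_sig)
        fix s M :: real assume s: "s \<in> {0..1}" and M: "\<And>t. t \<in> {0..1} \<Longrightarrow> ?h t \<le> M"
        let ?p = "sig s p" and ?q = "sig s q"
        have p': "?p \<in> cball 0 r" "?q \<in> cball 0 r" using sigB s pc qc by blast+
        let ?I = "\<lambda>t. g (?z t ?q) - g (?z t ?p) - ?D (?z t ?p) (0, sig s (q - p), W (sig t ?p) (sig t (sig s (q - p))))"
        have cI2: "continuous_on {0..1} (\<lambda>t. gW t ?p (W (sig t ?p)) (sig s (q - p)))"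
          by (intro continuous_intros cgW p')
        have I2: "?D (?z t ?p) (0, sig s (q - p), W (sig t ?p) (sig t (sig s (q - p))))
            = gW t ?p (W (sig t ?p)) (sig s (q - p))" if "t \<in> {0..1}" for t
          by (simp add: gW_def D_split[OF zOm[OF that p'(1)]] blinfun.add_left Sig)
        have cI: "continuous_on {0..1} (\<lambda>t. ?D (?z t ?p) (0, sig s (q - p), W (sig t ?p) (sig t (sig s (q - p)))))"
          by (rule continuous_on_eq[OF cI2]) (simp add: I2)
        have "u ?q - u ?p - W ?p (sig s (q - p)) = integral {0..1} ?I"
          using eq[OF cbB[OF p'(1)]] eq[OF cbB[OF p'(2)]] Wv[OF p'(1), of "sig s (q - p)"]
            cig[OF p'(1)] cig[OF p'(2)] cI
          by (simp add: integral_diff integrable_diff integrable_continuous_interval)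
        also have "norm \<dots> \<le> (e' * ((1 + L) * norm (q - p)) + M / 2) * (1 - 0)"
        proof (rule integral_bound)
          fix t :: real assume t: "t \<in> {0..1}"
          have ts: "t * s \<in> {0..1}" using t s by (auto intro: mult_le_one)
          let ?x = "?z t ?p" and ?y = "?z t ?q"
          let ?du = "u (sig t ?q) - u (sig t ?p)"
          have yx: "?y - ?x = (0, sig s (q - p), ?du)" by (simp add: sig_diff)
          have "norm (?y - ?x) \<le> norm (sig s (q - p)) + norm ?du"
            unfolding yx using norm_Pair_le[of "0::real" "(sig s (q - p), ?du)"] norm_Pair_le[of "sig s (q - p)" ?du]
            by simp
          also have "\<dots> \<le> norm (q - p) + L * norm (q - p)"
            using norm_sig[OF s] ulip[OF pc qc ts] by (intro add_mono) (auto simp: sig_sig)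
          finally have nyx: "norm (?y - ?x) \<le> (1 + L) * norm (q - p)" by (simp add: algebra_simps)
          have xK: "?x \<in> ?K" using t p'(1) by force
          have xO: "?x \<in> ?Om" using zOm[OF t p'(1)] .
          have rem: "norm (g ?y - g ?x - ?D ?x (?y - ?x)) \<le> e' * ((1 + L) * norm (q - p))"
            using e' by (intro order_trans[OF d(2)[OF xK le_less_trans[OF nyx qd]]] mult_left_mono[OF nyx]) auto
          define A where "A = g ?y - g ?x - ?D ?x (?y - ?x)"
          define B where "B = ?du - W (sig t ?p) (sig t (sig s (q - p)))"
          \<comment> \<open>\<open>A\<close> is the remainder of the kernel, and \<open>B\<close> is
            the remainder of \<open>u\<close> further down the same ray, damped by the partial
            derivative \<open>b\<close> of norm at most 1/2.\<close>
          have "?I t = A + b ?x B"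
            unfolding A_def B_def yx D_split[OF xO] by (simp add: blinfun.diff_right blinfun.add_right algebra_simps)
          then have "norm (?I t) \<le> norm A + norm (b ?x B)" by (simp only: norm_triangle_ineq)
          moreover have "norm (b ?x B) \<le> 1/2 * norm B"
            by (rule order_trans[OF norm_blinfun mult_right_mono[OF nb[OF t p'(1) uV[OF sigB[OF t p'(1)]]]]]) simp
          moreover have "norm B \<le> M" unfolding B_def using M[OF ts] by (simp only: sig_sig)
          moreover have "norm A \<le> e' * ((1 + L) * norm (q - p))" unfolding A_def by (rule rem)
          ultimately show "norm (?I t) \<le> e' * ((1 + L) * norm (q - p)) + M / 2" by linarith
        qed (rule zero_le_one, intro continuous_on_diff cig p' cI)
        finally show "?h s \<le> e' * ((1 + L) * norm (q - p)) + M / 2" by simp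
      qed simp
      also have "2 * (e' * ((1 + L) * norm (q - p))) = e * norm (q - p)"
        using L by (simp add: e'_def field_simps)
      finally show ?thesis by simp
    qed
    moreover have "min (d / (1 + L)) (r - norm p) > 0" using d L p by simp
    ultimately show "\<exists>d>0. \<forall>y. norm (y - p) < d \<longrightarrow> norm (u y - u p - blinfun_apply (W p) (y - p)) \<le> e * norm (y - p)"
      by blast
  qed
  show ?thesis by (rule that[OF W(1) main Wv])
qed

text \<open>Compactness costs a strictly smaller closed ball; since derivatives are local and
  unique, radii between \<open>norm p\<close> and \<open>R\<close> recover the open ball. The
  derivative formula survives because the ray of \<open>p\<close> stays in the smaller ball.\<close>

lemma fixed_point_C1:
  fixes g :: "real \<times> 'e \<times> 'f::euclidean_space \<Rightarrow> 'f"
  assumes V: "open V" and g: "Ck_on 1 (Om (ball 0 R) V) g"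
    and lip: "\<And>s p w w'. s \<in> {0..1} \<Longrightarrow> p \<in> ball 0 R \<Longrightarrow> w \<in> V \<Longrightarrow> w' \<in> V \<Longrightarrow>
       norm (g (s, p, w) - g (s, p, w')) \<le> norm (w - w') / 2"
    and u: "continuous_on (ball 0 R) u" "u ` ball 0 R \<subseteq> V"
    and eq: "\<And>p. p \<in> ball 0 R \<Longrightarrow> u p = integral {0..1} (\<lambda>s. g (s, p, u (sig s p)))"
  shows "Ck_on 1 (ball 0 R) u"
    and "p \<in> ball 0 R \<Longrightarrow> frechet_derivative u (at p) v = integral {0..1} (\<lambda>s.
        frechet_derivative g (at (s, p, u (sig s p))) (0, v, frechet_derivative u (at (sig s p)) (sig s v)))"
proof -
  have loc: "\<exists>r W. 0 < r \<and> p \<in> ball 0 r \<and> r < R \<and> continuous_on (cball 0 r) W \<and>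
      (\<forall>q\<in>ball 0 r. (u has_derivative blinfun_apply (W q)) (at q)) \<and>
      (\<forall>q\<in>cball 0 r. \<forall>v. W q v = integral {0..1} (\<lambda>s.
        frechet_derivative g (at (s, q, u (sig s q))) (0, v, W (sig s q) (sig s v))))"
    if "p \<in> ball 0 R" for p :: 'e
  proof -
    let ?r = "(norm p + R) / 2"
    have r: "0 < ?r" "?r < R" "p \<in> ball 0 ?r" using that by (auto simp: add_nonneg_pos le_less_trans[OF norm_ge_zero])
    obtain W :: "'e \<Rightarrow> 'e \<Rightarrow>\<^sub>L 'f" where "continuous_on (cball 0 ?r) W"
      "\<And>q. q \<in> ball 0 ?r \<Longrightarrow> (u has_derivative W q) (at q)"
      "\<And>q v. q \<in> cball 0 ?r \<Longrightarrow> W q v = integral {0..1} (\<lambda>s.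
        frechet_derivative g (at (s, q, u (sig s q))) (0, v, W (sig s q) (sig s v)))"
      using fixed_point_C1_closed_ball[OF r(1,2) V g lip u eq] by blast
    then show ?thesis using r by blast
  qed
  show "Ck_on 1 (ball 0 R) u"
  proof (rule Ck_on_local)
    fix p :: 'e assume "p \<in> ball 0 R"
    from loc[OF this] obtain r W where W: "p \<in> ball 0 r" "continuous_on (cball 0 r) W"
      "\<forall>q\<in>ball 0 r. (u has_derivative blinfun_apply (W q)) (at q)" by blast
    have "continuous_on (ball 0 r) (\<lambda>q. W q v)" for v
      by (intro continuous_intros continuous_on_subset[OF W(2)]) auto
    then have "Ck_on (Suc 0) (ball 0 r) u"
      using W by (intro Ck_on_SucI) auto
    then show "\<exists>U. open U \<and> p \<in> U \<and> Ck_on 1 U u" using W(1) by (metis One_nat_def open_ball)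
  qed simp
  show "frechet_derivative u (at p) v = integral {0..1} (\<lambda>s.
        frechet_derivative g (at (s, p, u (sig s p))) (0, v, frechet_derivative u (at (sig s p)) (sig s v)))"
    if p: "p \<in> ball 0 R" for p v
  proof -
    from loc[OF p] obtain r W where W: "p \<in> ball 0 r"
      "\<And>q. q \<in> ball 0 r \<Longrightarrow> (u has_derivative blinfun_apply (W q)) (at q)"
      "\<And>q v. q \<in> cball 0 r \<Longrightarrow> W q v = integral {0..1} (\<lambda>s.
        frechet_derivative g (at (s, q, u (sig s q))) (0, v, W (sig s q) (sig s v)))" by blast
    have D: "frechet_derivative u (at q) = W q" if "q \<in> ball 0 r" for q
      using frechet_derivative_at[OF W(2)[OF that]] by simp
    have "sig s p \<in> ball 0 r" if "s \<in> {0..1}" for s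
      using norm_sig[OF that, of p] W(1) by simp
    then have "integral {0..1} (\<lambda>s. frechet_derivative g (at (s, p, u (sig s p))) (0, v, W (sig s p) (sig s v)))
      = integral {0..1} (\<lambda>s. frechet_derivative g (at (s, p, u (sig s p))) (0, v, frechet_derivative u (at (sig s p)) (sig s v)))"
      by (intro integral_cong) (simp only: D)
    then show ?thesis
      using W(1) W(3)[of p v] by (simp add: D)
  qed
qed

text \<open>A directional derivative of a solution along an eigenvector of the maps \<open>sig s\<close> solves an equation
  of the same kind, so one more derivative is gained in each step.\<close>

lemma fixed_point_Ck:
  fixes g :: "real \<times> 'e \<times> 'f::euclidean_space \<Rightarrow> 'f"
  assumes "open V" "Ck_on k (Om (ball 0 R) V) g"
    and "\<And>s p w w'. s \<in> {0..1} \<Longrightarrow> p \<in> ball 0 R \<Longrightarrow> w \<in> V \<Longrightarrow> w' \<in> V \<Longrightarrow>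
       norm (g (s, p, w) - g (s, p, w')) \<le> norm (w - w') / 2"
    and "continuous_on (ball 0 R) u" "u ` ball 0 R \<subseteq> V"
    and "\<And>p. p \<in> ball 0 R \<Longrightarrow> u p = integral {0..1} (\<lambda>s. g (s, p, u (sig s p)))"
  shows "Ck_on k (ball 0 R) u"
  using assms
proof (induction k arbitrary: g V u)
  case 0
  then show ?case by simp
next
  case (Suc k)
  let ?Om = "Om (ball 0 R) V"
  \<comment> \<open>The unknown of the new equation is a directional derivative, with no restriction
    on its values; the new kernel is affine in it, so \<open>UNIV\<close> takes the place of
    \<open>V\<close>.\<close>
  let ?Om' = "Om (ball 0 R) (UNIV :: 'f set)"
  let ?D = "\<lambda>z. frechet_derivative g (at z)"
  let ?\<zeta> = "\<lambda>z. (fst z, fst (snd z), u (sig (fst z) (fst (snd z))))"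
  have g1: "Ck_on 1 ?Om g" using Ck_on_le[OF Suc.prems(2), of 1] by simp
  have u1: "Ck_on 1 (ball 0 R) u"
    by (rule fixed_point_C1(1)[OF Suc.prems(1) g1 Suc.prems(3-6)])
  have Du: "frechet_derivative u (at p) v = integral {0..1} (\<lambda>s.
        ?D (s, p, u (sig s p)) (0, v, frechet_derivative u (at (sig s p)) (sig s v)))"
    if "p \<in> ball 0 R" for p v
    by (rule fixed_point_C1(2)[OF Suc.prems(1) g1 Suc.prems(3-6) that])
  have uk: "Ck_on k (ball 0 R) u"
    by (rule Suc.IH[OF Suc.prems(1) Ck_on_Suc_imp[OF Suc.prems(2)] Suc.prems(3-6)])
  have oOm: "open ?Om" "open ?Om'" using Suc.prems(1) by (auto intro: open_Om)
  have lin: "linear (?D z)" if "z \<in> ?Om" for z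
    using Ck_on_SucE[OF Suc.prems(2) that] has_derivative_linear by blast
  have derU: "(u has_derivative frechet_derivative u (at p)) (at p)" if "p \<in> ball 0 R" for p
    using Ck_on_SucE[of 0 "ball 0 R" u p] u1 that unfolding One_nat_def by blast
  have sigB: "sig s p \<in> ball 0 R" if "s \<in> {0..1}" "p \<in> ball 0 R" for s p
    using norm_sig[OF that(1), of p] that(2) by simp
  have \<zeta>Om: "?\<zeta> z \<in> ?Om" if "z \<in> ?Om'" for z
    using that Suc.prems(5) by (auto simp: Om_def)
  \<comment> \<open>The new kernel contains \<open>u\<close> itself and first derivatives of
    \<open>g\<close>. By \<open>uk\<close> and the assumption of order k+1 on \<open>g\<close> it is
    of order k, which is what the induction hypothesis asks for.\<close>
  have C\<zeta>: "Ck_on k ?Om' ?\<zeta>"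
    by (intro Ck_on_Pair oOm Ck_on_linear Ck_on_compose[OF oOm(2) open_ball uk] Ck_on_sig
        bounded_linear_fst bounded_linear_snd bounded_linear_compose[OF bounded_linear_fst bounded_linear_snd])
      (auto simp: Om_def)
  have CD: "Ck_on k ?Om' (\<lambda>z. ?D (?\<zeta> z) h)" for h
    by (rule Ck_on_compose[OF oOm(2,1) _ C\<zeta> \<zeta>Om]) (use Suc.prems(2) in \<open>auto simp del: split_paired_All\<close>)
  \<comment> \<open>For an eigenvector the right-hand side involves only the derivative in the same
    direction \<open>v\<close>; \<open>\<bar>c s\<bar> \<le> 1\<close> preserves the contraction
    factor.\<close>
  have eig: "Ck_on k (ball 0 R) (\<lambda>p. frechet_derivative u (at p) v)"
    if c: "\<And>s. sig s v = c s *\<^sub>R v" "\<And>s. s \<in> {0..1} \<Longrightarrow> \<bar>c s\<bar> \<le> 1" "Ck_on k UNIV c" for v c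
  proof (rule Suc.IH)
    let ?g' = "\<lambda>z. ?D (?\<zeta> z) (0, v, 0) + c (fst z) *\<^sub>R ?D (?\<zeta> z) (0, 0, snd (snd z))"
    have lin0: "linear (\<lambda>h. ?D z (0, 0, h))" if "z \<in> ?Om" for z
      using linear_add[OF lin[OF that], of "(0, 0, _)" "(0, 0, _)"] linear_scale[OF lin[OF that], of _ "(0, 0, _)"]
      by (intro linearI) simp_all
    show "Ck_on k ?Om' ?g'"
    proof -
      have "Ck_on k ?Om' (\<lambda>z. \<Sum>b\<in>Basis. (snd (snd z) \<bullet> b) *\<^sub>R ?D (?\<zeta> z) (0, 0, b))"
        by (intro Ck_on_sum Ck_on_scaleR Ck_on_inner CD oOm Ck_on_const Ck_on_linear
            bounded_linear_compose[OF bounded_linear_snd bounded_linear_snd])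
      then have "Ck_on k ?Om' (\<lambda>z. ?D (?\<zeta> z) (0, 0, snd (snd z)))"
        by (rule Ck_on_cong[OF oOm(2)]) (rule linear_sum_Basis[OF lin0[OF \<zeta>Om], symmetric])
      moreover have "Ck_on k ?Om' (\<lambda>z. c (fst z))"
        by (rule Ck_on_compose[OF oOm(2) open_UNIV c(3) Ck_on_linear[OF oOm(2) bounded_linear_fst]]) auto
      ultimately show ?thesis
        by (intro Ck_on_add[OF oOm(2) CD] Ck_on_scaleR[OF oOm(2)])
    qed
    show "norm (?g' (s, p, w) - ?g' (s, p, w')) \<le> norm (w - w') / 2"
      if "s \<in> {0..1}" "p \<in> ball 0 R" for s p w w'
    proof -
      let ?z = "(s, p, u (sig s p))"
      have uV: "u (sig s p) \<in> V" using sigB[OF that] Suc.prems(5) by blast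
      have zO: "?z \<in> ?Om" using sigB[OF that] that uV by (simp add: Om_def)
      have "((\<lambda>w. g (s, p, w)) has_derivative (\<lambda>h. ?D ?z (0, 0, h))) (at (u (sig s p)))"
        using has_derivative_compose[OF has_derivative_Pair[OF has_derivative_const has_derivative_Pair[OF has_derivative_const has_derivative_ident]] Ck_on_SucE[OF Suc.prems(2) zO]]
        by simp
      then have b: "norm (?D ?z (0, 0, h)) \<le> 1/2 * norm h" for h
        by (rule has_derivative_lipschitz_bound[OF _ Suc.prems(1) uV])
          (use Suc.prems(3)[OF that _ uV] in auto)
      have "?g' (s, p, w) - ?g' (s, p, w') = c s *\<^sub>R ?D ?z (0, 0, w - w')"
        by (simp add: linear_diff[OF lin0[OF zO]] scaleR_diff_right)
      also have "norm \<dots> \<le> 1 * (1/2 * norm (w - w'))"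
        unfolding norm_scaleR by (intro mult_mono b c(2) that) auto
      finally show ?thesis by simp
    qed
    show "continuous_on (ball 0 R) (\<lambda>p. frechet_derivative u (at p) v)" using u1 by simp
    show "frechet_derivative u (at p) v = integral {0..1} (\<lambda>s. ?g' (s, p, frechet_derivative u (at (sig s p)) v))"
      if p: "p \<in> ball 0 R" for p
    proof -
      have "?D (s, p, u (sig s p)) (0, v, frechet_derivative u (at (sig s p)) (sig s v))
          = ?g' (s, p, frechet_derivative u (at (sig s p)) v)" if s: "s \<in> {0..1}" for s
      proof -
        let ?z = "(s, p, u (sig s p))"
        have zO: "?z \<in> ?Om" using sigB[OF s p] p Suc.prems(5) by (auto simp: Om_def)
        have "frechet_derivative u (at (sig s p)) (sig s v) = c s *\<^sub>R frechet_derivative u (at (sig s p)) v"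
          using has_derivative_linear[OF derU[OF sigB[OF s p]]] by (simp add: c(1) linear_scale)
        then show ?thesis
          using linear_add[OF lin[OF zO], of "(0, v, 0)" "(0, 0, c s *\<^sub>R frechet_derivative u (at (sig s p)) v)"]
            linear_scale[OF lin0[OF zO], of "c s"] by simp
      qed
      then show ?thesis unfolding Du[OF p] by (intro integral_cong) blast
    qed
  qed auto
  \<comment> \<open>Every \<open>v\<close> is the sum of the eigenvectors \<open>pr v\<close>, with
    eigenvalue \<open>s\<close>, and \<open>v - pr v\<close>, with eigenvalue 1.\<close>
  have "Ck_on k (ball 0 R) (\<lambda>p. frechet_derivative u (at p) v)" for v
  proof -
    have "Ck_on k (ball 0 R) (\<lambda>p. frechet_derivative u (at p) (pr v))"
      by (rule eig[of _ "\<lambda>s. s"]) (auto simp: sig_def pr_simps Ck_on_linear bounded_linear_ident)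
    moreover have "Ck_on k (ball 0 R) (\<lambda>p. frechet_derivative u (at p) (v - pr v))"
      by (rule eig[of _ "\<lambda>s. 1"]) (auto simp: sig_def pr_simps Ck_on_const)
    ultimately have "Ck_on k (ball 0 R) (\<lambda>p. frechet_derivative u (at p) (pr v) + frechet_derivative u (at p) (v - pr v))"
      by (intro Ck_on_add) auto
    then show ?thesis
      by (rule Ck_on_cong[rotated])
        (use linear_add[OF has_derivative_linear[OF derU], of _ "pr v" "v - pr v"] in auto)
  qed
  then show ?case using Ck_on_SucI[OF open_ball derU] by blast
qed

end

section \<open>The Frobenius theorem\<close>

lemma C1_lipschitz_on_compact_convex:
  fixes f :: "'a::euclidean_space \<Rightarrow> 'b::real_normed_vector"
  assumes "Ck_on 1 S f" "compact K" "convex K" "K \<subseteq> S"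
  obtains L where "L \<ge> 0" "\<And>x y. x \<in> K \<Longrightarrow> y \<in> K \<Longrightarrow> norm (f x - f y) \<le> L * norm (x - y)"
proof -
  let ?D = "\<lambda>x. frechet_derivative f (at x)"
  have der: "(f has_derivative ?D x) (at x)" if "x \<in> K" for x
    using Ck_on_SucE[of 0 S f x] assms that unfolding One_nat_def by blast
  have lin: "linear (?D x)" if "x \<in> K" for x using der[OF that] has_derivative_linear by blast
  have cont: "continuous_on K (\<lambda>x. ?D x v)" for v
    using assms(1,4) unfolding One_nat_def Ck_on.simps by (blast intro: continuous_on_subset)
  let ?f' = "\<lambda>x. Blinfun (?D x) :: 'a \<Rightarrow>\<^sub>L 'b"
  have "bounded (?f' ` K)"
    by (rule compact_imp_bounded[OF compact_continuous_image[OF continuous_on_Blinfun_derivative(1)[OF lin cont] assms(2)]])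
  then obtain L where L: "L > 0" "\<And>x. x \<in> K \<Longrightarrow> norm (?f' x) \<le> L" unfolding bounded_pos by blast
  have "norm (f x - f y) \<le> L * norm (x - y)" if "x \<in> K" "y \<in> K" for x y
  proof (rule differentiable_bound[OF assms(3)])
    show "(f has_derivative ?D x) (at x within K)" if "x \<in> K" for x
      using der[OF that] by (rule has_derivative_at_withinI)
    show "onorm (?D x) \<le> L" if "x \<in> K" for x
      using L(2)[OF that] continuous_on_Blinfun_derivative(2)[OF lin cont that] by (simp add: norm_blinfun.rep_eq)
  qed (use that in auto)
  then show ?thesis using that[of L] L(1) by auto
qed

context radial
begin

lemma norm_pr: "norm (pr v) \<le> 2 * norm v"
  using norm_triangle_sub[of "pr v" v] norm_compl[of v] by (simp add: norm_minus_commute)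

text \<open>The curve \<open>s \<mapsto> \<phi> (sig s p)\<close> solves \<open>u' = Gam u p\<close> with initial value \<open>y0 + p - pr p\<close>. The defect
  \<open>D\<phi> (p) (pr v) - Gam (\<phi> p) v\<close> is 0 because, by involutivity, it satisfies a homogeneous linear
  integral equation with a contracting kernel.\<close>

lemma leaf_parametrization:
  fixes Gam :: "'e \<Rightarrow> 'e \<Rightarrow> 'e"
  assumes S: "open S" "y0 \<in> S" and lin: "\<And>y. y \<in> S \<Longrightarrow> linear (Gam y)"
    and sm: "\<And>v. smooth_on S (\<lambda>y. Gam y v)"
    and Gam_pr: "\<And>y v. y \<in> S \<Longrightarrow> Gam y (pr v) = Gam y v"
    and Gam0: "\<And>v. Gam y0 v = pr v"
    and inv: "\<And>y v w. y \<in> S \<Longrightarrow> frechet_derivative (\<lambda>y. Gam y w) (at y) (Gam y v)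
       = frechet_derivative (\<lambda>y. Gam y v) (at y) (Gam y w)"
  obtains R \<phi> where "R > 0" "smooth_on (ball 0 R) \<phi>" "\<phi> ` ball 0 R \<subseteq> S" "\<phi> 0 = y0"
    "\<And>v. frechet_derivative \<phi> (at 0) v = v"
    "\<And>p v. p \<in> ball 0 R \<Longrightarrow> frechet_derivative \<phi> (at p) (pr v) = Gam (\<phi> p) v"
proof -
  obtain \<rho> where \<rho>: "\<rho> > 0" "cball y0 \<rho> \<subseteq> S" using S open_contains_cball by metis
  let ?K = "cball y0 \<rho>"
  have KS: "y \<in> S" if "y \<in> ?K" for y using that \<rho> by blast
  have "\<exists>L. L \<ge> 0 \<and> (\<forall>x\<in>?K. \<forall>y\<in>?K. norm (Gam x b - Gam y b) \<le> L * norm (x - y))" for b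
  proof -
    have "Ck_on 1 S (\<lambda>y. Gam y b)" using sm[of b] unfolding smooth_on_def by blast
    from C1_lipschitz_on_compact_convex[OF this compact_cball convex_cball \<rho>(2)] show ?thesis by metis
  qed
  then obtain l where l: "\<And>b. l b \<ge> 0" "\<And>b x y. x \<in> ?K \<Longrightarrow> y \<in> ?K \<Longrightarrow> norm (Gam x b - Gam y b) \<le> l b * norm (x - y)"
    by metis
  define L where "L = (\<Sum>b\<in>(Basis::'e set). l b)"
  have L0: "L \<ge> 0" unfolding L_def using l(1) by (simp add: sum_nonneg)
  have L: "norm (Gam x p - Gam y p) \<le> L * norm (x - y) * norm p" if "x \<in> ?K" "y \<in> ?K" for x y p
  proof -
    have "Gam x p - Gam y p = (\<Sum>b\<in>Basis. (p \<bullet> b) *\<^sub>R (Gam x b - Gam y b))"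
      using linear_sum_Basis[OF lin[OF KS[OF that(1)]], of p] linear_sum_Basis[OF lin[OF KS[OF that(2)]], of p]
      by (simp add: scaleR_diff_right sum_subtractf)
    also have "norm \<dots> \<le> (\<Sum>b\<in>Basis. norm p * (l b * norm (x - y)))"
      by (intro sum_norm_le) (auto intro!: mult_mono Basis_le_norm l that)
    also have "\<dots> = L * norm (x - y) * norm p"
      unfolding L_def sum_distrib_right by (simp add: mult.commute mult.assoc)
    finally show ?thesis .
  qed
  \<comment> \<open>The 2 bounds \<open>Gam y0\<close>, which is \<open>pr\<close>; the rest bounds
    the variation of \<open>Gam\<close> over \<open>?K\<close>.\<close>
  define M where "M = 2 + L * \<rho>"
  have M0: "M > 0" using L0 \<rho> by (simp add: M_def add_pos_nonneg)
  have M: "norm (Gam y p) \<le> M * norm p" if "y \<in> ?K" for y p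
  proof -
    have "norm (Gam y p) \<le> norm (Gam y0 p) + norm (Gam y p - Gam y0 p)"
      by (simp add: norm_triangle_sub add.commute)
    also have "\<dots> \<le> 2 * norm p + L * \<rho> * norm p"
    proof (intro add_mono)
      show "norm (Gam y0 p) \<le> 2 * norm p" using norm_pr by (simp add: Gam0)
      have "norm (Gam y p - Gam y0 p) \<le> L * norm (y - y0) * norm p" using L[OF that, of y0] \<rho> by simp
      also have "\<dots> \<le> L * \<rho> * norm p"
        using that L0 by (intro mult_right_mono mult_left_mono) (auto simp: dist_norm norm_minus_commute)
      finally show "norm (Gam y p - Gam y0 p) \<le> L * \<rho> * norm p" .
    qed
    finally show ?thesis by (simp add: M_def algebra_simps)
  qed
  \<comment> \<open>The first entry gives \<open>L * R \<le> 1/2\<close>, the contraction. The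
    second keeps the solution in the ball around \<open>y0\<close>: the displacement is at most
    \<open>norm p\<close> from \<open>p - pr p\<close> plus \<open>M * norm p\<close> from
    \<open>Gam\<close>.\<close>
  define R where "R = min (1 / (2 * (L + 1))) (\<rho> / (2 * (1 + M)))"
  have R: "R > 0" "L * R \<le> 1/2" "(1 + M) * R < \<rho>"
  proof -
    show "R > 0" unfolding R_def using L0 M0 \<rho> by simp
    have "L * R \<le> L * (1 / (2 * (L + 1)))" unfolding R_def using L0 by (intro mult_left_mono) auto
    also have "\<dots> \<le> 1/2" using L0 by (simp add: field_simps)
    finally show "L * R \<le> 1/2" .
    have "(1 + M) * R \<le> (1 + M) * (\<rho> / (2 * (1 + M)))" unfolding R_def using M0 by (intro mult_left_mono) auto
    also have "\<dots> = \<rho> / 2"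
    proof -
      have "1 + M \<noteq> 0" using M0 by linarith
      then show ?thesis by (simp add: divide_simps)
    qed
    also have "\<dots> < \<rho>" using \<rho> by simp
    finally show "(1 + M) * R < \<rho>" .
  qed
  \<comment> \<open>\<open>fixed_point_exists\<close> needs a kernel that is contractive for all
    \<open>w\<close>; the nonexpansive retraction onto \<open>?K\<close> provides one. It acts as
    the identity on the values of the solution, which stay inside \<open>?K\<close>.\<close>
  define cl where "cl = closest_point ?K"
  have ne: "?K \<noteq> {}" using \<rho> by auto
  have cl: "cl w \<in> ?K" "continuous_on A cl" "norm (cl w - cl w') \<le> norm (w - w')" "w \<in> ?K \<Longrightarrow> cl w = w" for w w' A
    unfolding cl_def using closest_point_in_set[OF closed_cball ne] continuous_on_closest_point[OF convex_cball closed_cball ne]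
      closest_point_lipschitz[OF convex_cball closed_cball ne, of w w'] closest_point_self
    by (auto simp: dist_norm simp del: mem_cball)
  let ?G = "\<lambda>s p w. y0 + (p - pr p) + Gam (cl w) p"
  obtain \<phi> where \<phi>: "continuous_on (cball 0 R) \<phi>"
    "\<And>p. p \<in> cball 0 R \<Longrightarrow> \<phi> p = integral {0..1} (\<lambda>s. ?G s p (\<phi> (sig s p)))"
  proof (rule fixed_point_exists[of R ?G])
    have cG: "continuous_on UNIV (\<lambda>w. Gam (cl w) b)" for b
      by (rule continuous_on_compose2[OF smooth_on_imp_continuous[OF sm] cl(2)]) (use cl(1) KS in blast)
    have "continuous_on ({0..1} \<times> cball 0 R \<times> UNIV)
        (\<lambda>z. y0 + (fst (snd z) - pr (fst (snd z))) + (\<Sum>b\<in>Basis. (fst (snd z) \<bullet> b) *\<^sub>R Gam (cl (snd (snd z))) b))"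
      by (intro continuous_intros bounded_linear.continuous_on[OF bl_pr] continuous_on_compose2[OF cG]) auto
    then show "continuous_on ({0..1} \<times> cball 0 R \<times> UNIV) (\<lambda>(s, p, w). ?G s p w)"
      by (simp add: split_beta linear_sum_Basis[OF lin[OF KS[OF cl(1)]], symmetric])
    show "norm (?G s p w - ?G s p w') \<le> norm (w - w') / 2" if "s \<in> {0..1}" "p \<in> cball 0 R" for s p w w'
    proof -
      have "norm (?G s p w - ?G s p w') \<le> L * norm (cl w - cl w') * norm p"
        using L[OF cl(1) cl(1), of w p w'] by simp
      also have "\<dots> \<le> L * norm (w - w') * R"
        using L0 cl(3) that by (intro mult_mono mult_left_mono) auto
      also have "\<dots> = (L * R) * norm (w - w')" by simp
      also have "\<dots> \<le> 1/2 * norm (w - w')" by (intro mult_right_mono R) auto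
      finally show ?thesis by simp
    qed
  qed (use R in auto)
  let ?B = "ball (0::'e) R"
  have sigB: "sig s p \<in> ?B" if "s \<in> {0..1}" "p \<in> ?B" for s p
    using norm_sig[OF that(1), of p] that(2) by simp
  have \<phi>b: "\<phi> p \<in> ball y0 \<rho>" if p: "p \<in> cball 0 R" for p
  proof -
    have c: "continuous_on {0..1} (\<lambda>s. ?G s p (\<phi> (sig s p)))"
    proof -
      have "continuous_on {0..1} (\<lambda>s. \<phi> (sig s p))"
        by (intro continuous_on_compose2[OF \<phi>(1)] continuous_on_sig continuous_intros)
          (use p norm_sig order_trans in fastforce)
      then have "continuous_on {0..1} (\<lambda>s. cl (\<phi> (sig s p)))"
        by (rule continuous_on_compose2[OF cl(2)]) auto
      then have "continuous_on {0..1} (\<lambda>s. Gam (cl (\<phi> (sig s p))) p)"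
        by (rule continuous_on_compose2[OF smooth_on_imp_continuous[OF sm]]) (use cl(1) KS in blast)
      then show ?thesis by (intro continuous_intros)
    qed
    have "\<phi> p - y0 = integral {0..1} (\<lambda>s. ?G s p (\<phi> (sig s p)) - y0)"
      using \<phi>(2)[OF p] integral_diff[OF integrable_continuous_interval[OF c] integrable_continuous_interval[OF continuous_on_const], of y0]
      by simp
    also have "norm \<dots> \<le> ((1 + M) * R) * (1 - 0)"
    proof (rule integral_bound)
      show "norm (?G t p (\<phi> (sig t p)) - y0) \<le> (1 + M) * R" for t
      proof -
        have "norm (?G t p (\<phi> (sig t p)) - y0) \<le> norm (p - pr p) + norm (Gam (cl (\<phi> (sig t p))) p)"
          using norm_triangle_ineq[of "p - pr p" "Gam (cl (\<phi> (sig t p))) p"] by (simp add: algebra_simps)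
        also have "\<dots> \<le> 1 * norm p + M * norm p" using norm_compl M[OF cl(1)] by (intro add_mono) auto
        also have "\<dots> = (1 + M) * norm p" by (simp add: algebra_simps)
        also have "\<dots> \<le> (1 + M) * R" using p M0 by (intro mult_left_mono) auto
        finally show ?thesis .
      qed
    qed (rule zero_le_one, intro continuous_on_diff c continuous_on_const)
    finally show ?thesis using R(3) by (simp add: dist_norm norm_minus_commute)
  qed

  \<comment> \<open>Smoothness of the solution of the integral equation\<close>
  let ?V = "ball y0 \<rho>"
  let ?g = "\<lambda>z::real \<times> 'e \<times> 'e. y0 + (fst (snd z) - pr (fst (snd z))) + Gam (snd (snd z)) (fst (snd z))"
  let ?Om = "Om ?B ?V :: (real \<times> 'e \<times> 'e) set"
  have oOm: "open ?Om" by (intro open_Om open_ball)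
  have OmS: "snd (snd z) \<in> S" if "z \<in> ?Om" for z
    using that KS unfolding Om_def by force
  have gsm: "smooth_on ?Om ?g"
  proof -
    have bl: "bounded_linear (\<lambda>z::real \<times> 'e \<times> 'e. fst (snd z))" "bounded_linear (\<lambda>z::real \<times> 'e \<times> 'e. snd (snd z))"
      by (intro bounded_linear_compose[OF bounded_linear_fst bounded_linear_snd]
          bounded_linear_compose[OF bounded_linear_snd bounded_linear_snd])+
    have "smooth_on ?Om (\<lambda>z. Gam (snd (snd z)) b)" for b
      by (rule smooth_on_compose[OF oOm S(1) sm]) (use OmS smooth_on_linear[OF oOm bl(2)] in auto)
    from smooth_on_apply[OF oOm lin[OF OmS] this smooth_on_linear[OF oOm bl(1)]]
    have "smooth_on ?Om (\<lambda>z. Gam (snd (snd z)) (fst (snd z)))" by blast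
    moreover have "smooth_on ?Om (\<lambda>z. fst (snd z) - pr (fst (snd z)))"
      by (rule smooth_on_linear[OF oOm bounded_linear_sub[OF bl(1) bounded_linear_compose[OF bl_pr bl(1)]]])
    ultimately show ?thesis
      by (rule smooth_on_add[OF oOm smooth_on_add[OF oOm smooth_on_const[OF oOm]], rotated])
  qed
  have glip: "norm (?g (s, p, w) - ?g (s, p, w')) \<le> norm (w - w') / 2"
    if "s \<in> {0..1}" "p \<in> ?B" "w \<in> ?V" "w' \<in> ?V" for s :: real and p w w'
  proof -
    have "norm (?g (s, p, w) - ?g (s, p, w')) \<le> L * norm (w - w') * norm p"
      using L[of w w' p] that by simp
    also have "\<dots> \<le> L * norm (w - w') * R" using L0 that by (intro mult_left_mono) auto
    also have "\<dots> = (L * R) * norm (w - w')" by simp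
    also have "\<dots> \<le> 1/2 * norm (w - w')" by (intro mult_right_mono R) auto
    finally show ?thesis by simp
  qed
  have \<phi>c: "continuous_on ?B \<phi>" using \<phi>(1) by (rule continuous_on_subset) auto
  have \<phi>V: "\<phi> ` ?B \<subseteq> ?V" using \<phi>b by auto
  have \<phi>eq: "\<phi> p = integral {0..1} (\<lambda>s. ?g (s, p, \<phi> (sig s p)))" if p: "p \<in> ?B" for p
  proof -
    have "\<phi> p = integral {0..1} (\<lambda>s. ?G s p (\<phi> (sig s p)))" using \<phi>(2)[of p] p by simp
    also have "\<dots> = integral {0..1} (\<lambda>s. ?g (s, p, \<phi> (sig s p)))"
    proof (rule integral_cong)
      fix s :: real assume "s \<in> {0..1}"
      then have "\<phi> (sig s p) \<in> ?V" using \<phi>V sigB[OF _ p] by blast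
      then have "\<phi> (sig s p) \<in> ?K" by simp
      from cl(4)[OF this] show "?G s p (\<phi> (sig s p)) = ?g (s, p, \<phi> (sig s p))" by simp
    qed
    finally show ?thesis .
  qed
  have VK: "?V \<subseteq> ?K" by auto
  have \<phi>S: "\<phi> ` ?B \<subseteq> S" using \<phi>V VK KS by blast
  have \<phi>sm: "smooth_on ?B \<phi>"
    unfolding smooth_on_def
  proof
    fix k
    show "Ck_on k ?B \<phi>"
      by (rule fixed_point_Ck[OF open_ball _ glip \<phi>c \<phi>V \<phi>eq]) (use gsm in \<open>auto simp: smooth_on_def\<close>)
  qed

  \<comment> \<open>Tangency of the solution to the distribution\<close>
  let ?D\<phi> = "\<lambda>p. frechet_derivative \<phi> (at p)"
  have der\<phi>: "(\<phi> has_derivative ?D\<phi> p) (at p)" if "p \<in> ?B" for p using smooth_onD[OF \<phi>sm that] .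
  have lin\<phi>: "linear (?D\<phi> p)" if "p \<in> ?B" for p using der\<phi>[OF that] has_derivative_linear by blast
  let ?DG = "\<lambda>y w h. frechet_derivative (\<lambda>y. Gam y w) (at y) h"
  have derG: "((\<lambda>y. Gam y w) has_derivative ?DG y w) (at y)" if "y \<in> S" for y w
    using smooth_onD[OF sm that] .
  have linG: "linear (?DG y w)" if "y \<in> S" for y w using derG[OF that] has_derivative_linear by blast
  have Dg: "frechet_derivative ?g (at z) (0, v, h) = v - pr v + Gam (snd (snd z)) v + ?DG (snd (snd z)) (fst (snd z)) h"
    if z: "z \<in> ?Om" for z v h
  proof -
    have d1: "((\<lambda>z. Gam (snd (snd z)) w) has_derivative (\<lambda>h. ?DG (snd (snd z)) w (snd (snd h)))) (at z)" for w
      by (rule has_derivative_compose[where f="\<lambda>z. snd (snd z)" and g="\<lambda>y. Gam y w"])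
        (auto intro!: derivative_eq_intros derG OmS z)
    have d2: "((\<lambda>z. fst (snd z)) has_derivative (\<lambda>h. fst (snd h))) (at z)"
      by (auto intro!: derivative_eq_intros)
    have "((\<lambda>z. Gam (snd (snd z)) (fst (snd z))) has_derivative
       (\<lambda>h. ?DG (snd (snd z)) (fst (snd z)) (snd (snd h)) + Gam (snd (snd z)) (fst (snd h)))) (at z)"
      by (rule has_derivative_apply[where A="\<lambda>z. Gam (snd (snd z))" and w="\<lambda>z. fst (snd z)" and w'="\<lambda>h. fst (snd h)"
            and A'="\<lambda>w h. ?DG (snd (snd z)) w (snd (snd h))", OF oOm z lin[OF OmS] d1 d2])
    then have "(?g has_derivative (\<lambda>h. (fst (snd h) - pr (fst (snd h))) +
        (?DG (snd (snd z)) (fst (snd z)) (snd (snd h)) + Gam (snd (snd z)) (fst (snd h))))) (at z)"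
      by (auto intro!: derivative_eq_intros bounded_linear.has_derivative[OF bl_pr])
    from fun_cong[OF frechet_derivative_at[OF this], of "(0, v, h)", symmetric] show ?thesis
      by (simp add: algebra_simps)
  qed
  have \<phi>y: "\<phi> (sig s p) \<in> S" if "s \<in> {0..1}" "p \<in> ?B" for s p using \<phi>S sigB[OF that] by blast
  have D\<phi>: "?D\<phi> p v = integral {0..1} (\<lambda>s. v - pr v + Gam (\<phi> (sig s p)) v + ?DG (\<phi> (sig s p)) p (?D\<phi> (sig s p) (sig s v)))"
    if p: "p \<in> ?B" for p v
  proof -
    have "Ck_on 1 ?Om ?g" using gsm unfolding smooth_on_def by blast
    from fixed_point_C1(2)[OF open_ball this glip \<phi>c \<phi>V \<phi>eq p, of v]
    have "?D\<phi> p v = integral {0..1} (\<lambda>s. frechet_derivative ?g (at (s, p, \<phi> (sig s p))) (0, v, ?D\<phi> (sig s p) (sig s v)))" .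
    also have "\<dots> = integral {0..1} (\<lambda>s. v - pr v + Gam (\<phi> (sig s p)) v + ?DG (\<phi> (sig s p)) p (?D\<phi> (sig s p) (sig s v)))"
    proof (rule integral_cong)
      fix s :: real assume s: "s \<in> {0..1}"
      have "(s, p, \<phi> (sig s p)) \<in> ?Om" using p sigB[OF s p] \<phi>V unfolding Om_def by blast
      from Dg[OF this] show "frechet_derivative ?g (at (s, p, \<phi> (sig s p))) (0, v, ?D\<phi> (sig s p) (sig s v))
        = v - pr v + Gam (\<phi> (sig s p)) v + ?DG (\<phi> (sig s p)) p (?D\<phi> (sig s p) (sig s v))" by simp
    qed
    finally show ?thesis .
  qed
  \<comment> \<open>Fundamental theorem of calculus for
    \<open>s *\<^sub>R Gam (\<phi> (sig s p)) w\<close>, which vanishes at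
    \<open>s = 0\<close>.\<close>
  have radial_int: "((\<lambda>s. Gam (\<phi> (sig s p)) w + s *\<^sub>R ?DG (\<phi> (sig s p)) w (?D\<phi> (sig s p) (pr p)))
     has_integral Gam (\<phi> p) w) {0..1}" if p: "p \<in> ?B" for p w
  proof -
    have "((\<lambda>s. s *\<^sub>R Gam (\<phi> (sig s p)) w) has_vector_derivative
       Gam (\<phi> (sig s p)) w + s *\<^sub>R ?DG (\<phi> (sig s p)) w (?D\<phi> (sig s p) (pr p))) (at s within {0..1})"
      if s: "s \<in> {0..1}" for s
    proof -
      have "((\<lambda>s. sig s p) has_derivative (\<lambda>h. h *\<^sub>R pr p)) (at s within {0..1})"
        unfolding sig_def by (auto intro!: derivative_eq_intros)
      then have "((\<lambda>s. \<phi> (sig s p)) has_derivative (\<lambda>h. ?D\<phi> (sig s p) (h *\<^sub>R pr p))) (at s within {0..1})"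
        by (rule has_derivative_compose[where f="\<lambda>s. sig s p" and g=\<phi>, OF _ der\<phi>[OF sigB[OF s p]]])
      then have "((\<lambda>s. Gam (\<phi> (sig s p)) w) has_derivative (\<lambda>h. ?DG (\<phi> (sig s p)) w (?D\<phi> (sig s p) (h *\<^sub>R pr p)))) (at s within {0..1})"
        by (rule has_derivative_compose[where f="\<lambda>s. \<phi> (sig s p)" and g="\<lambda>y. Gam y w", OF _ derG[OF \<phi>y[OF s p], of w]])
      from has_derivative_scaleR[OF has_derivative_ident this] show ?thesis
        unfolding has_vector_derivative_def
        by (rule has_derivative_eq_rhs)
          (auto simp: linear_scale[OF lin\<phi>[OF sigB[OF s p]]] linear_scale[OF linG[OF \<phi>y[OF s p]]] algebra_simps)
    qed
    from fundamental_theorem_of_calculus[OF _ this] show ?thesis by simp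
  qed
  \<comment> \<open>The formula \<open>D\<phi>\<close> in direction \<open>pr p\<close> has the
    integrand of \<open>radial_int\<close> with \<open>w = p\<close>, since \<open>sig s\<close>
    multiplies \<open>pr p\<close> by \<open>s\<close>. This says that the rays are integral
    curves.\<close>
  have radial: "?D\<phi> p (pr p) = Gam (\<phi> p) p" if p: "p \<in> ?B" for p
  proof -
    have "?D\<phi> p (pr p) = integral {0..1} (\<lambda>s. Gam (\<phi> (sig s p)) p + s *\<^sub>R ?DG (\<phi> (sig s p)) p (?D\<phi> (sig s p) (pr p)))"
      unfolding D\<phi>[OF p]
    proof (rule integral_cong)
      fix s :: real assume s: "s \<in> {0..1}"
      show "pr p - pr (pr p) + Gam (\<phi> (sig s p)) (pr p) + ?DG (\<phi> (sig s p)) p (?D\<phi> (sig s p) (sig s (pr p)))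
        = Gam (\<phi> (sig s p)) p + s *\<^sub>R ?DG (\<phi> (sig s p)) p (?D\<phi> (sig s p) (pr p))"
        using Gam_pr[OF \<phi>y[OF s p]]
        by (simp add: sig_def[of _ "pr p"] linear_scale[OF lin\<phi>[OF sigB[OF s p]]] linear_scale[OF linG[OF \<phi>y[OF s p]]])
    qed
    also have "\<dots> = Gam (\<phi> p) p" using radial_int[OF p] by (rule integral_unique)
    finally show ?thesis .
  qed
  have DGbound: "norm (?DG y p h) \<le> 1/2 * norm h" if y: "y \<in> ?V" and p: "p \<in> ?B" for y p h
  proof (rule has_derivative_lipschitz_bound[OF derG open_ball y])
    show "y \<in> S" using y KS by force
    fix x assume "x \<in> ?V"
    then have "norm (Gam x p - Gam y p) \<le> L * norm (x - y) * norm p" using L[of x y p] y by simp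
    also have "\<dots> \<le> L * norm (x - y) * R" using L0 p by (intro mult_left_mono) auto
    also have "\<dots> = (L * R) * norm (x - y)" by simp
    also have "\<dots> \<le> 1/2 * norm (x - y)" by (intro mult_right_mono R) auto
    finally show "norm (Gam x p - Gam y p) \<le> 1/2 * norm (x - y)" .
  qed
  have tangent: "?D\<phi> p (pr v) = Gam (\<phi> p) v" if p: "p \<in> ?B" for p v
  proof -
    let ?E = "\<lambda>q. ?D\<phi> q (pr v) - Gam (\<phi> q) v"
    have cD: "continuous_on ?B (\<lambda>q. ?D\<phi> q w)" for w
      by (intro smooth_on_imp_continuous smooth_on_frechet_derivative \<phi>sm)
    have cs: "continuous_on {0..1} (\<lambda>s. sig s p)" for p by (intro continuous_on_sig continuous_intros)
    have csD: "continuous_on {0..1} (\<lambda>s. ?D\<phi> (sig s p) w)" if "p \<in> ?B" for w p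
      by (rule continuous_on_compose2[OF cD cs]) (use sigB that in auto)
    have csG: "continuous_on {0..1} (\<lambda>s. Gam (\<phi> (sig s p)) w)" if "p \<in> ?B" for w p
      by (rule continuous_on_compose2[OF smooth_on_imp_continuous[OF sm] continuous_on_compose2[OF \<phi>c cs]])
        (use sigB \<phi>y that in auto)
    have csDG: "continuous_on {0..1} (\<lambda>s. ?DG (\<phi> (sig s p)) w (X s))" if p: "p \<in> ?B" and X: "continuous_on {0..1} X" for w p X
    proof -
      have "continuous_on {0..1} (\<lambda>s. ?DG (\<phi> (sig s p)) w b)" for b
        by (rule continuous_on_compose2[OF smooth_on_imp_continuous[OF smooth_on_frechet_derivative[OF sm]] continuous_on_compose2[OF \<phi>c cs]])
          (use sigB \<phi>y p in auto)
      then have "continuous_on {0..1} (\<lambda>s. \<Sum>b\<in>Basis. (X s \<bullet> b) *\<^sub>R ?DG (\<phi> (sig s p)) w b)"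
        by (intro continuous_intros X)
      then show ?thesis
        by (rule continuous_on_eq) (rule linear_sum_Basis[OF linG[OF \<phi>y[OF _ p]], symmetric])
    qed
    \<comment> \<open>Subtracting \<open>radial_int\<close> for \<open>v\<close> cancels the
      \<open>Gam\<close> terms; involutivity then exchanges \<open>p\<close> and \<open>v\<close> in
      the second derivative term, so that only the defect further down the ray remains.\<close>
    have E_eq: "?E p = integral {0..1} (\<lambda>s. s *\<^sub>R ?DG (\<phi> (sig s p)) p (?E (sig s p)))" if p: "p \<in> ?B" for p
    proof -
      have 1: "?D\<phi> p (pr v) = integral {0..1} (\<lambda>s. Gam (\<phi> (sig s p)) v + s *\<^sub>R ?DG (\<phi> (sig s p)) p (?D\<phi> (sig s p) (pr v)))"
        unfolding D\<phi>[OF p]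
      proof (rule integral_cong)
        fix s :: real assume s: "s \<in> {0..1}"
        show "pr v - pr (pr v) + Gam (\<phi> (sig s p)) (pr v) + ?DG (\<phi> (sig s p)) p (?D\<phi> (sig s p) (sig s (pr v)))
          = Gam (\<phi> (sig s p)) v + s *\<^sub>R ?DG (\<phi> (sig s p)) p (?D\<phi> (sig s p) (pr v))"
          using Gam_pr[OF \<phi>y[OF s p]]
          by (simp add: sig_def[of _ "pr v"] linear_scale[OF lin\<phi>[OF sigB[OF s p]]] linear_scale[OF linG[OF \<phi>y[OF s p]]])
      qed
      have i1: "(\<lambda>s. Gam (\<phi> (sig s p)) v + s *\<^sub>R ?DG (\<phi> (sig s p)) p (?D\<phi> (sig s p) (pr v))) integrable_on {0..1}"
        by (intro integrable_continuous_interval continuous_intros csG csDG csD p)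
      have "?E p = integral {0..1} (\<lambda>s. (Gam (\<phi> (sig s p)) v + s *\<^sub>R ?DG (\<phi> (sig s p)) p (?D\<phi> (sig s p) (pr v)))
         - (Gam (\<phi> (sig s p)) v + s *\<^sub>R ?DG (\<phi> (sig s p)) v (?D\<phi> (sig s p) (pr p))))"
        using radial_int[OF p, of v] integral_diff[OF i1 has_integral_integrable[OF radial_int[OF p, of v]]]
        by (simp only: 1[symmetric] integral_unique)
      also have "\<dots> = integral {0..1} (\<lambda>s. s *\<^sub>R ?DG (\<phi> (sig s p)) p (?E (sig s p)))"
      proof (rule integral_cong)
        fix s :: real assume s: "s \<in> {0..1}"
        note lG = linG[OF \<phi>y[OF s p]]
        \<comment> \<open>The factor \<open>s\<close> stays: \<open>radial\<close> at
          \<open>sig s p\<close> speaks of \<open>pr (sig s p) = s *\<^sub>R pr p\<close>, and at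
          \<open>s = 0\<close> it cannot be cancelled.\<close>
        have "s *\<^sub>R ?D\<phi> (sig s p) (pr p) = s *\<^sub>R Gam (\<phi> (sig s p)) p"
        proof -
          have ps: "pr (sig s p) = s *\<^sub>R pr p" by (simp add: sig_def pr_simps)
          have "s *\<^sub>R ?D\<phi> (sig s p) (pr p) = ?D\<phi> (sig s p) (pr (sig s p))"
            unfolding ps by (simp add: linear_scale[OF lin\<phi>[OF sigB[OF s p]]])
          also have "\<dots> = Gam (\<phi> (sig s p)) (sig s p)" using radial[OF sigB[OF s p]] .
          also have "\<dots> = Gam (\<phi> (sig s p)) (pr (sig s p))" using Gam_pr[OF \<phi>y[OF s p]] by simp
          also have "\<dots> = s *\<^sub>R Gam (\<phi> (sig s p)) p"
            unfolding ps using Gam_pr[OF \<phi>y[OF s p]] by (simp add: linear_scale[OF lin[OF \<phi>y[OF s p]]])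
          finally show ?thesis .
        qed
        then have "s *\<^sub>R ?DG (\<phi> (sig s p)) v (?D\<phi> (sig s p) (pr p)) = s *\<^sub>R ?DG (\<phi> (sig s p)) v (Gam (\<phi> (sig s p)) p)"
          by (metis linear_scale[OF lG])
        also have "\<dots> = s *\<^sub>R ?DG (\<phi> (sig s p)) p (Gam (\<phi> (sig s p)) v)"
          using inv[OF \<phi>y[OF s p], of v p] by simp
        finally show "(Gam (\<phi> (sig s p)) v + s *\<^sub>R ?DG (\<phi> (sig s p)) p (?D\<phi> (sig s p) (pr v)))
         - (Gam (\<phi> (sig s p)) v + s *\<^sub>R ?DG (\<phi> (sig s p)) v (?D\<phi> (sig s p) (pr p)))
         = s *\<^sub>R ?DG (\<phi> (sig s p)) p (?E (sig s p))"
          by (simp add: linear_diff[OF lG] scaleR_diff_right)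
      qed
      finally show ?thesis .
    qed
    \<comment> \<open>\<open>sup_half_bound\<close> with \<open>c = 0\<close>: a defect bounded by
      half of its own maximum vanishes.\<close>
    have "norm (?E (sig 1 p)) \<le> 2 * 0"
    proof (rule sup_half_bound[of "\<lambda>s. norm (?E (sig s p))"])
      show "continuous_on {0..1} (\<lambda>s. norm (?E (sig s p)))" by (intro continuous_intros csD csG p)
      fix s M :: real assume s: "s \<in> {0..1}" and M: "\<And>t. t \<in> {0..1} \<Longrightarrow> norm (?E (sig t p)) \<le> M"
      let ?q = "sig s p"
      have q: "?q \<in> ?B" using sigB[OF s p] .
      have "norm (?E ?q) \<le> (M / 2) * (1 - 0)"
        unfolding E_eq[OF q]
      proof (rule integral_bound)
        show "continuous_on {0..1} (\<lambda>t. t *\<^sub>R ?DG (\<phi> (sig t ?q)) ?q (?E (sig t ?q)))"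
          by (intro continuous_intros csDG csD csG q)
        show "norm (t *\<^sub>R ?DG (\<phi> (sig t ?q)) ?q (?E (sig t ?q))) \<le> M / 2" if t: "t \<in> {0..1}" for t
        proof -
          have ts: "t * s \<in> {0..1}" using t s by (auto intro: mult_le_one)
          have "norm (t *\<^sub>R ?DG (\<phi> (sig t ?q)) ?q (?E (sig t ?q))) \<le> 1 * (1/2 * norm (?E (sig t ?q)))"
            unfolding norm_scaleR using t q subsetD[OF \<phi>V imageI[OF sigB[OF t q]]] by (intro mult_mono DGbound) auto
          also have "\<dots> \<le> M / 2" using M[OF ts] by (simp add: sig_sig)
          finally show ?thesis .
        qed
      qed simp
      then show "norm (?E ?q) \<le> 0 + M / 2" by simp
    qed simp
    then show ?thesis by simp
  qed
  have 0: "0 \<in> ?B" using R by simp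
  have sig0: "sig s 0 = 0" for s by (simp add: sig_def pr_simps)
  have "\<phi> 0 = y0"
    using \<phi>eq[OF 0] linear_0[OF lin] \<phi>S 0 by (simp add: sig0 pr_simps image_subset_iff)
  moreover have "?D\<phi> 0 v = v" for v
  proof -
    \<comment> \<open>At \<open>p = 0\<close> the term with the derivative of \<open>Gam\<close>
      differentiates the zero function; \<open>v - pr v + pr v\<close> remains.\<close>
    have z: "?DG y0 0 h = 0" for h
    proof -
      have "((\<lambda>y. Gam y 0) has_derivative (\<lambda>h. 0)) (at y0)"
        by (rule has_derivative_transform_within_open[OF has_derivative_const S]) (simp add: linear_0[OF lin])
      from has_derivative_unique[OF this derG[OF S(2)]] show ?thesis by metis
    qed
    show ?thesis using D\<phi>[OF 0, of v] \<open>\<phi> 0 = y0\<close> by (simp add: sig0 z Gam0)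
  qed
  ultimately show ?thesis using that[OF R(1) \<phi>sm \<phi>S] tangent by blast
qed

text \<open>The local inverse \<open>\<psi>\<close> of the leaf parametrization straightens the
  leaves into translates of the range of \<open>pr\<close>, so the complementary component
  \<open>\<psi> y - pr (\<psi> y)\<close> is constant on them. The right inverse \<open>s\<close> of
  its derivative is the derivative of the parametrization at \<open>\<psi> y\<close>.\<close>

theorem frobenius:
  fixes Gam :: "'e \<Rightarrow> 'e \<Rightarrow> 'e"
  assumes S: "open S" "y0 \<in> S" and lin: "\<And>y. y \<in> S \<Longrightarrow> linear (Gam y)"
    and sm: "\<And>v. smooth_on S (\<lambda>y. Gam y v)"
    and Gam_pr: "\<And>y v. y \<in> S \<Longrightarrow> Gam y (pr v) = Gam y v"
    and Gam0: "\<And>v. Gam y0 v = pr v"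
    and inv: "\<And>y v w. y \<in> S \<Longrightarrow> frechet_derivative (\<lambda>y. Gam y w) (at y) (Gam y v)
       = frechet_derivative (\<lambda>y. Gam y v) (at y) (Gam y w)"
  obtains V f s where "open V" "y0 \<in> V" "V \<subseteq> S" "smooth_on V f" "\<And>y. y \<in> V \<Longrightarrow> pr (f y) = 0"
    "\<And>y h. y \<in> V \<Longrightarrow> frechet_derivative f (at y) h = 0 \<longleftrightarrow> h \<in> range (Gam y)"
    "\<And>y. y \<in> V \<Longrightarrow> linear (s y)" "\<And>c. smooth_on V (\<lambda>y. s y c)"
    "\<And>y c. y \<in> V \<Longrightarrow> pr c = 0 \<Longrightarrow> frechet_derivative f (at y) (s y c) = c"
proof -
  obtain R \<phi> where \<phi>: "R > 0" "smooth_on (ball 0 R) \<phi>" "\<phi> ` ball 0 R \<subseteq> S" "\<phi> 0 = y0"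
    "\<And>v. frechet_derivative \<phi> (at 0) v = v"
    "\<And>p v. p \<in> ball 0 R \<Longrightarrow> frechet_derivative \<phi> (at p) (pr v) = Gam (\<phi> p) v"
    using leaf_parametrization[OF assms] by blast
  let ?D\<phi> = "\<lambda>p. frechet_derivative \<phi> (at p)"
  obtain U V \<psi> where U: "open U" "U \<subseteq> ball 0 R" "0 \<in> U" "open V" "homeomorphism U V \<phi> \<psi>" "smooth_on V \<psi>"
    "\<And>x v. x \<in> U \<Longrightarrow> frechet_derivative \<psi> (at (\<phi> x)) (?D\<phi> x v) = v"
    "\<And>x v. x \<in> U \<Longrightarrow> ?D\<phi> x (frechet_derivative \<psi> (at (\<phi> x)) v) = v"
  proof (rule smooth_inverse_function_theorem[OF open_ball \<phi>(2), of 0])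
    show "0 \<in> ball (0::'e) R" using \<phi>(1) by simp
  qed (use \<phi>(5) in auto)
  have \<psi>: "\<psi> y \<in> U" "\<phi> (\<psi> y) = y" if "y \<in> V" for y
    using U(5) that unfolding homeomorphism_def by blast+
  let ?f = "\<lambda>y. \<psi> y - pr (\<psi> y)"
  let ?D\<psi> = "\<lambda>y. frechet_derivative \<psi> (at y)"
  have derf: "(?f has_derivative (\<lambda>h. ?D\<psi> y h - pr (?D\<psi> y h))) (at y)" if "y \<in> V" for y
    by (intro has_derivative_diff bounded_linear.has_derivative[OF bl_pr] smooth_onD[OF U(6) that])
  have Df: "frechet_derivative ?f (at y) = (\<lambda>h. ?D\<psi> y h - pr (?D\<psi> y h))" if "y \<in> V" for y
    using frechet_derivative_at[OF derf[OF that]] by simp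
  have 1: "?D\<psi> y (?D\<phi> (\<psi> y) v) = v" "?D\<phi> (\<psi> y) (?D\<psi> y v) = v" if "y \<in> V" for y v
    using U(7,8)[OF \<psi>(1)[OF that], of v] \<psi>(2)[OF that] by simp_all
  have G: "?D\<phi> (\<psi> y) (pr v) = Gam y v" if "y \<in> V" for y v
    using \<phi>(6)[of "\<psi> y" v] \<psi>[OF that] U(2) by auto
  show ?thesis
  proof (rule that[of V ?f "\<lambda>y. ?D\<phi> (\<psi> y)"])
    show "open V" by (rule U)
    show "y0 \<in> V" using U(3,5) \<phi>(4) unfolding homeomorphism_def by blast
    show "V \<subseteq> S" using \<psi> U(2) \<phi>(3) by (metis image_subset_iff subset_iff)
    show "smooth_on V ?f" by (intro smooth_on_diff smooth_on_bounded_linear[OF _ bl_pr] U)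
    show "pr (?f y) = 0" for y by (simp add: pr_simps)
    show "frechet_derivative ?f (at y) h = 0 \<longleftrightarrow> h \<in> range (Gam y)" if y: "y \<in> V" for y h
    proof
      assume "frechet_derivative ?f (at y) h = 0"
      then have "?D\<psi> y h = pr (?D\<psi> y h)" using Df[OF y] by simp
      then have "h = Gam y (?D\<psi> y h)" using 1(2)[OF y, of h] G[OF y, of "?D\<psi> y h"] by simp
      then show "h \<in> range (Gam y)" by blast
    next
      assume "h \<in> range (Gam y)"
      then obtain v where "h = Gam y v" by blast
      then have "?D\<psi> y h = pr v" using 1(1)[OF y, of "pr v"] G[OF y] by simp
      then show "frechet_derivative ?f (at y) h = 0" using Df[OF y] by simp
    qed
    show "linear (?D\<phi> (\<psi> y))" if "y \<in> V" for y
      using smooth_onD[OF \<phi>(2)] U(2) \<psi>(1)[OF that] has_derivative_linear by blast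
    show "smooth_on V (\<lambda>y. ?D\<phi> (\<psi> y) c)" for c
      by (rule smooth_on_compose[OF U(4) open_ball smooth_on_frechet_derivative[OF \<phi>(2)] U(6)]) (use \<psi>(1) U(2) in blast)
    show "frechet_derivative ?f (at y) (?D\<phi> (\<psi> y) c) = c" if "y \<in> V" "pr c = 0" for y c
      using that by (simp add: Df 1)
  qed
qed

end

section \<open>Local normal form\<close>

text \<open>Distance at most 1/2 from the identity gives
  \<open>norm v \<le> 2 * norm (T y v)\<close>: injectivity, and the uniform bound behind smoothness
  of the inverse.\<close>

lemma linear_near_id_inverse:
  fixes T :: "'e::euclidean_space \<Rightarrow> 'e \<Rightarrow> 'e"
  assumes "open V" and lin: "\<And>y. y \<in> V \<Longrightarrow> linear (T y)" and sm: "\<And>v. smooth_on V (\<lambda>y. T y v)"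
    and near: "\<And>y v. y \<in> V \<Longrightarrow> norm (T y v - v) \<le> 1/2 * norm v"
  obtains I where "\<And>y. y \<in> V \<Longrightarrow> linear (I y)" "\<And>v. smooth_on V (\<lambda>y. I y v)"
    "\<And>y v. y \<in> V \<Longrightarrow> T y (I y v) = v" "\<And>y v. y \<in> V \<Longrightarrow> I y (T y v) = v"
proof -
  have bd: "norm v \<le> 2 * norm (T y v)" if "y \<in> V" for y v
    using near[OF that, of v] norm_triangle_sub[of v "T y v"] by (simp add: norm_minus_commute)
  define I where "I y = inv (T y)" for y
  have bij: "bij (T y)" if "y \<in> V" for y
  proof -
    have "inj (T y)" unfolding linear_injective_0[OF lin[OF that]]
      using bd[OF that] by (metis norm_zero mult_zero_right norm_le_zero_iff)
    then show ?thesis using linear_injective_imp_surjective[OF lin[OF that]] by (simp add: bij_def)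
  qed
  have TI: "T y (I y v) = v" "I y (T y v) = v" if "y \<in> V" for y v
    using bij[OF that] unfolding I_def by (simp_all add: bij_is_surj surj_f_inv_f bij_is_inj inv_f_f)
  have linI: "linear (I y)" if "y \<in> V" for y
    by (intro linearI) (metis TI that linear_add[OF lin[OF that]], metis TI that linear_scale[OF lin[OF that]])
  show ?thesis
    by (rule that[of I, OF linI smooth_on_operator_inverse[OF assms(1) lin linI TI bd sm] TI])
qed

text \<open>Realizes a varying span as the image of a fixed subspace under smooth linear maps close
  to the identity.\<close>

lemma moving_frame:
  fixes X :: "nat \<Rightarrow> 'e::euclidean_space \<Rightarrow> 'e"
  assumes S: "open S" "y0 \<in> S" and sm: "\<And>i. i < m \<Longrightarrow> smooth_on S (X i)"
    and dim: "dim (span ((\<lambda>i. X i y0) ` {..<m})) = m" and e: "e > 0"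
  obtains V T where "open V" "y0 \<in> V" "V \<subseteq> S" "\<And>y. linear (T y)" "\<And>v. smooth_on V (\<lambda>y. T y v)"
    "\<And>v. T y0 v = v" "\<And>y v. y \<in> V \<Longrightarrow> norm (T y v - v) \<le> e * norm v"
    "\<And>y. T y ` span ((\<lambda>i. X i y0) ` {..<m}) = span ((\<lambda>i. X i y) ` {..<m})"
proof -
  let ?x = "\<lambda>i. X i y0"
  let ?B = "?x ` {..<m}"
  have cB: "card ?B = m"
    using dim dim_le_card[of "span ?B" ?B] card_image_le[of "{..<m}" ?x] by simp
  have inj: "inj_on ?x {..<m}" using cB by (simp add: eq_card_imp_inj_on)
  have ind: "independent ?B"
    using card_le_dim_spanning[of ?B "span ?B"] cB dim by (simp add: span_superset)
  have "\<exists>g. linear g \<and> (\<forall>x\<in>?B. g x = (if x = ?x i then 1 else 0 :: real))" for i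
    using linear_independent_extend[OF ind] .
  then obtain g where g: "\<And>i. linear (g i)" "\<And>i x. x \<in> ?B \<Longrightarrow> g i x = (if x = ?x i then 1 else 0 :: real)"
    by metis
  have gx: "g i (?x j) = (if i = j then 1 else 0)" if "i < m" "j < m" for i j
    using g(2)[of "?x j" i] that inj by (auto simp: inj_on_def)
  \<comment> \<open>The \<open>g i\<close> are dual to the frame at \<open>y0\<close>, so
    \<open>T y\<close> sends each \<open>X i y0\<close> to \<open>X i y\<close> and is the identity
    at \<open>y0\<close>.\<close>
  define T where "T y v = v + (\<Sum>i<m. g i v *\<^sub>R (X i y - ?x i))" for y v
  have Tx: "T y (?x j) = X j y" if "j < m" for j y
  proof -
    have "(\<Sum>i<m. g i (?x j) *\<^sub>R (X i y - ?x i)) = (\<Sum>i<m. if i = j then X i y - ?x i else 0)"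
      by (rule sum.cong) (use gx that in auto)
    then show ?thesis using that by (simp add: T_def)
  qed
  have linT: "linear (T y)" for y
    unfolding T_def
    by (intro linearI) (simp_all add: linear_add[OF g(1)] linear_scale[OF g(1)] scaleR_add_left sum.distrib
        scaleR_add_right scaleR_sum_right)
  have "\<exists>K. K > 0 \<and> (\<forall>v. norm (g i v) \<le> K * norm v)" for i
    using linear_bounded_pos[OF g(1)] by metis
  then obtain K where K: "\<And>i. K i > 0" "\<And>i v. norm (g i v) \<le> K i * norm v" by metis
  let ?N = "\<lambda>y. \<Sum>i<m. K i * norm (X i y - ?x i)"
  define V where "V = S \<inter> ?N -` {..<e}"
  have cN: "continuous_on S ?N"
    by (intro continuous_intros smooth_on_imp_continuous sm) auto
  have oV: "open V" unfolding V_def using cN S(1) by (intro continuous_open_preimage) auto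
  show ?thesis
  proof (rule that[of V T])
    show "y0 \<in> V" using S e by (simp add: V_def)
    show "smooth_on V (\<lambda>y. T y v)" for v
      unfolding T_def using oV sm smooth_on_subset[of S _ V]
      by (intro smooth_on_add smooth_on_const smooth_on_sum smooth_on_scaleR smooth_on_diff) (auto simp: V_def)
    show "T y0 v = v" for v by (simp add: T_def)
    show "norm (T y v - v) \<le> e * norm v" if "y \<in> V" for y v
    proof -
      have "norm (T y v - v) = norm (\<Sum>i<m. g i v *\<^sub>R (X i y - ?x i))" by (simp add: T_def)
      also have "\<dots> \<le> (\<Sum>i<m. (K i * norm v) * norm (X i y - ?x i))"
        by (intro sum_norm_le) (use K in \<open>auto intro!: mult_right_mono\<close>)
      also have "\<dots> = ?N y * norm v" by (simp add: sum_distrib_left sum_distrib_right algebra_simps)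
      also have "\<dots> \<le> e * norm v" using that by (intro mult_right_mono) (auto simp: V_def)
      finally show ?thesis .
    qed
    show "T y ` span ?B = span ((\<lambda>i. X i y) ` {..<m})" for y
    proof -
      have "T y ` ?B = (\<lambda>i. X i y) ` {..<m}" using Tx by (auto simp: image_image)
      then show ?thesis using linear_span_image[OF linT] by metis
    qed
  qed (use oV linT in \<open>auto simp: V_def\<close>)
qed

text \<open>Orthogonality serves the bound \<open>norm_compl\<close> of \<open>radial\<close>, which
  is Pythagoras' theorem.\<close>

lemma orthogonal_projection_exists:
  fixes F :: "'e::euclidean_space set"
  assumes "subspace F"
  obtains pr :: "'e \<Rightarrow> 'e" where "radial pr" "range pr = F"
proof -
  obtain B where B: "B \<subseteq> F" "pairwise orthogonal B" "\<And>x. x \<in> B \<Longrightarrow> norm x = 1" "independent B" "span B = F"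
    using orthonormal_basis_subspace[OF assms] by metis
  have finB: "finite B" using B(4) by (rule independent_imp_finite)
  define pr where "pr v = (\<Sum>b\<in>B. (v \<bullet> b) *\<^sub>R b)" for v
  have lin: "linear pr" unfolding pr_def
    by (intro linearI) (simp_all add: inner_add_left scaleR_add_left sum.distrib scaleR_sum_right)
  have bb: "b \<bullet> c = (if b = c then 1 else 0)" if "b \<in> B" "c \<in> B" for b c
    using that B(2,3) by (auto simp: pairwise_def orthogonal_def norm_eq_1)
  have pib: "pr c = c" if "c \<in> B" for c
  proof -
    have "pr c = (\<Sum>b\<in>B. if b = c then b else 0)"
      unfolding pr_def by (rule sum.cong) (use bb that in auto)
    then show ?thesis using finB that by simp
  qed
  have pinF: "pr v \<in> F" for v
    unfolding pr_def using B(1) assms by (intro subspace_sum subspace_scale) auto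
  have piF: "pr v = v" if "v \<in> F" for v
  proof -
    have "v \<in> span B" using that B(5) by simp
    then show ?thesis
      by (induction rule: span_induct_alt) (simp_all add: linear_0[OF lin] linear_add[OF lin] linear_scale[OF lin] pib)
  qed
  have orth: "(v - pr v) \<bullet> pr v = 0" for v
  proof -
    have "pr v \<bullet> c = v \<bullet> c" if "c \<in> B" for c
    proof -
      have "pr v \<bullet> c = (\<Sum>b\<in>B. if b = c then v \<bullet> b else 0)"
        unfolding pr_def inner_sum_left by (rule sum.cong) (use bb that in auto)
      then show ?thesis using finB that by simp
    qed
    then have "(v - pr v) \<bullet> c = 0" if "c \<in> B" for c using that by (simp add: inner_diff_left)
    then show ?thesis unfolding pr_def[of v] by (subst inner_sum_right) (simp add: pr_def[symmetric])
  qed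
  have "norm (v - pr v) \<le> norm v" for v
  proof -
    have "(norm v)\<^sup>2 = (norm (v - pr v))\<^sup>2 + (norm (pr v))\<^sup>2"
      using norm_add_Pythagorean[of "v - pr v" "pr v"] orth[of v] by (simp add: orthogonal_def)
    then have "(norm (v - pr v))\<^sup>2 \<le> (norm v)\<^sup>2" by simp
    then show ?thesis by (rule power2_le_imp_le) simp
  qed
  then have "radial pr" unfolding radial_def using lin piF pinF by blast
  moreover have "range pr = F" using pinF piF by (metis image_subset_iff rangeI subsetI subset_antisym UNIV_I)
  ultimately show ?thesis by (rule that)
qed

text \<open>\<open>Gam y v\<close> is the vector in the span of the frame at \<open>y\<close> whose projection is \<open>pr v\<close>.\<close>

lemma adapted_graph:
  fixes X :: "nat \<Rightarrow> 'e::euclidean_space \<Rightarrow> 'e" and pr :: "'e \<Rightarrow> 'e"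
  assumes S: "open S" "y0 \<in> S" and sm: "\<And>i. i < m \<Longrightarrow> smooth_on S (X i)"
    and dim: "dim (span ((\<lambda>i. X i y0) ` {..<m})) = m"
    and pr: "radial pr" "range pr = span ((\<lambda>i. X i y0) ` {..<m})"
  obtains V Gam where "open V" "y0 \<in> V" "V \<subseteq> S" "\<And>y. y \<in> V \<Longrightarrow> linear (Gam y)" "\<And>v. smooth_on V (\<lambda>y. Gam y v)"
    "\<And>y v. y \<in> V \<Longrightarrow> Gam y (pr v) = Gam y v" "\<And>y v. y \<in> V \<Longrightarrow> pr (Gam y v) = pr v" "\<And>v. Gam y0 v = pr v"
    "\<And>y. y \<in> V \<Longrightarrow> range (Gam y) = span ((\<lambda>i. X i y) ` {..<m})"
proof -
  interpret radial pr by (rule pr)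
  let ?F = "\<lambda>y. span ((\<lambda>i. X i y) ` {..<m})"
  have F0: "v \<in> ?F y0 \<longleftrightarrow> pr v = v" for v using pr(2) pr_pr by (metis rangeE rangeI)
  \<comment> \<open>The constant 1/8: two uses of \<open>norm_pr\<close> cost a factor 2 each, which
    leaves the 1/2 that \<open>linear_near_id_inverse\<close> asks for.\<close>
  obtain V T where T: "open V" "y0 \<in> V" "V \<subseteq> S" "\<And>y. linear (T y)" "\<And>v. smooth_on V (\<lambda>y. T y v)"
    "\<And>v. T y0 v = v" "\<And>y v. y \<in> V \<Longrightarrow> norm (T y v - v) \<le> 1/8 * norm v" "\<And>y. T y ` ?F y0 = ?F y"
    using moving_frame[OF S sm dim, of "1/8"] by (auto simp: that)
  \<comment> \<open>The compression of \<open>T y\<close> to the range of \<open>pr\<close>,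
    completed by the identity on its kernel. Inverting it solves \<open>pr (T y w) = pr v\<close>
    for \<open>w\<close> in the range of \<open>pr\<close>.\<close>
  define A where "A y v = pr (T y (pr v)) + (v - pr v)" for y v
  have linA: "linear (A y)" for y
    unfolding A_def by (intro linearI) (simp_all add: pr_simps linear_add[OF T(4)] linear_scale[OF T(4)] algebra_simps)
  have smTc: "smooth_on V (\<lambda>y. T y (w y))" if "smooth_on V w" for w
    by (rule smooth_on_apply[OF T(1,4,5) that])
  have smA: "smooth_on V (\<lambda>y. A y v)" for v
    unfolding A_def by (intro smooth_on_add smooth_on_const smooth_on_bounded_linear[OF _ bl_pr] T)
  have nearA: "norm (A y v - v) \<le> 1/2 * norm v" if "y \<in> V" for y v
  proof -
    have "A y v - v = pr (T y (pr v) - pr v)" by (simp add: A_def pr_simps)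
    also have "norm \<dots> \<le> 2 * (1/8 * norm (pr v))" using norm_pr T(7)[OF that, of "pr v"] by (meson mult_left_mono order_trans zero_le_numeral)
    also have "\<dots> \<le> 1/2 * norm v" using norm_pr[of v] by simp
    finally show ?thesis .
  qed
  obtain I where I: "\<And>y. y \<in> V \<Longrightarrow> linear (I y)" "\<And>v. smooth_on V (\<lambda>y. I y v)"
    "\<And>y v. y \<in> V \<Longrightarrow> A y (I y v) = v" "\<And>y v. y \<in> V \<Longrightarrow> I y (A y v) = v"
    using linear_near_id_inverse[of V A, OF T(1) linA smA nearA] by metis
  have piA: "pr (A y w) = pr (T y (pr w))" "A y w - pr (A y w) = w - pr w" for y w
    by (simp_all add: A_def pr_simps)
  have piI: "pr (I y (pr v)) = I y (pr v)" if "y \<in> V" for y v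
    using piA(2)[of y "I y (pr v)"] I(3)[OF that] by simp
  define Gam where "Gam y v = T y (I y (pr v))" for y v
  show ?thesis
  proof (rule that[OF T(1-3), of Gam])
    show "linear (Gam y)" if "y \<in> V" for y
      unfolding Gam_def using linear_compose[OF linear_compose[OF lin_pr I(1)[OF that]] T(4)] by (simp add: o_def)
    show "smooth_on V (\<lambda>y. Gam y v)" for v unfolding Gam_def by (rule smTc[OF I(2)])
    show "Gam y (pr v) = Gam y v" for y v by (simp add: Gam_def)
    show "pr (Gam y v) = pr v" if "y \<in> V" for y v
      using piA(1)[of y "I y (pr v)"] I(3)[OF that] piI[OF that] by (simp add: Gam_def)
    show "Gam y0 v = pr v" for v
    proof -
      have "A y0 w = w" for w by (simp add: A_def T(6))
      then show ?thesis using I(4)[OF T(2), of "pr v"] by (simp add: Gam_def T(6))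
    qed
    show "range (Gam y) = ?F y" if y: "y \<in> V" for y
    proof
      show "range (Gam y) \<subseteq> ?F y"
        unfolding Gam_def T(8)[of y, symmetric] using piI[OF y] F0 by auto
      show "?F y \<subseteq> range (Gam y)"
      proof
        fix u assume "u \<in> ?F y"
        then obtain w where w: "pr w = w" "u = T y w" unfolding T(8)[of y, symmetric] using F0 by auto
        have "pr (A y w) = A y w" using piA(2)[of y w] w(1) by simp
        then have "Gam y (A y w) = u" using I(4)[OF y] w(2) by (simp add: Gam_def)
        then show "u \<in> range (Gam y)" by blast
      qed
    qed
  qed
qed

text \<open>Involutivity says that the derivative of the graph map is symmetric on the distribution:
  differentiate \<open>X i y = Gam y (X i y)\<close> along \<open>X j\<close>.\<close>

lemma involutive_graph:
  fixes X :: "nat \<Rightarrow> 'e::euclidean_space \<Rightarrow> 'e" and pr :: "'e \<Rightarrow> 'e" and Gam :: "'e \<Rightarrow> 'e \<Rightarrow> 'e"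
  assumes V: "open V" and sm: "\<And>i. i < m \<Longrightarrow> smooth_on V (X i)"
    and pr: "radial pr"
    and lin: "\<And>y. y \<in> V \<Longrightarrow> linear (Gam y)" and smG: "\<And>v. smooth_on V (\<lambda>y. Gam y v)"
    and G: "\<And>y v. y \<in> V \<Longrightarrow> Gam y (pr v) = Gam y v" "\<And>y v. y \<in> V \<Longrightarrow> pr (Gam y v) = pr v"
    and range: "\<And>y. y \<in> V \<Longrightarrow> range (Gam y) = span ((\<lambda>i. X i y) ` {..<m})"
    and inv: "\<And>i j y. i < m \<Longrightarrow> j < m \<Longrightarrow> y \<in> V \<Longrightarrow>
      frechet_derivative (X i) (at y) (X j y) - frechet_derivative (X j) (at y) (X i y) \<in> span ((\<lambda>i. X i y) ` {..<m})"
    and y: "y \<in> V"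
  shows "frechet_derivative (\<lambda>y. Gam y w) (at y) (Gam y v) = frechet_derivative (\<lambda>y. Gam y v) (at y) (Gam y w)"
proof -
  interpret radial pr by (rule pr)
  let ?DG = "\<lambda>w h. frechet_derivative (\<lambda>y. Gam y w) (at y) h"
  have derG: "((\<lambda>y. Gam y w) has_derivative ?DG w) (at y)" for w using smooth_onD[OF smG y] .
  have linG: "linear (?DG w)" for w using derG has_derivative_linear by blast
  have DG_lin: "linear (\<lambda>w. ?DG w h)" for h
  proof (rule linearI)
    show "?DG (a + b) h = ?DG a h + ?DG b h" for a b
    proof -
      have "((\<lambda>y. Gam y (a + b)) has_derivative (\<lambda>h. ?DG a h + ?DG b h)) (at y)"
        by (rule has_derivative_transform_within_open[OF has_derivative_add[OF derG derG] V y]) (simp add: linear_add[OF lin])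
      from has_derivative_unique[OF this derG] show ?thesis by metis
    qed
    show "?DG (c *\<^sub>R a) h = c *\<^sub>R ?DG a h" for c a
    proof -
      have "((\<lambda>y. Gam y (c *\<^sub>R a)) has_derivative (\<lambda>h. c *\<^sub>R ?DG a h)) (at y)"
        by (rule has_derivative_transform_within_open[OF has_derivative_scaleR_right[OF derG] V y]) (simp add: linear_scale[OF lin])
      from has_derivative_unique[OF this derG] show ?thesis by metis
    qed
  qed
  have Gid: "Gam z u = u" if "z \<in> V" "u \<in> span ((\<lambda>i. X i z) ` {..<m})" for z u
  proof -
    have "u \<in> range (Gam z)" using that(2) range[OF that(1)] by simp
    then obtain v where v: "u = Gam z v" by blast
    then show ?thesis using G[OF that(1)] by metis
  qed
  have Xin: "X i z \<in> span ((\<lambda>i. X i z) ` {..<m})" if "i < m" for i z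
    using that by (intro span_base) auto
  have DX: "frechet_derivative (X i) (at y) h = ?DG (X i y) h + Gam y (frechet_derivative (X i) (at y) h)" if i: "i < m" for i h
  proof -
    have "((\<lambda>z. Gam z (X i z)) has_derivative (\<lambda>h. ?DG (X i y) h + Gam y (frechet_derivative (X i) (at y) h))) (at y)"
      by (rule has_derivative_apply[OF V y lin derG smooth_onD[OF sm[OF i] y]])
    then have "(X i has_derivative (\<lambda>h. ?DG (X i y) h + Gam y (frechet_derivative (X i) (at y) h))) (at y)"
      by (rule has_derivative_transform_within_open[OF _ V y]) (simp add: Gid Xin i)
    from has_derivative_unique[OF this smooth_onD[OF sm[OF i] y]] show ?thesis by metis
  qed
  \<comment> \<open>The bracket lies in the distribution, hence is fixed by \<open>Gam y\<close>; in
    the difference of the two instances of \<open>DX\<close> only the derivatives of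
    \<open>Gam\<close> can therefore contribute.\<close>
  have sym: "?DG (X i y) (X j y) = ?DG (X j y) (X i y)" if ij: "i < m" "j < m" for i j
  proof -
    let ?b = "frechet_derivative (X i) (at y) (X j y) - frechet_derivative (X j) (at y) (X i y)"
    have "Gam y ?b = ?b" by (rule Gid[OF y inv[OF ij y]])
    then have "frechet_derivative (X i) (at y) (X j y) - Gam y (frechet_derivative (X i) (at y) (X j y))
        = frechet_derivative (X j) (at y) (X i y) - Gam y (frechet_derivative (X j) (at y) (X i y))"
      by (simp add: linear_diff[OF lin[OF y]] algebra_simps)
    then show ?thesis
      using DX[OF ij(1), of "X j y"] DX[OF ij(2), of "X i y"] by (metis add_diff_cancel_right')
  qed
  have sym2: "?DG a b = ?DG b a"
    if a: "a \<in> span ((\<lambda>i. X i y) ` {..<m})" and b: "b \<in> span ((\<lambda>i. X i y) ` {..<m})" for a b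
  proof -
    have *: "?DG (X i y) b = ?DG b (X i y)" if "i < m" for i
      using b
    proof (induction rule: span_induct_alt)
      case base
      show ?case using linear_0[OF linG] linear_0[OF DG_lin] by simp
    next
      case (step c x z)
      then obtain j where "j < m" "x = X j y" by auto
      then show ?case using step sym[OF \<open>i < m\<close> \<open>j < m\<close>]
        by (simp add: linear_add[OF linG] linear_scale[OF linG] linear_add[OF DG_lin] linear_scale[OF DG_lin])
    qed
    show ?thesis
      using a
    proof (induction rule: span_induct_alt)
      case base
      show ?case using linear_0[OF linG] linear_0[OF DG_lin] by simp
    next
      case (step c x z)
      then obtain j where "j < m" "x = X j y" by auto
      then show ?case using step *[OF \<open>j < m\<close>]
        by (simp add: linear_add[OF linG] linear_scale[OF linG] linear_add[OF DG_lin] linear_scale[OF DG_lin])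
    qed
  qed
  \<comment> \<open>\<open>Gam\<close> depends on the \<open>pr\<close> component only, and
    \<open>Gam y w\<close> has the same one as \<open>w\<close>; so arbitrary vectors may be
    replaced by vectors of the distribution, where \<open>sym2\<close> applies.\<close>
  have DGpi: "?DG w h = ?DG (pr w) h" for w h
  proof -
    have "((\<lambda>y. Gam y (pr w)) has_derivative ?DG w) (at y)"
      by (rule has_derivative_transform_within_open[OF derG V y]) (simp add: G)
    from has_derivative_unique[OF this derG] show ?thesis by metis
  qed
  have DGG: "?DG w h = ?DG (Gam y w) h" for w h using DGpi[of w h] DGpi[of "Gam y w" h] G(2)[OF y] by simp
  have rG: "Gam y u \<in> span ((\<lambda>i. X i y) ` {..<m})" for u using range[OF y] by blast
  show ?thesis using DGG[of w] DGG[of v] sym2[OF rG rG] by metis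
qed

text \<open>\<open>frobenius\<close> yields a map into the kernel of \<open>pr\<close>, whose
  dimension is \<open>CARD('k)\<close>; the isomorphism \<open>Q\<close> with right inverse
  \<open>J\<close> carries it to \<open>real^'k\<close>.\<close>

lemma frobenius_span:
  fixes X :: "nat \<Rightarrow> 'e::euclidean_space \<Rightarrow> 'e"
  assumes S: "open S" "y0 \<in> S" and sm: "\<And>i. i < n \<Longrightarrow> smooth_on S (X i)"
    and dim: "dim (span ((\<lambda>i. X i y0) ` {..<n})) = n"
    and inv: "\<And>i j y. i < n \<Longrightarrow> j < n \<Longrightarrow> y \<in> S \<Longrightarrow>
      frechet_derivative (X i) (at y) (X j y) - frechet_derivative (X j) (at y) (X i y) \<in> span ((\<lambda>i. X i y) ` {..<n})"
    and card: "DIM('e) = n + CARD('k::finite)"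
  obtains V and f :: "'e \<Rightarrow> real^'k" and s :: "'e \<Rightarrow> real^'k \<Rightarrow> 'e"
    where "open V" "y0 \<in> V" "V \<subseteq> S" "smooth_on V f"
    "\<And>y h. y \<in> V \<Longrightarrow> frechet_derivative f (at y) h = 0 \<longleftrightarrow> h \<in> span ((\<lambda>i. X i y) ` {..<n})"
    "\<And>y. y \<in> V \<Longrightarrow> linear (s y)" "\<And>c. smooth_on V (\<lambda>y. s y c)"
    "\<And>y c. y \<in> V \<Longrightarrow> frechet_derivative f (at y) (s y c) = c"
proof -
  obtain pr :: "'e \<Rightarrow> 'e" where pr: "radial pr" "range pr = span ((\<lambda>i. X i y0) ` {..<n})"
    using orthogonal_projection_exists[OF subspace_span] by blast
  interpret radial pr by (rule pr)
  obtain V Gam where G: "open V" "y0 \<in> V" "V \<subseteq> S" "\<And>y. y \<in> V \<Longrightarrow> linear (Gam y)" "\<And>v. smooth_on V (\<lambda>y. Gam y v)"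
    "\<And>y v. y \<in> V \<Longrightarrow> Gam y (pr v) = Gam y v" "\<And>y v. y \<in> V \<Longrightarrow> pr (Gam y v) = pr v" "\<And>v. Gam y0 v = pr v"
    "\<And>y. y \<in> V \<Longrightarrow> range (Gam y) = span ((\<lambda>i. X i y) ` {..<n})"
    by (rule adapted_graph[OF S sm dim pr]) ((rule that; assumption) | assumption)+
  have inv': "frechet_derivative (\<lambda>y. Gam y w) (at y) (Gam y v) = frechet_derivative (\<lambda>y. Gam y v) (at y) (Gam y w)"
    if "y \<in> V" for y v w
    by (rule involutive_graph[OF G(1) _ pr(1) G(4,5,6,7,9) inv that])
      (use sm G(3) smooth_on_subset in blast)+
  obtain V' f s where f: "open V'" "y0 \<in> V'" "V' \<subseteq> V" "smooth_on V' f" "\<And>y. y \<in> V' \<Longrightarrow> pr (f y) = 0"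
    "\<And>y h. y \<in> V' \<Longrightarrow> frechet_derivative f (at y) h = 0 \<longleftrightarrow> h \<in> range (Gam y)"
    "\<And>y. y \<in> V' \<Longrightarrow> linear (s y)" "\<And>c. smooth_on V' (\<lambda>y. s y c)"
    "\<And>y c. y \<in> V' \<Longrightarrow> pr c = 0 \<Longrightarrow> frechet_derivative f (at y) (s y c) = c"
    by (rule frobenius[OF G(1,2,4,5,6,8) inv']) ((rule that; assumption) | assumption)+
  let ?N = "{v. pr v = 0}"
  have subN: "subspace ?N" by (rule subspaceI) (simp_all add: pr_simps)
  have "dim (range pr) + dim ?N = DIM('e)"
  proof -
    have "{x + y |x y. x \<in> range pr \<and> y \<in> ?N} = UNIV"
    proof -
      have "v \<in> {x + y |x y. x \<in> range pr \<and> y \<in> ?N}" for v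
        by (rule CollectI, rule exI[of _ "pr v"], rule exI[of _ "v - pr v"]) (simp add: pr_simps)
      then show ?thesis by blast
    qed
    moreover have "range pr \<inter> ?N = {0}" by (auto simp: pr_simps) (metis pr_simps(4) rangeI)
    ultimately show ?thesis
      using dim_sums_Int[OF subspace_span[of "(\<lambda>i. X i y0) ` {..<n}", folded pr(2)] subN] by (simp add: dim_UNIV)
  qed
  then have dN: "dim ?N = dim (UNIV :: (real^'k) set)"
    using card dim pr(2) by (simp add: dim_UNIV)
  obtain Q :: "'e \<Rightarrow> real^'k" where Q: "linear Q" "Q ` ?N = UNIV" "inj_on Q ?N"
    using subspace_isomorphism[OF subN subspace_UNIV dN] by metis
  obtain J :: "real^'k \<Rightarrow> 'e" where J: "linear J" "\<And>c. Q (J c) = c" "\<And>c. pr (J c) = 0"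
  proof -
    obtain J where "range J \<subseteq> ?N" "linear J" "\<forall>c\<in>Q ` ?N. Q (J c) = c"
      using linear_exists_right_inverse_on[OF Q(1) subN] by blast
    then show ?thesis using that[of J] unfolding Q(2) by auto
  qed
  have blQ: "bounded_linear Q" using Q(1) by (simp add: linear_conv_bounded_linear)
  have Df: "frechet_derivative (\<lambda>y. Q (f y)) (at y) = (\<lambda>h. Q (frechet_derivative f (at y) h))" if "y \<in> V'" for y
    using frechet_derivative_at[OF bounded_linear.has_derivative[OF blQ smooth_onD[OF f(4) that]]] by simp
  \<comment> \<open>\<open>Q\<close> is injective on the kernel of \<open>pr\<close> only, so the
    values of the derivative have to be located there before composing with
    \<open>Q\<close>.\<close>
  have prD: "pr (frechet_derivative f (at y) h) = 0" if "y \<in> V'" for y h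
  proof -
    have "((\<lambda>y. 0) has_derivative (\<lambda>h. pr (frechet_derivative f (at y) h))) (at y)"
      by (rule has_derivative_transform_within_open[OF bounded_linear.has_derivative[OF bl_pr smooth_onD[OF f(4) that]] f(1) that])
        (simp add: f(5))
    from has_derivative_unique[OF this has_derivative_const] show ?thesis by metis
  qed
  have Q0: "Q v = 0 \<longleftrightarrow> v = 0" if "pr v = 0" for v
    using Q(3) linear_0[OF Q(1)] that pr_simps(4) unfolding inj_on_def by force
  show ?thesis
  proof (rule that[of V' "\<lambda>y. Q (f y)" "\<lambda>y c. s y (J c)"])
    show "smooth_on V' (\<lambda>y. Q (f y))" by (rule smooth_on_bounded_linear[OF f(1) blQ f(4)])
    show "frechet_derivative (\<lambda>y. Q (f y)) (at y) h = 0 \<longleftrightarrow> h \<in> span ((\<lambda>i. X i y) ` {..<n})" if "y \<in> V'" for y h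
      using f(6)[OF that] G(9) f(3) that Q0[OF prD[OF that]] by (auto simp: Df)
    show "linear (\<lambda>c. s y (J c))" if "y \<in> V'" for y
      using linear_compose[OF J(1) f(7)[OF that]] by (simp add: o_def)
    show "frechet_derivative (\<lambda>y. Q (f y)) (at y) (s y (J c)) = c" if "y \<in> V'" for y c
      using f(9)[OF that J(3)] J(2) by (simp add: Df[OF that])
  qed (use f(1,2,3,8) G(3) in auto)
qed

text \<open>The span at \<open>y0\<close> is a hyperplane with normal \<open>\<nu>\<close>; pulling
  the functional \<open>\<nu> \<bullet> v\<close> back by the inverse of the moving frame map
  carries it to the neighbouring spans.\<close>

lemma annihilating_form:
  fixes Z :: "nat \<Rightarrow> 'e::euclidean_space \<Rightarrow> 'e"
  assumes S: "open S" "y0 \<in> S" and sm: "\<And>i. i < m \<Longrightarrow> smooth_on S (Z i)"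
    and dim: "dim (span ((\<lambda>i. Z i y0) ` {..<m})) = m" and DIM: "DIM('e) = m + 1"
  obtains V and \<alpha> :: "'e \<Rightarrow> 'e \<Rightarrow> real" where "open V" "y0 \<in> V" "V \<subseteq> S" "\<And>y. y \<in> V \<Longrightarrow> linear (\<alpha> y)"
    "\<And>v. smooth_on V (\<lambda>y. \<alpha> y v)" "\<And>y v. y \<in> V \<Longrightarrow> \<alpha> y v = 0 \<longleftrightarrow> v \<in> span ((\<lambda>i. Z i y) ` {..<m})"
proof -
  let ?H = "\<lambda>y. span ((\<lambda>i. Z i y) ` {..<m})"
  obtain V T where T: "open V" "y0 \<in> V" "V \<subseteq> S" "\<And>y. linear (T y)" "\<And>v. smooth_on V (\<lambda>y. T y v)"
    "\<And>v. T y0 v = v" "\<And>y v. y \<in> V \<Longrightarrow> norm (T y v - v) \<le> 1/2 * norm v" "\<And>y. T y ` ?H y0 = ?H y"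
    using moving_frame[OF S sm dim, of "1/2"] by (auto simp: that)
  obtain I where I: "\<And>y. y \<in> V \<Longrightarrow> linear (I y)" "\<And>v. smooth_on V (\<lambda>y. I y v)"
    "\<And>y v. y \<in> V \<Longrightarrow> T y (I y v) = v" "\<And>y v. y \<in> V \<Longrightarrow> I y (T y v) = v"
    using linear_near_id_inverse[of V T, OF T(1,4,5,7)] by metis
  obtain \<nu> where \<nu>: "\<nu> \<noteq> 0" "?H y0 \<subseteq> {x. \<nu> \<bullet> x = 0}"
  proof -
    have "?H y0 \<noteq> UNIV" using dim DIM by (metis dim_UNIV dim_span add_cancel_right_right zero_neq_one)
    from span_not_UNIV_orthogonal[OF this] show ?thesis using that by blast
  qed
  have H0: "?H y0 = {x. \<nu> \<bullet> x = 0}"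
  proof (rule subspace_dim_equal[OF subspace_span _ \<nu>(2)])
    show "subspace {x. \<nu> \<bullet> x = 0}" by (rule subspace_hyperplane)
    show "dim (?H y0) \<ge> dim {x. \<nu> \<bullet> x = 0}"
      using dim_hyperplane[OF \<nu>(1)] dim DIM by simp
  qed
  have lin: "linear (\<lambda>v. \<nu> \<bullet> I y v)" if "y \<in> V" for y
    by (intro linearI) (simp_all add: linear_add[OF I(1)[OF that]] linear_scale[OF I(1)[OF that]] inner_add_right)
  have ker: "\<nu> \<bullet> I y v = 0 \<longleftrightarrow> v \<in> ?H y" if "y \<in> V" for y v
  proof -
    have "\<nu> \<bullet> I y v = 0 \<longleftrightarrow> I y v \<in> ?H y0" unfolding H0 by simp
    also have "\<dots> \<longleftrightarrow> v \<in> ?H y"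
      unfolding T(8)[of y, symmetric] using I(3,4)[OF that] by (metis (no_types, lifting) imageE imageI)
    finally show ?thesis .
  qed
  show ?thesis
    by (rule that[of V "\<lambda>y v. \<nu> \<bullet> I y v"]) (assumption | intro T(1-3) lin ker smooth_on_inner smooth_on_const I)+
qed

text \<open>The hypothesis \<open>nondeg\<close> expresses non-degeneracy by differentials of forms.
  It is quantified over all local forms with kernel \<open>H\<close> because the form in question
  arises inside the proof, after the normalization of one component.\<close>

theorem local_normal_form:
  fixes X Z :: "nat \<Rightarrow> 'e::euclidean_space \<Rightarrow> 'e" and n :: nat
  defines "F \<equiv> \<lambda>y. span ((\<lambda>i. X i y) ` {..<n})" and "H \<equiv> \<lambda>y. span ((\<lambda>i. Z i y) ` {..<2 * n})"
  assumes S: "open S" "y0 \<in> S"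
    and smX: "\<And>i. i < n \<Longrightarrow> smooth_on S (X i)" and smZ: "\<And>i. i < 2 * n \<Longrightarrow> smooth_on S (Z i)"
    and dimF: "dim (F y0) = n" and dimH: "dim (H y0) = 2 * n"
    and FH: "\<And>y. y \<in> S \<Longrightarrow> F y \<subseteq> H y"
    and inv: "\<And>i j y. i < n \<Longrightarrow> j < n \<Longrightarrow> y \<in> S \<Longrightarrow>
      frechet_derivative (X i) (at y) (X j y) - frechet_derivative (X j) (at y) (X i y) \<in> F y"
    and nondeg: "\<And>V \<alpha> y v. open V \<Longrightarrow> V \<subseteq> S \<Longrightarrow> (\<And>y. y \<in> V \<Longrightarrow> linear (\<alpha> y)) \<Longrightarrow>
      (\<And>w. smooth_on V (\<lambda>y. \<alpha> y w)) \<Longrightarrow> (\<And>y w. y \<in> V \<Longrightarrow> \<alpha> y w = (0::real) \<longleftrightarrow> w \<in> H y) \<Longrightarrow>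
      y \<in> V \<Longrightarrow> v \<in> H y \<Longrightarrow>
      (\<And>w. w \<in> H y \<Longrightarrow> frechet_derivative (\<lambda>y. \<alpha> y w) (at y) v = frechet_derivative (\<lambda>y. \<alpha> y v) (at y) w) \<Longrightarrow>
      v = 0"
    and DIM: "DIM('e) = 2 * n + 1" and card: "CARD('k::finite) = n + 1"
  obtains V and f lam :: "'e \<Rightarrow> real^'k" and i where "open V" "y0 \<in> V" "V \<subseteq> S" "smooth_on V f" "smooth_on V lam"
    "\<And>y. y \<in> V \<Longrightarrow> lam y $ i = 1"
    "\<And>y v. y \<in> V \<Longrightarrow> v \<in> F y \<longleftrightarrow> frechet_derivative f (at y) v = 0"
    "\<And>y v. y \<in> V \<Longrightarrow> v \<in> H y \<longleftrightarrow> lam y \<bullet> frechet_derivative f (at y) v = 0"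
    "\<And>y v. y \<in> V \<Longrightarrow> frechet_derivative f (at y) v = 0 \<Longrightarrow> frechet_derivative lam (at y) v = 0 \<Longrightarrow> v = 0"
proof -
  have dk: "DIM('e) = n + CARD('k)" using DIM card by simp
  obtain V1 and f :: "'e \<Rightarrow> real^'k" and s where f: "open V1" "y0 \<in> V1" "V1 \<subseteq> S" "smooth_on V1 f"
    "\<And>y h. y \<in> V1 \<Longrightarrow> frechet_derivative f (at y) h = 0 \<longleftrightarrow> h \<in> span ((\<lambda>i. X i y) ` {..<n})"
    "\<And>y. y \<in> V1 \<Longrightarrow> linear (s y)" "\<And>c. smooth_on V1 (\<lambda>y. s y c)"
    "\<And>y c. y \<in> V1 \<Longrightarrow> frechet_derivative f (at y) (s y c) = c"
    by (rule frobenius_span[OF S smX dimF[unfolded F_def] inv[unfolded F_def] dk]) ((rule that; assumption) | assumption)+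
  obtain V2 and \<alpha> :: "'e \<Rightarrow> 'e \<Rightarrow> real" where \<alpha>: "open V2" "y0 \<in> V2" "V2 \<subseteq> V1" "\<And>y. y \<in> V2 \<Longrightarrow> linear (\<alpha> y)"
    "\<And>v. smooth_on V2 (\<lambda>y. \<alpha> y v)" "\<And>y v. y \<in> V2 \<Longrightarrow> \<alpha> y v = 0 \<longleftrightarrow> v \<in> span ((\<lambda>i. Z i y) ` {..<2 * n})"
    by (rule annihilating_form[where Z=Z, OF f(1,2) smooth_on_subset[OF smZ f(3)] dimH[unfolded H_def] DIM])
      ((rule that; assumption) | assumption)+
  have f5: "frechet_derivative f (at y) h = 0 \<longleftrightarrow> h \<in> F y" if "y \<in> V1" for y h
    using f(5)[OF that] by (simp add: F_def)
  have \<alpha>6: "\<alpha> y v = 0 \<longleftrightarrow> v \<in> H y" if "y \<in> V2" for y v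
    using \<alpha>(6)[OF that] by (simp add: H_def)
  let ?Df = "\<lambda>y. frechet_derivative f (at y)"
  have linDf: "linear (?Df y)" if "y \<in> V1" for y using smooth_onD[OF f(4) that] has_derivative_linear by blast
  define l where "l y j = \<alpha> y (s y (axis j 1))" for y j
  \<comment> \<open>\<open>v\<close> and \<open>s y (Df v)\<close> have the same image under
    \<open>Df\<close>, so they differ by an element of \<open>F y\<close>, on which
    \<open>\<alpha>\<close> vanishes because \<open>F y\<close> lies in \<open>H y\<close>.\<close>
  have factor: "\<alpha> y v = (\<Sum>j\<in>UNIV. (?Df y v $ j) * l y j)" if y: "y \<in> V2" for y v
  proof -
    have y1: "y \<in> V1" using y \<alpha>(3) by blast
    have "?Df y (v - s y (?Df y v)) = 0" by (simp add: linear_diff[OF linDf[OF y1]] f(8)[OF y1])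
    then have "v - s y (?Df y v) \<in> F y" using f5[OF y1, of "v - s y (?Df y v)"] by simp
    then have "v - s y (?Df y v) \<in> H y" using FH[OF subsetD[OF f(3) y1]] by (rule rev_subsetD)
    then have "\<alpha> y (v - s y (?Df y v)) = 0" using \<alpha>6[OF y, of "v - s y (?Df y v)"] by simp
    then have 1: "\<alpha> y v = \<alpha> y (s y (?Df y v))" by (simp add: linear_diff[OF \<alpha>(4)[OF y]])
    have sum: "\<alpha> y (s y (\<Sum>j\<in>UNIV. (c $ j) *\<^sub>R axis j 1)) = (\<Sum>j\<in>UNIV. (c $ j) * l y j)" for c
      by (simp add: l_def linear_sum[OF f(6)[OF y1]] linear_sum[OF \<alpha>(4)[OF y]] linear_scale[OF f(6)[OF y1]] linear_scale[OF \<alpha>(4)[OF y]])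
    have "(\<Sum>j\<in>UNIV. (c $ j) *\<^sub>R axis j 1) = c" for c :: "real^'k"
      by (simp add: vec_eq_iff axis_def if_distrib cong: if_cong)
    then show ?thesis using 1 sum[of "?Df y v"] by simp
  qed
  \<comment> \<open>\<open>\<alpha> y0\<close> is not zero, since its kernel \<open>H y0\<close> is
    a proper subspace; so some component is nonzero and, by continuity, stays so on
    \<open>V\<close>.\<close>
  obtain i where i: "l y0 i \<noteq> 0"
  proof -
    have "\<exists>v. v \<notin> H y0"
    proof (rule ccontr)
      assume "\<not> ?thesis"
      then have "H y0 = UNIV" by blast
      then show False using dimH DIM by (simp add: dim_UNIV)
    qed
    then obtain v where "v \<notin> H y0" by blast
    then have "\<alpha> y0 v \<noteq> 0" using \<alpha>6[OF \<alpha>(2), of v] by simp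
    then have "(\<Sum>j\<in>UNIV. (?Df y0 v $ j) * l y0 j) \<noteq> 0" using factor[OF \<alpha>(2), of v] by simp
    then obtain j where "(?Df y0 v $ j) * l y0 j \<noteq> 0" by (rule sum.not_neutral_contains_not_neutral)
    then show ?thesis using that[of j] by simp
  qed
  have sml: "smooth_on V2 (\<lambda>y. l y j)" for j
    unfolding l_def
    by (rule smooth_on_apply[OF \<alpha>(1,4,5) smooth_on_subset[OF f(7) \<alpha>(3)]])
  define V where "V = V2 \<inter> (\<lambda>y. l y i) -` (- {0})"
  have V: "open V" "y0 \<in> V" "V \<subseteq> V2" "\<And>y. y \<in> V \<Longrightarrow> l y i \<noteq> 0"
    unfolding V_def using i \<alpha>(2) continuous_open_preimage[OF smooth_on_imp_continuous[OF sml] \<alpha>(1) open_Compl[OF closed_singleton[of 0]]] by auto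
  have V1: "y \<in> V1" and V2: "y \<in> V2" and VS: "y \<in> S" if "y \<in> V" for y using that V(3) \<alpha>(3) f(3) by auto
  define lam :: "'e \<Rightarrow> real^'k" where "lam y = (\<chi> j. inverse (l y i) * l y j)" for y
  \<comment> \<open>A nonvanishing multiple of \<open>\<alpha>\<close> with the same kernel, so
    \<open>nondeg\<close> applies to it; in contrast to \<open>\<alpha>\<close> it has the
    normalized coefficients \<open>lam\<close>.\<close>
  define \<beta> where "\<beta> y v = inverse (l y i) * \<alpha> y v" for y v
  have sminv: "smooth_on V (\<lambda>y. inverse (l y i))"
    by (intro smooth_on_inverse V smooth_on_subset[OF sml V(3)])
  have smlam: "smooth_on V lam"
  proof (rule smooth_on_componentwise[OF V(1)])
    fix b :: "real^'k" assume "b \<in> Basis"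
    then obtain j where "b = axis j 1" by (auto simp: Basis_vec_def)
    then have "(\<lambda>y. lam y \<bullet> b) = (\<lambda>y. inverse (l y i) * l y j)" by (simp add: lam_def inner_axis)
    then show "smooth_on V (\<lambda>y. lam y \<bullet> b)"
      using smooth_on_mult[OF V(1) sminv smooth_on_subset[OF sml V(3)], of j] by simp
  qed
  have lin\<beta>: "linear (\<beta> y)" if "y \<in> V" for y
    unfolding \<beta>_def
    by (intro linearI) (simp_all add: linear_add[OF \<alpha>(4)[OF V2[OF that]]] linear_scale[OF \<alpha>(4)[OF V2[OF that]]] algebra_simps)
  have sm\<beta>: "smooth_on V (\<lambda>y. \<beta> y w)" for w
    unfolding \<beta>_def by (intro smooth_on_mult V(1) sminv smooth_on_subset[OF \<alpha>(5) V(3)])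
  have ker\<beta>: "\<beta> y w = 0 \<longleftrightarrow> w \<in> H y" if "y \<in> V" for y w
    using V(4)[OF that] \<alpha>6[OF V2[OF that]] by (simp add: \<beta>_def)
  have \<beta>lam: "\<beta> y w = lam y \<bullet> ?Df y w" if "y \<in> V" for y w
    unfolding \<beta>_def factor[OF V2[OF that]] lam_def inner_vec_def
    by (simp add: sum_distrib_left algebra_simps)
  have inj: "v = 0" if y: "y \<in> V" and v: "?Df y v = 0" "frechet_derivative lam (at y) v = 0" for y v
  proof (rule nondeg[OF V(1) _ lin\<beta> sm\<beta> ker\<beta> y])
    show "V \<subseteq> S" using VS by blast
    show "v \<in> H y" by (rule subsetD[OF FH[OF VS[OF y]]]) (use v(1) f5[OF V1[OF y], of v] in simp)
    have d2: "((\<lambda>y. ?Df y w) has_derivative frechet_derivative (\<lambda>y. ?Df y w) (at y)) (at y)" for w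
      by (rule smooth_onD[OF smooth_on_frechet_derivative[OF f(4)] V1[OF y]])
    \<comment> \<open>For a vector \<open>v\<close> killed by both derivatives, the products of
      first derivatives drop out on either side of the symmetry condition; the second derivatives of
      \<open>f\<close> agree by symmetry.\<close>
    have D\<beta>: "frechet_derivative (\<lambda>y. \<beta> y w) (at y) h =
        lam y \<bullet> frechet_derivative (\<lambda>y. ?Df y w) (at y) h + frechet_derivative lam (at y) h \<bullet> ?Df y w" for w h
    proof -
      have "((\<lambda>y. lam y \<bullet> ?Df y w) has_derivative
         (\<lambda>h. lam y \<bullet> frechet_derivative (\<lambda>y. ?Df y w) (at y) h + frechet_derivative lam (at y) h \<bullet> ?Df y w)) (at y)"
        by (rule has_derivative_inner[OF smooth_onD[OF smlam y] d2])
      then have "((\<lambda>y. \<beta> y w) has_derivative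
         (\<lambda>h. lam y \<bullet> frechet_derivative (\<lambda>y. ?Df y w) (at y) h + frechet_derivative lam (at y) h \<bullet> ?Df y w)) (at y)"
        by (rule has_derivative_transform_within_open[OF _ V(1) y]) (simp add: \<beta>lam)
      from fun_cong[OF frechet_derivative_at[OF this]] show ?thesis by metis
    qed
    fix w assume "w \<in> H y"
    have "frechet_derivative (\<lambda>y. ?Df y w) (at y) v = frechet_derivative (\<lambda>y. ?Df y v) (at y) w"
      by (rule second_derivative_symmetric[OF f(1) V1[OF y] smooth_onD[OF f(4)] d2 d2])
    then show "frechet_derivative (\<lambda>y. \<beta> y w) (at y) v = frechet_derivative (\<lambda>y. \<beta> y v) (at y) w"
      by (simp add: D\<beta> v)
  qed
  show ?thesis
  proof (rule that[OF V(1,2) _ _ smlam _ _ _ inj, of f])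
    show "smooth_on V f" by (rule smooth_on_subset[OF f(4)]) (use V1 in blast)
    show "lam y $ i = 1" if "y \<in> V" for y using V(4)[OF that] by (simp add: lam_def)
    show "v \<in> F y \<longleftrightarrow> ?Df y v = 0" if "y \<in> V" for y v using f5[OF V1[OF that], of v] by simp
    show "v \<in> H y \<longleftrightarrow> lam y \<bullet> ?Df y v = 0" if "y \<in> V" for y v using ker\<beta>[OF that] \<beta>lam[OF that] by metis
  qed (use VS in auto)
qed

section \<open>Charts and tangent vectors\<close>

text \<open>Coefficients attached to indices rather than to vectors can be reused as constant
  coefficients of vector fields, also when two fields coincide at a point.\<close>

lemma span_image_sum:
  assumes "v \<in> span (x ` {..<m::nat})"
  obtains a where "v = (\<Sum>i<m. a i *\<^sub>R x i)"
proof -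
  from assms have "\<exists>a. v = (\<Sum>i<m. a i *\<^sub>R x i)"
  proof (induction rule: span_induct_alt)
    case base
    show ?case by (rule exI[of _ "\<lambda>_. 0"]) simp
  next
    case (step c y z)
    then obtain j a where j: "j < m" "y = x j" "z = (\<Sum>i<m. a i *\<^sub>R x i)" by auto
    have "(\<Sum>i<m. (if i = j then c else 0) *\<^sub>R x i) = (\<Sum>i<m. if i = j then c *\<^sub>R x i else 0)"
      by (rule sum.cong) auto
    also have "\<dots> = c *\<^sub>R y" using j by simp
    finally have "c *\<^sub>R y + z = (\<Sum>i<m. ((if i = j then c else 0) + a i) *\<^sub>R x i)"
      using j(3) by (simp add: scaleR_add_left sum.distrib)
    then show ?case by (rule exI[of _ "\<lambda>i. (if i = j then c else 0) + a i"])
  qed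
  then show ?thesis using that by blast
qed

text \<open>Common setting for computations in charts of \<open>M\<close> and of the target
  \<open>pcot_mfd\<close>.\<close>

locale charted =
  fixes M :: "('a, 'e::euclidean_space) mfd"
  assumes chart: "c \<in> atlas M \<Longrightarrow> is_chart (mtop M) c"
    and trans: "c \<in> atlas M \<Longrightarrow> d \<in> atlas M \<Longrightarrow> smooth_on (snd c ` (fst c \<inter> fst d)) (transition c d)"
begin

lemma chart_homeo:
  assumes "c \<in> atlas M"
  shows "openin (mtop M) (fst c)" "open (snd c ` fst c)"
    "homeomorphic_map (subtopology (mtop M) (fst c)) (top_of_set (snd c ` fst c)) (snd c)"
  using chart[OF assms] by (auto simp: is_chart_def)

lemma chart_topspace: "c \<in> atlas M \<Longrightarrow> fst c \<subseteq> topspace (mtop M)"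
  by (rule openin_subset[OF chart_homeo(1)])

lemma chart_inj: assumes "c \<in> atlas M" shows "inj_on (snd c) (fst c)"
  using homeomorphic_imp_injective_map[OF chart_homeo(3)[OF assms]]
  unfolding topspace_subtopology_subset[OF chart_topspace[OF assms]] .

lemma chart_inv_snd: "c \<in> atlas M \<Longrightarrow> p \<in> fst c \<Longrightarrow> chart_inv c (snd c p) = p"
  unfolding chart_inv_def by (rule inv_into_f_f[OF chart_inj])

lemma open_chart_image:
  assumes c: "c \<in> atlas M" and W: "openin (mtop M) W"
  shows "open (snd c ` (W \<inter> fst c))"
proof -
  have "openin (subtopology (mtop M) (fst c)) (W \<inter> fst c)"
    using W chart_homeo(1)[OF c] by (simp add: openin_open_subtopology openin_Int)
  then have "openin (top_of_set (snd c ` fst c)) (snd c ` (W \<inter> fst c))"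
    using homeomorphic_imp_open_map[OF chart_homeo(3)[OF c]] by (simp add: open_map_def)
  then show ?thesis by (simp add: openin_open_eq[OF chart_homeo(2)[OF c]])
qed

lemma openin_chart_preimage:
  assumes c: "c \<in> atlas M" and N: "open N"
  shows "openin (mtop M) {p \<in> fst c. snd c p \<in> N}"
proof -
  have "continuous_map (subtopology (mtop M) (fst c)) euclidean (snd c)"
    by (rule continuous_map_into_fulltopology[OF homeomorphic_imp_continuous_map[OF chart_homeo(3)[OF c]]])
  from openin_continuous_map_preimage[OF this open_openin[THEN iffD1, OF N]]
  have "openin (subtopology (mtop M) (fst c)) {p \<in> fst c. snd c p \<in> N}"
    unfolding topspace_subtopology_subset[OF chart_topspace[OF c]] .
  then show ?thesis unfolding openin_open_subtopology[OF chart_homeo(1)[OF c]] by (rule conjunct1)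
qed

abbreviation D_trans :: "('a, 'e) chart \<Rightarrow> ('a, 'e) chart \<Rightarrow> 'a \<Rightarrow> 'e \<Rightarrow> 'e" where
  "D_trans c d p \<equiv> frechet_derivative (transition c d) (at (snd c p))"

lemma charts_atD: "c \<in> charts_at M p \<Longrightarrow> c \<in> atlas M \<and> p \<in> fst c"
  by (simp add: charts_at_def)

lemma overlap: "c \<in> charts_at M p \<Longrightarrow> d \<in> charts_at M p \<Longrightarrow> snd c p \<in> snd c ` (fst c \<inter> fst d)"
  by (auto simp: charts_at_def)

lemma open_overlap: "c \<in> atlas M \<Longrightarrow> d \<in> atlas M \<Longrightarrow> open (snd c ` (fst c \<inter> fst d))"
  using open_chart_image[OF _ chart_homeo(1), of c d] by (simp only: Int_commute)

lemma transition_snd: "c \<in> atlas M \<Longrightarrow> p \<in> fst c \<Longrightarrow> transition c d (snd c p) = snd d p"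
  by (simp add: transition_def chart_inv_snd)

lemma D_trans_has:
  assumes "c \<in> charts_at M p" "d \<in> charts_at M p"
  shows "(transition c d has_derivative D_trans c d p) (at (snd c p))"
  by (rule smooth_onD[OF trans overlap[OF assms]]) (simp_all add: charts_atD[OF assms(1)] charts_atD[OF assms(2)])

lemma D_trans_linear: "c \<in> charts_at M p \<Longrightarrow> d \<in> charts_at M p \<Longrightarrow> linear (D_trans c d p)"
  by (rule has_derivative_linear[OF D_trans_has])

lemma D_trans_refl: assumes "c \<in> charts_at M p" shows "D_trans c c p v = v"
proof -
  have c: "c \<in> atlas M" "p \<in> fst c" using assms charts_atD by auto
  have "(transition c c has_derivative (\<lambda>v. v)) (at (snd c p))"
    by (rule has_derivative_transform_within_open[OF has_derivative_ident chart_homeo(2)[OF c(1)]])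
      (use c in \<open>auto simp: transition_snd\<close>)
  from fun_cong[OF frechet_derivative_at[OF this], of v] show ?thesis by simp
qed

lemma D_trans_comp:
  assumes "c \<in> charts_at M p" "d \<in> charts_at M p" "e \<in> charts_at M p"
  shows "D_trans d e p (D_trans c d p v) = D_trans c e p v"
proof -
  have c: "c \<in> atlas M" "d \<in> atlas M" "p \<in> fst c" using assms charts_atD by auto
  have "(transition d e has_derivative D_trans d e p) (at (transition c d (snd c p)))"
    using D_trans_has[OF assms(2,3)] c by (simp add: transition_snd)
  from has_derivative_compose[OF D_trans_has[OF assms(1,2)] this]
  have "((\<lambda>y. transition d e (transition c d y)) has_derivative (\<lambda>v. D_trans d e p (D_trans c d p v))) (at (snd c p))" .
  then have "(transition c e has_derivative (\<lambda>v. D_trans d e p (D_trans c d p v))) (at (snd c p))"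
    by (rule has_derivative_transform_within_open[OF _ open_overlap[OF c(1,2)] overlap[OF assms(1,2)]])
      (use c in \<open>auto simp: transition_snd\<close>)
  from fun_cong[OF frechet_derivative_at[OF this], of v] show ?thesis by simp
qed

text \<open>The inverse of evaluation at the chart \<open>c\<close> on the tangent space at
  \<open>p\<close>.\<close>

definition tvec_of :: "'a \<Rightarrow> ('a, 'e) chart \<Rightarrow> 'e \<Rightarrow> ('a, 'e) tvec" where
  "tvec_of p c v = (\<lambda>d. if d \<in> charts_at M p then D_trans c d p v else 0)"

lemma tangentI:
  assumes "\<And>c d. c \<in> charts_at M p \<Longrightarrow> d \<in> charts_at M p \<Longrightarrow> \<xi> d = D_trans c d p (\<xi> c)"
    and "\<And>c. c \<notin> charts_at M p \<Longrightarrow> \<xi> c = 0"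
  shows "\<xi> \<in> tangent_space M p"
  unfolding tangent_space_def using assms by blast

lemma tangent_outside: "\<xi> \<in> tangent_space M p \<Longrightarrow> c \<notin> charts_at M p \<Longrightarrow> \<xi> c = 0"
  unfolding tangent_space_def by blast

lemma tvec_of_in: "c \<in> charts_at M p \<Longrightarrow> tvec_of p c v \<in> tangent_space M p"
  by (rule tangentI) (simp_all add: tvec_of_def D_trans_comp)

lemma tvec_of_same: "c \<in> charts_at M p \<Longrightarrow> tvec_of p c v c = v"
  by (simp add: tvec_of_def D_trans_refl)

lemma tangent_change:
  "\<xi> \<in> tangent_space M p \<Longrightarrow> c \<in> charts_at M p \<Longrightarrow> d \<in> charts_at M p \<Longrightarrow> \<xi> d = D_trans c d p (\<xi> c)"
  unfolding tangent_space_def by blast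

lemma tangent_eqI:
  assumes "\<xi> \<in> tangent_space M p" "\<eta> \<in> tangent_space M p" "c \<in> charts_at M p" "\<xi> c = \<eta> c"
  shows "\<xi> = \<eta>"
proof
  show "\<xi> d = \<eta> d" for d
  proof (cases "d \<in> charts_at M p")
    case True
    show ?thesis
      unfolding tangent_change[OF assms(1,3) True] tangent_change[OF assms(2,3) True] assms(4) ..
  next
    case False
    show ?thesis unfolding tangent_outside[OF assms(1) False] tangent_outside[OF assms(2) False] ..
  qed
qed

lemma tangent_add:
  assumes "\<xi> \<in> tangent_space M p" "\<eta> \<in> tangent_space M p"
  shows "(\<lambda>c. \<xi> c + \<eta> c) \<in> tangent_space M p"
proof (rule tangentI)
  show "\<xi> d + \<eta> d = D_trans c d p (\<xi> c + \<eta> c)" if "c \<in> charts_at M p" "d \<in> charts_at M p" for c d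
    unfolding linear_add[OF D_trans_linear[OF that]] tangent_change[OF assms(1) that] tangent_change[OF assms(2) that] ..
qed (simp add: tangent_outside[OF assms(1)] tangent_outside[OF assms(2)])

lemma tangent_scale:
  assumes "\<xi> \<in> tangent_space M p" shows "(\<lambda>c. r *\<^sub>R \<xi> c) \<in> tangent_space M p"
proof (rule tangentI)
  show "r *\<^sub>R \<xi> d = D_trans c d p (r *\<^sub>R \<xi> c)" if "c \<in> charts_at M p" "d \<in> charts_at M p" for c d
    unfolding linear_scale[OF D_trans_linear[OF that]] tangent_change[OF assms that] ..
qed (simp add: tangent_outside[OF assms])

lemma tangent_zero: "(\<lambda>c. 0) \<in> tangent_space M p"
  by (rule tangentI) (simp_all add: linear_0[OF D_trans_linear])

lemma tangent_diff:
  "\<xi> \<in> tangent_space M p \<Longrightarrow> \<eta> \<in> tangent_space M p \<Longrightarrow> (\<lambda>c. \<xi> c - \<eta> c) \<in> tangent_space M p"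
  using tangent_add[OF _ tangent_scale[of \<eta> p "-1"]] by simp

lemma tangent_sum:
  "(\<And>i. i \<in> I \<Longrightarrow> \<xi> i \<in> tangent_space M p) \<Longrightarrow> (\<lambda>c. \<Sum>i\<in>I. \<xi> i c) \<in> tangent_space M p"
proof (induction I rule: infinite_finite_induct)
  case (insert i I)
  then show ?case using tangent_add[of "\<xi> i" p "\<lambda>c. \<Sum>i\<in>I. \<xi> i c"] by simp
next
  case empty
  then show ?case using tangent_zero by simp
next
  case (infinite I)
  then show ?case using tangent_zero by simp
qed

lemma vf_rep_snd: "c \<in> atlas M \<Longrightarrow> p \<in> fst c \<Longrightarrow> vf_rep c X (snd c p) = X p c"
  by (simp add: vf_rep_def chart_inv_snd)

lemma smooth_vf_rep:
  "smooth_vector_field M U X \<Longrightarrow> c \<in> atlas M \<Longrightarrow> smooth_on (snd c ` (U \<inter> fst c)) (vf_rep c X)"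
  by (simp add: smooth_vector_field_def)

text \<open>Each derivative of a vector field acquires a second derivative of the transition map
  under a change of chart; by symmetry these terms cancel in the bracket.\<close>

lemma lie_bracket_tangent:
  assumes X: "smooth_vector_field M U X" and Y: "smooth_vector_field M U Y" and p: "p \<in> U"
  shows "lie_bracket M X Y p \<in> tangent_space M p"
proof -
  have "lie_bracket M X Y p d = D_trans c d p (lie_bracket M X Y p c)"
    if c: "c \<in> charts_at M p" and d: "d \<in> charts_at M p" for c d
  proof -
    let ?\<tau> = "transition c d"
    let ?x = "snd c p"
    let ?D = "\<lambda>y. frechet_derivative ?\<tau> (at y)"
    let ?D2 = "\<lambda>w. frechet_derivative (\<lambda>y. ?D y w) (at ?x)"
    have ca: "c \<in> atlas M" "d \<in> atlas M" "p \<in> fst c" "p \<in> fst d" using c d charts_atD by auto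
    let ?O = "snd c ` (fst c \<inter> fst d)"
    have O: "open ?O" "?x \<in> ?O" using open_overlap ca by auto
    have sm: "smooth_on ?O ?\<tau>" by (rule trans[OF ca(1,2)])
    let ?N = "snd c ` (U \<inter> (fst c \<inter> fst d))"
    have N: "open ?N" "?x \<in> ?N"
    proof -
      have "openin (mtop M) (U \<inter> fst d)" using X chart_homeo(1)[OF ca(2)] by (simp add: smooth_vector_field_def openin_Int)
      then show "open ?N" using open_chart_image[OF ca(1), of "U \<inter> fst d"] by (simp add: Int_ac)
      show "?x \<in> ?N" using p ca by blast
    qed
    \<comment> \<open>Differentiate \<open>vf_rep d Z (?\<tau> y) = ?D y (vf_rep c Z y)\<close>; the
      term \<open>?D2\<close> comes from the moving operator \<open>?D y\<close>.\<close>
    have change: "frechet_derivative (vf_rep d Z) (at (snd d p)) (?D ?x w) =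
        ?D2 (Z p c) w + ?D ?x (frechet_derivative (vf_rep c Z) (at ?x) w)"
      if Z: "smooth_vector_field M U Z" for Z w
    proof -
      have eq: "vf_rep d Z (?\<tau> y) = ?D y (vf_rep c Z y)" if "y \<in> ?N" for y
      proof -
        obtain q where q: "q \<in> U" "q \<in> fst c" "q \<in> fst d" "y = snd c q" using \<open>y \<in> ?N\<close> by blast
        have "Z q \<in> tangent_space M q" using Z q(1) by (simp add: smooth_vector_field_def)
        from tangent_change[OF this, of c d] show ?thesis
          using q ca by (simp add: transition_snd vf_rep_snd charts_at_def)
      qed
      have dc: "(vf_rep c Z has_derivative frechet_derivative (vf_rep c Z) (at ?x)) (at ?x)"
        by (rule smooth_onD[OF smooth_vf_rep[OF Z ca(1)]]) (use p ca in blast)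
      have dd: "(vf_rep d Z has_derivative frechet_derivative (vf_rep d Z) (at (snd d p))) (at (?\<tau> ?x))"
        using smooth_onD[OF smooth_vf_rep[OF Z ca(2)], of "snd d p"] p ca by (simp add: transition_snd)
      have 1: "((\<lambda>y. vf_rep d Z (?\<tau> y)) has_derivative (\<lambda>w. frechet_derivative (vf_rep d Z) (at (snd d p)) (?D ?x w))) (at ?x)"
        by (rule has_derivative_compose[OF smooth_onD[OF sm O(2)] dd])
      have linD: "linear (?D y)" if "y \<in> ?O" for y using smooth_onD[OF sm that] has_derivative_linear by blast
      have "((\<lambda>y. ?D y (vf_rep c Z y)) has_derivative
          (\<lambda>w. ?D2 (vf_rep c Z ?x) w + ?D ?x (frechet_derivative (vf_rep c Z) (at ?x) w))) (at ?x)"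
        by (rule has_derivative_apply[OF O linD smooth_onD[OF smooth_on_frechet_derivative[OF sm] O(2)] dc])
      then have 2: "((\<lambda>y. vf_rep d Z (?\<tau> y)) has_derivative
          (\<lambda>w. ?D2 (vf_rep c Z ?x) w + ?D ?x (frechet_derivative (vf_rep c Z) (at ?x) w))) (at ?x)"
        by (rule has_derivative_transform_within_open[OF _ N]) (simp add: eq)
      from fun_cong[OF has_derivative_unique[OF 1 2], of w] show ?thesis
        using ca by (simp add: vf_rep_snd)
    qed
    have XY: "X p d = ?D ?x (X p c)" "Y p d = ?D ?x (Y p c)"
      using X Y p tangent_change[OF _ c d] by (auto simp: smooth_vector_field_def)
    have "?D2 (Y p c) (X p c) = ?D2 (X p c) (Y p c)"
      by (rule second_derivative_symmetric[OF O smooth_onD[OF sm]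
            smooth_onD[OF smooth_on_frechet_derivative[OF sm] O(2)] smooth_onD[OF smooth_on_frechet_derivative[OF sm] O(2)]])
    then show ?thesis
      using c d change[OF X, of "Y p c"] change[OF Y, of "X p c"] XY
      by (simp add: lie_bracket_def linear_diff[OF D_trans_linear[OF c d]])
  qed
  then show ?thesis by (rule tangentI) (simp_all add: lie_bracket_def)
qed

lemma smooth_vector_field_sum:
  assumes "\<And>i. i < m \<Longrightarrow> smooth_vector_field M U (X i)" and U: "openin (mtop M) U"
  shows "smooth_vector_field M U (\<lambda>p c. \<Sum>i<m. a i *\<^sub>R X i p c)"
proof -
  have "smooth_on (snd c ` (U \<inter> fst c)) (vf_rep c (\<lambda>p c. \<Sum>i<m. a i *\<^sub>R X i p c))" if c: "c \<in> atlas M" for c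
  proof -
    have "vf_rep c (\<lambda>p c. \<Sum>i<m. a i *\<^sub>R X i p c) = (\<lambda>y. \<Sum>i<m. a i *\<^sub>R vf_rep c (X i) y)"
      by (simp add: vf_rep_def)
    then show ?thesis
      using open_chart_image[OF c U] smooth_vf_rep[OF assms(1) c]
      by (auto intro!: smooth_on_sum smooth_on_scaleR smooth_on_const)
  qed
  moreover have "(\<lambda>c. \<Sum>i<m. a i *\<^sub>R X i p c) \<in> tangent_space M p" if "p \<in> U" for p
    using assms(1) that by (intro tangent_sum tangent_scale) (auto simp: smooth_vector_field_def)
  ultimately show ?thesis using U by (simp add: smooth_vector_field_def)
qed

lemma subbundle_tangent:
  assumes F: "subbundle M r F" and p: "c \<in> charts_at M p" and \<xi>: "\<xi> \<in> F p"
  shows "\<xi> \<in> tangent_space M p"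
proof -
  have "p \<in> topspace (mtop M)" using chart_topspace[of c] charts_atD[OF p] by auto
  with F have "F p \<subseteq> tangent_space M p" by (simp add: subbundle_def)
  then show ?thesis using \<xi> by (rule subsetD)
qed

lemma subbundle_memI:
  assumes F: "subbundle M r F" and p: "c \<in> charts_at M p"
    and \<xi>: "\<xi> \<in> tangent_space M p" "\<xi> c \<in> (\<lambda>\<xi>. \<xi> c) ` F p"
  shows "\<xi> \<in> F p"
proof -
  obtain \<eta> where "\<xi> c = \<eta> c" "\<eta> \<in> F p" using \<xi>(2) by (rule imageE)
  then show ?thesis using tangent_eqI[OF \<xi>(1) subbundle_tangent[OF F p] p] by simp
qed

lemma subbundle_fibre:
  assumes "subbundle M r F" "c \<in> charts_at M p"
  shows "subspace ((\<lambda>\<xi>. \<xi> c) ` F p)" "dim ((\<lambda>\<xi>. \<xi> c) ` F p) = r"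
proof -
  have "p \<in> topspace (mtop M)" using chart_topspace[of c] charts_atD[OF assms(2)] by auto
  then show "subspace ((\<lambda>\<xi>. \<xi> c) ` F p)" "dim ((\<lambda>\<xi>. \<xi> c) ` F p) = r"
    using assms by (auto simp: subbundle_def)
qed

lemma subbundle_frame:
  assumes F: "subbundle M r F" and p: "p \<in> topspace (mtop M)"
  obtains U X where "p \<in> U" "openin (mtop M) U" "\<And>i. i < r \<Longrightarrow> smooth_vector_field M U (X i)"
    "\<And>q c. q \<in> U \<Longrightarrow> c \<in> charts_at M q \<Longrightarrow> (\<lambda>\<xi>. \<xi> c) ` F q = span ((\<lambda>i. X i q c) ` {..<r})"
proof -
  from bspec[OF conjunct2[OF F[unfolded subbundle_def]] p]
  obtain U X where U: "p \<in> U \<and> (\<forall>i<r. smooth_vector_field M U (X i)) \<and> openin (mtop M) U \<and>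
        (\<forall>q\<in>U. \<forall>c\<in>charts_at M q. (\<lambda>\<xi>. \<xi> c) ` F q = span ((\<lambda>i. X i q c) ` {..<r}))"
    by (elim exE)
  show ?thesis by (rule that[of U X]) (use U in simp_all)
qed

text \<open>Combinations of a local frame with constant coefficients. The domain does not depend on
  the vector, because \<open>levi_bracket\<close> takes both sections on one set
  \<open>U\<close>.\<close>

lemma smooth_section_extension:
  assumes F: "subbundle M r F" and cov: "(\<Union>c\<in>atlas M. fst c) = topspace (mtop M)"
    and p: "p \<in> topspace (mtop M)"
  obtains U where "p \<in> U" "\<And>\<xi>. \<xi> \<in> F p \<Longrightarrow> \<exists>X. section_on M F U X \<and> X p = \<xi>"
proof -
  obtain U X where U: "p \<in> U" "openin (mtop M) U" "\<And>i. i < r \<Longrightarrow> smooth_vector_field M U (X i)"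
    "\<And>q c. q \<in> U \<Longrightarrow> c \<in> charts_at M q \<Longrightarrow> (\<lambda>\<xi>. \<xi> c) ` F q = span ((\<lambda>i. X i q c) ` {..<r})"
    by (rule subbundle_frame[OF F p]) ((rule that; assumption) | assumption)+
  have ch: "\<exists>c. c \<in> charts_at M q" if "q \<in> U" for q
  proof -
    have "q \<in> (\<Union>c\<in>atlas M. fst c)" unfolding cov using openin_subset[OF U(2)] that by (rule subsetD)
    then show ?thesis unfolding charts_at_def by (elim UN_E) blast
  qed
  have "\<exists>X. section_on M F U X \<and> X p = \<xi>" if \<xi>: "\<xi> \<in> F p" for \<xi>
  proof -
    obtain c where c: "c \<in> charts_at M p" using ch U(1) by blast
    have "\<xi> c \<in> span ((\<lambda>i. X i p c) ` {..<r})" unfolding U(4)[OF U(1) c, symmetric] using \<xi> by (rule imageI)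
    then obtain a where a: "\<xi> c = (\<Sum>i<r. a i *\<^sub>R X i p c)"
      by (rule span_image_sum)
    let ?X = "\<lambda>p c. \<Sum>i<r. a i *\<^sub>R X i p c"
    have sX: "smooth_vector_field M U ?X" by (rule smooth_vector_field_sum[OF U(3,2)])
    then have tX: "?X q \<in> tangent_space M q" if "q \<in> U" for q using that by (simp add: smooth_vector_field_def)
    have "?X q \<in> F q" if "q \<in> U" for q
    proof -
      obtain c where c: "c \<in> charts_at M q" using ch \<open>q \<in> U\<close> by blast
      have "?X q c \<in> span ((\<lambda>i. X i q c) ` {..<r})"
        by (intro span_sum span_scale span_base) auto
      then show ?thesis
        by (intro subbundle_memI[OF F c tX[OF \<open>q \<in> U\<close>]]) (simp only: U(4)[OF \<open>q \<in> U\<close> c])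
    qed
    moreover have "?X p = \<xi>"
    proof (rule tangent_eqI[where c=c])
      show "?X p \<in> tangent_space M p" by (rule tX[OF U(1)])
      show "\<xi> \<in> tangent_space M p" using subbundle_tangent[OF F c \<xi>] .
    qed (use a c in simp_all)
    ultimately show ?thesis using sX by (auto simp: section_on_def)
  qed
  then show ?thesis using that U(1) by blast
qed

text \<open>Since \<open>\<alpha>\<close> annihilates the sections of \<open>H\<close>, their bracket satisfies
  \<open>\<alpha> [X, Y] = D\<alpha> (Y) X - D\<alpha> (X) Y\<close>.\<close>

lemma contact_nondegenerate:
  assumes H: "subbundle M r H" and cov: "(\<Union>c\<in>atlas M. fst c) = topspace (mtop M)"
    and nd: "\<And>p \<xi>. p \<in> topspace (mtop M) \<Longrightarrow> \<xi> \<in> H p \<Longrightarrow> (\<And>\<eta>. \<eta> \<in> H p \<Longrightarrow> levi_bracket M H p \<xi> \<eta> = H p) \<Longrightarrow> \<xi> = (\<lambda>_. 0)"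
    and c: "c \<in> charts_at M p"
    and V: "open V" "snd c p \<in> V" "V \<subseteq> snd c ` fst c"
    and \<alpha>: "\<And>y. y \<in> V \<Longrightarrow> linear (\<alpha> y)" "\<And>w. smooth_on V (\<lambda>y. \<alpha> y w)"
      "\<And>y w. y \<in> V \<Longrightarrow> \<alpha> y w = (0::real) \<longleftrightarrow> w \<in> (\<lambda>\<xi>. \<xi> c) ` H (chart_inv c y)"
    and v: "v \<in> (\<lambda>\<xi>. \<xi> c) ` H p"
    and sym: "\<And>w. w \<in> (\<lambda>\<xi>. \<xi> c) ` H p \<Longrightarrow>
      frechet_derivative (\<lambda>y. \<alpha> y w) (at (snd c p)) v = frechet_derivative (\<lambda>y. \<alpha> y v) (at (snd c p)) w"
  shows "v = 0"
proof -
  have ca: "c \<in> atlas M" "p \<in> fst c" using c charts_atD by auto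
  have pT: "p \<in> topspace (mtop M)" using chart_topspace[OF ca(1)] ca(2) by auto
  let ?x = "snd c p"
  let ?D\<alpha> = "\<lambda>w. frechet_derivative (\<lambda>y. \<alpha> y w) (at ?x)"
  obtain \<xi> where \<xi>: "\<xi> \<in> H p" "v = \<xi> c" using v by blast
  \<comment> \<open>Membership is shown for arbitrary sections through \<open>\<xi>\<close>, since
    \<open>levi_bracket\<close> collects the brackets of all of them.\<close>
  have lie_in: "lie_bracket M X Y p \<in> H p"
    if X: "section_on M H U X" and Y: "section_on M H U Y" and p: "p \<in> U" and XY: "X p = \<xi>" for U X Y
  proof -
    have sX: "smooth_vector_field M U X" and sY: "smooth_vector_field M U Y"
      using X Y by (auto simp: section_on_def)
    have U: "openin (mtop M) U" using sX by (simp add: smooth_vector_field_def)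
    let ?N = "V \<inter> snd c ` (U \<inter> fst c)"
    have N: "open ?N" "?x \<in> ?N" using V open_chart_image[OF ca(1) U] p ca by auto
    have ann: "\<alpha> ?x (frechet_derivative (vf_rep c Z) (at ?x) h) = - ?D\<alpha> (Z p c) h"
      if Z: "section_on M H U Z" for Z h
    proof -
      have sZ: "smooth_vector_field M U Z" using Z by (simp add: section_on_def)
      have dZ: "(vf_rep c Z has_derivative frechet_derivative (vf_rep c Z) (at ?x)) (at ?x)"
        by (rule smooth_onD[OF smooth_vf_rep[OF sZ ca(1)]]) (use p ca in blast)
      have 1: "((\<lambda>y. \<alpha> y (vf_rep c Z y)) has_derivative
          (\<lambda>h. ?D\<alpha> (vf_rep c Z ?x) h + \<alpha> ?x (frechet_derivative (vf_rep c Z) (at ?x) h))) (at ?x)"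
        by (rule has_derivative_apply[OF V(1,2) \<alpha>(1) smooth_onD[OF \<alpha>(2) V(2)] dZ])
      have "\<alpha> y (vf_rep c Z y) = 0" if y: "y \<in> ?N" for y
      proof -
        obtain q where q: "q \<in> U" "q \<in> fst c" "y = snd c q" using y by blast
        have "Z q \<in> H q" using Z q(1) by (simp add: section_on_def)
        then show ?thesis using \<alpha>(3)[of y] y q ca by (simp add: vf_rep_snd chart_inv_snd)
      qed
      then have "((\<lambda>y. \<alpha> y (vf_rep c Z y)) has_derivative (\<lambda>h. 0)) (at ?x)"
        by (intro has_derivative_transform_within_open[OF has_derivative_const N]) simp
      from fun_cong[OF has_derivative_unique[OF 1 this], of h] show ?thesis
        using ca by (simp add: vf_rep_snd)
    qed
    have YH: "Y p \<in> H p" using Y p by (simp add: section_on_def)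
    have "\<alpha> ?x (lie_bracket M X Y p c) = - ?D\<alpha> (Y p c) (X p c) + ?D\<alpha> (X p c) (Y p c)"
      using c ann[OF X] ann[OF Y] by (simp add: lie_bracket_def linear_diff[OF \<alpha>(1)[OF V(2)]])
    also have "\<dots> = 0" using sym[of "Y p c"] YH XY \<xi>(2) by simp
    finally have "lie_bracket M X Y p c \<in> (\<lambda>\<xi>. \<xi> c) ` H p"
      using \<alpha>(3)[OF V(2)] ca by (simp add: chart_inv_snd)
    then show ?thesis
      by (rule subbundle_memI[OF H c lie_bracket_tangent[OF sX sY p]])
  qed
  have add: "(\<lambda>c. a c + b c) \<in> H p" and diff: "(\<lambda>c. a c - b c) \<in> H p" if "a \<in> H p" "b \<in> H p" for a b
  proof -
    have "a c + b c \<in> (\<lambda>\<xi>. \<xi> c) ` H p" "a c - b c \<in> (\<lambda>\<xi>. \<xi> c) ` H p"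
      by (intro subspace_add subspace_diff subbundle_fibre(1)[OF H c] imageI that)+
    then show "(\<lambda>c. a c + b c) \<in> H p" "(\<lambda>c. a c - b c) \<in> H p"
      using subbundle_memI[OF H c tangent_add[OF that[THEN subbundle_tangent[OF H c]]]]
        subbundle_memI[OF H c tangent_diff[OF that[THEN subbundle_tangent[OF H c]]]] by blast+
  qed
  obtain U where U: "p \<in> U" "\<And>\<xi>. \<xi> \<in> H p \<Longrightarrow> \<exists>X. section_on M H U X \<and> X p = \<xi>"
    using smooth_section_extension[OF H cov pT] by blast
  \<comment> \<open>Brackets lying in \<open>H p\<close> give one inclusion only. The other one
    needs actual sections through \<open>\<xi>\<close> and \<open>\<eta>\<close>: each
    \<open>\<zeta>\<close> is their bracket plus an element of \<open>H p\<close>.\<close>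
  have "levi_bracket M H p \<xi> \<eta> = H p" if \<eta>: "\<eta> \<in> H p" for \<eta>
  proof
    show "levi_bracket M H p \<xi> \<eta> \<subseteq> H p"
      unfolding levi_bracket_def using lie_in add by blast
    show "H p \<subseteq> levi_bracket M H p \<xi> \<eta>"
    proof
      fix \<zeta> assume \<zeta>: "\<zeta> \<in> H p"
      obtain X Y where XY: "section_on M H U X" "X p = \<xi>" "section_on M H U Y" "Y p = \<eta>"
        using U(2)[OF \<xi>(1)] U(2)[OF \<eta>] by blast
      let ?\<zeta>' = "\<lambda>c. \<zeta> c - lie_bracket M X Y p c"
      have z: "?\<zeta>' \<in> H p" by (rule diff[OF \<zeta> lie_in[OF XY(1,3) U(1) XY(2)]])
      show "\<zeta> \<in> levi_bracket M H p \<xi> \<eta>"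
        unfolding levi_bracket_def
        by (rule CollectI, rule exI[of _ U], rule exI[of _ X], rule exI[of _ Y], rule exI[of _ ?\<zeta>'])
          (use XY U(1) z in simp)
    qed
  qed
  then have "\<xi> = (\<lambda>_. 0)" using nd[OF pT \<xi>(1)] by blast
  then show ?thesis using \<xi>(2) by simp
qed

end

text \<open>All other coordinate expressions differ from \<open>g\<close> by transition maps. It
  serves both the map to the bundle and its inverse, each of which is described in one pair of
  charts.\<close>

lemma chart_smooth_map:
  fixes M :: "('a, 'e::euclidean_space) mfd" and P :: "('b, 'f::euclidean_space) mfd"
  assumes M: "charted M" and P: "charted P" and c: "c \<in> atlas M" and d: "d \<in> atlas P"
    and U: "openin (mtop M) U" "U \<subseteq> fst c" and g: "smooth_on (snd c ` U) g"
    and \<Phi>: "\<And>q. q \<in> U \<Longrightarrow> \<Phi> q \<in> fst d" "\<And>q. q \<in> U \<Longrightarrow> snd d (\<Phi> q) = g (snd c q)"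
  shows "smooth_map_on M U P \<Phi>"
proof -
  interpret M: charted M by (rule M)
  interpret P: charted P by (rule P)
  have oU: "open (snd c ` U)"
    using M.open_chart_image[OF c U(1)] U(2) by (simp add: Int_absorb2)
  have pre: "openin (mtop M) {q \<in> U. \<Phi> q \<in> W}" if W: "openin (mtop P) W" for W
  proof -
    let ?N = "snd c ` U \<inter> g -` (snd d ` (W \<inter> fst d))"
    have N: "open ?N"
      by (rule continuous_open_preimage[OF smooth_on_imp_continuous[OF g] oU P.open_chart_image[OF d W]])
    have "{q \<in> U. \<Phi> q \<in> W} = {q \<in> fst c. snd c q \<in> ?N}"
    proof (rule set_eqI)
      fix q
      show "q \<in> {q \<in> U. \<Phi> q \<in> W} \<longleftrightarrow> q \<in> {q \<in> fst c. snd c q \<in> ?N}"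
      proof
        assume "q \<in> {q \<in> U. \<Phi> q \<in> W}"
        then have q: "q \<in> U" "\<Phi> q \<in> W" by auto
        have "snd d (\<Phi> q) \<in> snd d ` (W \<inter> fst d)" using q \<Phi>(1) by blast
        then show "q \<in> {q \<in> fst c. snd c q \<in> ?N}" using q U(2) \<Phi>(2)[OF q(1)] by auto
      next
        assume "q \<in> {q \<in> fst c. snd c q \<in> ?N}"
        then obtain q' z where q: "q \<in> fst c" "q' \<in> U" "snd c q = snd c q'" "z \<in> W" "z \<in> fst d" "g (snd c q) = snd d z"
          by auto
        have "q = q'" using inj_onD[OF M.chart_inj[OF c] q(3,1)] q(2) U(2) by blast
        then have "\<Phi> q = z" using inj_onD[OF P.chart_inj[OF d], of "\<Phi> q" z] q \<Phi> by simp
        then show "q \<in> {q \<in> U. \<Phi> q \<in> W}" using q \<open>q = q'\<close> by simp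
      qed
    qed
    then show ?thesis using M.openin_chart_preimage[OF c N] by simp
  qed
  have cont: "continuous_map (subtopology (mtop M) U) (mtop P) \<Phi>"
    unfolding continuous_map topspace_subtopology_subset[OF openin_subset[OF U(1)]]
  proof (intro conjI allI impI)
    show "\<Phi> ` U \<subseteq> topspace (mtop P)" using \<Phi>(1) P.chart_topspace[OF d] by blast
    show "openin (subtopology (mtop M) U) {x \<in> U. \<Phi> x \<in> W}" if "openin (mtop P) W" for W
      unfolding openin_open_subtopology[OF U(1)] using pre[OF that] by blast
  qed
  have "smooth_on (snd c' ` {p \<in> U \<inter> fst c'. \<Phi> p \<in> fst d'}) (snd d' \<circ> \<Phi> \<circ> chart_inv c')"
    if c': "c' \<in> atlas M" and d': "d' \<in> atlas P" for c' d'
  proof -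
    let ?Q = "{p \<in> U. \<Phi> p \<in> fst d'}"
    let ?S = "snd c' ` (?Q \<inter> fst c')"
    have S: "open ?S" by (rule M.open_chart_image[OF c' pre[OF P.chart_homeo(1)[OF d']]])
    have tc: "transition c' c y \<in> snd c ` U" "g (transition c' c y) \<in> snd d ` (fst d \<inter> fst d')"
      "y \<in> snd c' ` (fst c' \<inter> fst c)" "transition d d' (g (transition c' c y)) = snd d' (\<Phi> (chart_inv c' y))"
      if y: "y \<in> ?S" for y
    proof -
      obtain q where q: "q \<in> U" "\<Phi> q \<in> fst d'" "q \<in> fst c'" "y = snd c' q" using y by blast
      have t: "transition c' c y = snd c q" using M.transition_snd[OF c' q(3)] q(4) by simp
      have gd: "g (transition c' c y) = snd d (\<Phi> q)" unfolding t using \<Phi>(2)[OF q(1)] by simp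
      show "transition c' c y \<in> snd c ` U" unfolding t using q(1) by blast
      show "g (transition c' c y) \<in> snd d ` (fst d \<inter> fst d')" unfolding gd using q(2) \<Phi>(1)[OF q(1)] by blast
      show "y \<in> snd c' ` (fst c' \<inter> fst c)" using q U(2) by blast
      show "transition d d' (g (transition c' c y)) = snd d' (\<Phi> (chart_inv c' y))"
        unfolding gd unfolding P.transition_snd[OF d \<Phi>(1)[OF q(1)]] q(4) M.chart_inv_snd[OF c' q(3)] ..
    qed
    have s1: "smooth_on ?S (transition c' c)"
      by (rule smooth_on_subset[OF M.trans[OF c' c]]) (use tc(3) in blast)
    have s2: "smooth_on ?S (\<lambda>y. g (transition c' c y))"
      by (rule smooth_on_compose[OF S oU g s1 tc(1)])
    have "smooth_on ?S (\<lambda>y. transition d d' (g (transition c' c y)))"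
      by (rule smooth_on_compose[OF S P.open_overlap[OF d d'] P.trans[OF d d'] s2 tc(2)])
    then have "smooth_on ?S (snd d' \<circ> \<Phi> \<circ> chart_inv c')"
      by (rule smooth_on_cong[OF S]) (simp add: tc(4))
    moreover have "{p \<in> U \<inter> fst c'. \<Phi> p \<in> fst d'} = ?Q \<inter> fst c'" by blast
    ultimately show ?thesis by simp
  qed
  then show ?thesis using cont by (simp add: smooth_map_on_def)
qed

text \<open>Frees \<open>tangent_map\<close> from its unspecified choice of chart: by the chain rule
  the change from the chosen chart to \<open>c\<close> is absorbed by the transformation law of
  \<open>\<xi>\<close>.\<close>

lemma chart_tangent_map:
  fixes M :: "('a, 'e::euclidean_space) mfd" and P :: "('b, 'f::euclidean_space) mfd"
  assumes M: "charted M" and P: "charted P" and c: "c \<in> atlas M" and d: "d \<in> atlas P"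
    and U: "openin (mtop M) U" "U \<subseteq> fst c" and g: "smooth_on (snd c ` U) g"
    and \<Phi>: "\<And>q. q \<in> U \<Longrightarrow> \<Phi> q \<in> fst d" "\<And>q. q \<in> U \<Longrightarrow> snd d (\<Phi> q) = g (snd c q)"
    and q: "q \<in> U" and \<xi>: "\<xi> \<in> tangent_space M q"
  shows "tangent_map M P \<Phi> q \<xi> = charted.tvec_of P (\<Phi> q) d (frechet_derivative g (at (snd c q)) (\<xi> c))"
proof -
  interpret M: charted M by (rule M)
  interpret P: charted P by (rule P)
  define c' where "c' = (SOME c. c \<in> charts_at M q)"
  have cq: "c \<in> charts_at M q" using c q U(2) by (auto simp: charts_at_def)
  then have c'q: "c' \<in> charts_at M q" unfolding c'_def by (rule someI)
  have c': "c' \<in> atlas M" "q \<in> fst c'" using M.charts_atD[OF c'q] by auto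
  have dq: "d \<in> charts_at P (\<Phi> q)" using d \<Phi>(1)[OF q] by (simp add: charts_at_def)
  let ?Dg = "frechet_derivative g (at (snd c q))"
  have dg: "(g has_derivative ?Dg) (at (snd c q))" by (rule smooth_onD[OF g]) (use q in blast)
  have "frechet_derivative (snd e \<circ> \<Phi> \<circ> chart_inv c') (at (snd c' q)) (\<xi> c') = P.D_trans d e (\<Phi> q) (?Dg (\<xi> c))"
    if e: "e \<in> charts_at P (\<Phi> q)" for e
  proof -
    let ?S = "snd c' ` (U \<inter> fst c')"
    have S: "open ?S" "snd c' q \<in> ?S" using M.open_chart_image[OF c'(1) U(1)] q c' by auto
    have t: "transition c' c (snd c' q) = snd c q" by (rule M.transition_snd[OF c'])
    have 1: "(transition c' c has_derivative M.D_trans c' c q) (at (snd c' q))" by (rule M.D_trans_has[OF c'q cq])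
    have 2: "((\<lambda>y. g (transition c' c y)) has_derivative (\<lambda>v. ?Dg (M.D_trans c' c q v))) (at (snd c' q))"
      by (rule has_derivative_compose[OF 1]) (simp add: t dg)
    have "((\<lambda>y. transition d e (g (transition c' c y))) has_derivative
        (\<lambda>v. P.D_trans d e (\<Phi> q) (?Dg (M.D_trans c' c q v)))) (at (snd c' q))"
      by (rule has_derivative_compose[OF 2]) (simp add: t \<Phi>(2)[OF q, symmetric] P.D_trans_has[OF dq e])
    then have "((snd e \<circ> \<Phi> \<circ> chart_inv c') has_derivative
        (\<lambda>v. P.D_trans d e (\<Phi> q) (?Dg (M.D_trans c' c q v)))) (at (snd c' q))"
    proof (rule has_derivative_transform_within_open[OF _ S])
      fix y assume "y \<in> ?S"
      then obtain q' where q': "q' \<in> U" "q' \<in> fst c'" "y = snd c' q'" by blast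
      show "transition d e (g (transition c' c y)) = (snd e \<circ> \<Phi> \<circ> chart_inv c') y"
        using M.transition_snd[OF c'(1) q'(2)] M.chart_inv_snd[OF c'(1) q'(2)] \<Phi>(2)[OF q'(1)]
          P.transition_snd[OF d \<Phi>(1)[OF q'(1)]] q'(3) by (simp del: \<Phi> add: \<Phi>(2)[OF q'(1), symmetric])
    qed
    from fun_cong[OF frechet_derivative_at[OF this], of "\<xi> c'"] show ?thesis
      using M.tangent_change[OF \<xi> c'q cq] by simp
  qed
  then show ?thesis
    unfolding tangent_map_def Let_def c'_def[symmetric] P.tvec_of_def by (intro ext) simp
qed

section \<open>The projectivized cotangent bundle\<close>

abbreviation cov :: "real^'k \<Rightarrow> ((real^'k) \<Rightarrow>\<^sub>L real)" where
  "cov \<equiv> blinfun_inner_right"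

lemma inner_axis_1 [simp]: "w \<bullet> axis j (1::real) = w $ j"
  by (simp add: inner_axis)

lemma cov_components:
  fixes \<alpha> :: "(real^'k) \<Rightarrow>\<^sub>L real"
  shows "cov (\<chi> j. blinfun_apply \<alpha> (axis j 1)) = \<alpha>"
proof (rule blinfun_eqI)
  fix v :: "real^'k"
  have "v = (\<Sum>j\<in>UNIV. (v $ j) *\<^sub>R axis j 1)"
    by (simp add: vec_eq_iff axis_def if_distrib cong: if_cong)
  then have "blinfun_apply \<alpha> v = blinfun_apply \<alpha> (\<Sum>j\<in>UNIV. (v $ j) *\<^sub>R axis j 1)" by simp
  also have "\<dots> = (\<Sum>j\<in>UNIV. (v $ j) * blinfun_apply \<alpha> (axis j 1))"
    by (simp add: blinfun.sum_right blinfun.scaleR_right)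
  finally show "blinfun_apply (cov (\<chi> j. blinfun_apply \<alpha> (axis j 1))) v = blinfun_apply \<alpha> v"
    by (simp add: blinfun_inner_right.rep_eq inner_vec_def mult.commute)
qed

lemma cov_scale: "cov (r *\<^sub>R w) = r *\<^sub>R cov w"
  by (rule blinfun_eqI) (simp add: blinfun_inner_right.rep_eq blinfun.scaleR_left)

lemma pcot_of_scale: assumes "r \<noteq> 0" shows "pcot_of (x, r *\<^sub>R \<alpha>) = pcot_of (x, \<alpha>)"
proof -
  have "span {r *\<^sub>R \<alpha>} = span {\<alpha>}"
  proof
    show "span {r *\<^sub>R \<alpha>} \<subseteq> span {\<alpha>}" by (rule span_minimal) (auto intro: span_scale span_base)
    have "\<alpha> = (1 / r) *\<^sub>R (r *\<^sub>R \<alpha>)" using assms by simp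
    then have "\<alpha> \<in> span {r *\<^sub>R \<alpha>}" by (metis insertI1 span_base span_scale)
    then show "span {\<alpha>} \<subseteq> span {r *\<^sub>R \<alpha>}" by (intro span_minimal) auto
  qed
  then show ?thesis by (simp add: pcot_of_def)
qed

lemma pcot_of_carrier: assumes "\<alpha> \<noteq> 0" shows "pcot_of (x, \<alpha>) \<in> pcot_carrier"
proof -
  have "independent {\<alpha>}" using assms by simp
  then have "dim (span {\<alpha>}) = 1" using dim_eq_card_independent[of "{\<alpha>}"] by (simp add: dim_span)
  then show ?thesis by (simp add: pcot_of_def pcot_carrier_def)
qed

lemma pcot_of_dom:
  assumes "blinfun_apply \<alpha> (axis i 1) \<noteq> 0" shows "pcot_of (x, \<alpha>) \<in> pcot_chart_dom i"
proof -
  have "\<alpha> \<noteq> 0" using assms by auto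
  from pcot_of_carrier[OF this, of x] show ?thesis
    using assms span_base[of \<alpha> "{\<alpha>}"] by (auto simp: pcot_chart_dom_def pcot_of_def)
qed

lemma pcot_coords_of:
  assumes "w $ i = 1" shows "pcot_coords i (pcot_of (x, cov w)) = (x, w - axis i 1)"
proof -
  have "(THE \<alpha>. \<alpha> \<in> span {cov w} \<and> blinfun_apply \<alpha> (axis i 1) = 1) = cov w"
  proof (rule the_equality)
    show "cov w \<in> span {cov w} \<and> blinfun_apply (cov w) (axis i 1) = 1"
      using assms by (simp add: span_base)
    fix \<alpha> assume "\<alpha> \<in> span {cov w} \<and> blinfun_apply \<alpha> (axis i 1) = 1"
    then obtain r where "\<alpha> = r *\<^sub>R cov w" "blinfun_apply \<alpha> (axis i 1) = 1" by (auto simp: span_singleton)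
    then show "\<alpha> = cov w" using assms by (simp add: blinfun.scaleR_left)
  qed
  moreover have "axis i (1::real) $ j = (if j = i then 1 else 0)" for j
    by (simp add: axis_def)
  ultimately show ?thesis
    using assms by (simp add: pcot_coords_def pcot_of_def vec_eq_iff Let_def)
qed

lemma pcot_coords_of_cov:
  assumes "w $ i \<noteq> 0" shows "pcot_coords i (pcot_of (x, cov w)) = (x, (1 / w $ i) *\<^sub>R w - axis i 1)"
proof -
  have "pcot_of (x, cov w) = pcot_of (x, cov ((1 / w $ i) *\<^sub>R w))"
    using pcot_of_scale[of "1 / w $ i" x "cov w"] assms by (simp add: cov_scale)
  then show ?thesis using pcot_coords_of[of "(1 / w $ i) *\<^sub>R w" i x] assms by simp
qed

lemma pcot_dom_cov:
  assumes "z \<in> pcot_chart_dom i" obtains w where "w $ i = 1" "z = pcot_of (fst z, cov w)"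
proof -
  obtain x l \<alpha> where z: "z = (x, l)" "subspace l" "dim l = 1" "\<alpha> \<in> l" "blinfun_apply \<alpha> (axis i 1) \<noteq> 0"
    using assms by (auto simp: pcot_chart_dom_def pcot_carrier_def)
  obtain B where B: "B \<subseteq> l" "independent B" "l \<subseteq> span B" "card B = dim l" using basis_exists[of l] by blast
  then obtain b where b: "B = {b}" using z(3) by (auto simp: card_1_singleton_iff)
  have lb: "l = span {b}" using B z(2) b by (metis span_minimal subset_antisym)
  let ?r = "blinfun_apply b (axis i 1)"
  have r: "?r \<noteq> 0" using z(4,5) unfolding lb span_singleton by (auto simp: blinfun.scaleR_left)
  let ?w = "\<chi> j. blinfun_apply ((1 / ?r) *\<^sub>R b) (axis j 1)"
  show ?thesis
  proof (rule that)
    show "?w $ i = 1" using r by (simp add: blinfun.scaleR_left)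
    show "z = pcot_of (fst z, cov ?w)"
      unfolding cov_components using pcot_of_scale[of "1 / ?r" x b] r by (simp add: z(1) lb pcot_of_def)
  qed
qed

text \<open>\<open>B\<close> is the inverse of the linear identification \<open>A\<close> on the hyperplane of normalized coordinates.\<close>

locale pcot_chart =
  fixes i :: "'k::finite" and A :: "(real^'k) \<times> (real^'k) \<Rightarrow> 'e::euclidean_space" and B
  assumes lin_A: "linear A" and lin_B: "linear B" and AB: "A (B y) = y" and B_i: "snd (B y) $ i = 0"
    and BA: "u $ i = 0 \<Longrightarrow> B (A (x, u)) = (x, u)"
begin

abbreviation "ch \<equiv> (pcot_chart_dom i, A \<circ> pcot_coords i)"

text \<open>Fibre coordinates have vanishing component \<open>i\<close>; adding
  \<open>axis i 1\<close> restores the normalized covector.\<close>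

definition wv :: "'e \<Rightarrow> real^'k" where "wv y = snd (B y) + axis i 1"

text \<open>The inverse of the chart \<open>ch\<close>; see \<open>chart_inv_ch\<close>.\<close>

definition h :: "'e \<Rightarrow> 'k pcot" where "h y = pcot_of (fst (B y), cov (wv y))"

lemma bl: "bounded_linear A" "bounded_linear B" "bounded_linear (\<lambda>y. fst (B y))" "bounded_linear (\<lambda>y. snd (B y))"
  using lin_A lin_B bounded_linear_compose[OF bounded_linear_fst, of B] bounded_linear_compose[OF bounded_linear_snd, of B]
  by (simp_all add: linear_conv_bounded_linear)

lemma wv_i: "wv y $ i = 1"
  by (simp add: wv_def B_i)

lemma wv_nz: "cov (wv y) \<noteq> 0"
proof
  assume "cov (wv y) = 0"
  then have "blinfun_apply (cov (wv y)) (axis i 1) = 0" by simp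
  then show False by (simp add: wv_i)
qed

lemma h_dom: "h y \<in> pcot_chart_dom i"
  unfolding h_def by (rule pcot_of_dom) (simp add: wv_i)

lemma coords_h: "A (pcot_coords i (h y)) = y"
  unfolding h_def pcot_coords_of[OF wv_i] by (simp add: wv_def AB)

lemma coords_of: "w $ i = 1 \<Longrightarrow> B (A (pcot_coords i (pcot_of (x, cov w)))) = (x, w - axis i 1)"
  by (simp add: pcot_coords_of BA)

lemma h_coords: assumes "z \<in> pcot_chart_dom i" shows "h (A (pcot_coords i z)) = z"
proof -
  obtain w where w: "w $ i = 1" "z = pcot_of (fst z, cov w)" using pcot_dom_cov[OF assms] .
  have "B (A (pcot_coords i z)) = (fst z, w - axis i 1)"
    by (subst w(2)) (rule coords_of[OF w(1)])
  then show ?thesis unfolding h_def wv_def using w(2) by simp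
qed

lemma ch_image: "snd ch ` W = {y. h y \<in> W}" if "W \<subseteq> pcot_chart_dom i"
proof
  show "snd ch ` W \<subseteq> {y. h y \<in> W}" using h_coords that by auto
  show "{y. h y \<in> W} \<subseteq> snd ch ` W"
  proof
    fix y assume "y \<in> {y. h y \<in> W}"
    then show "y \<in> snd ch ` W" using coords_h[of y] by (intro image_eqI[of _ _ "h y"]) auto
  qed
qed

lemma ch_UNIV: "snd ch ` fst ch = UNIV"
  using ch_image[of "pcot_chart_dom i"] h_dom by auto

lemma chart_inv_ch: "chart_inv ch = h"
proof
  fix y
  have "inj_on (A \<circ> pcot_coords i) (pcot_chart_dom i)"
    by (rule inj_on_inverseI[of _ h]) (simp add: h_coords)
  then show "chart_inv ch y = h y"
    unfolding chart_inv_def using h_dom coords_h[of y] inv_into_f_f[of "A \<circ> pcot_coords i" "pcot_chart_dom i" "h y"] by simp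
qed

lemma open_h_preimage: assumes "openin pcot_top W" shows "open {y. h y \<in> W}"
proof -
  have o: "open {z. snd z \<noteq> 0 \<and> pcot_of z \<in> W}" using assms by (simp add: openin_pcot_top)
  have "continuous_on UNIV (\<lambda>y. (fst (B y), cov (wv y)))"
    unfolding wv_def
    by (intro continuous_on_Pair bounded_linear.continuous_on[OF bl(3)] bounded_linear.continuous_on[OF bl(4)]
        bounded_linear.continuous_on[OF bounded_linear_blinfun_inner_right] continuous_on_add continuous_on_id continuous_on_const)
  then have "open ((\<lambda>y. (fst (B y), cov (wv y))) -` {z. snd z \<noteq> 0 \<and> pcot_of z \<in> W})"
    by (rule open_vimage[OF o])
  moreover have "(\<lambda>y. (fst (B y), cov (wv y))) -` {z. snd z \<noteq> 0 \<and> pcot_of z \<in> W} = {y. h y \<in> W}"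
    using wv_nz by (auto simp: h_def)
  ultimately show ?thesis by simp
qed

text \<open>By the quotient topology this is a statement about covectors: the chart, lifted to
  covectors with nonzero component \<open>i\<close>, is the continuous map \<open>?k\<close>, and
  the set in question is a preimage under it.\<close>

lemma openin_h_image: assumes "open O'" shows "openin pcot_top (h ` O')"
proof -
  let ?D = "{z :: (real^'k) \<times> ((real^'k) \<Rightarrow>\<^sub>L real). blinfun_apply (snd z) (axis i 1) \<noteq> 0}"
  let ?w = "\<lambda>z :: (real^'k) \<times> ((real^'k) \<Rightarrow>\<^sub>L real). \<chi> j. blinfun_apply (snd z) (axis j 1)"
  let ?k = "\<lambda>z. A (fst z, (1 / blinfun_apply (snd z) (axis i 1)) *\<^sub>R ?w z - axis i 1)"
  have oD: "open ?D" by (intro open_Collect_neq continuous_intros)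
  have "continuous_on ?D ?k"
    by (intro bounded_linear.continuous_on[OF bl(1)] continuous_intros) auto
  then have "open (?D \<inter> ?k -` O')" by (rule continuous_open_preimage[OF _ oD assms])
  moreover have "?D \<inter> ?k -` O' = {z. snd z \<noteq> 0 \<and> pcot_of z \<in> h ` O'}"
  proof (rule set_eqI)
    fix z :: "(real^'k) \<times> ((real^'k) \<Rightarrow>\<^sub>L real)"
    obtain x \<alpha> where z: "z = (x, \<alpha>)" by (cases z)
    have k: "?k z = A (pcot_coords i (pcot_of z))" if "z \<in> ?D"
      using that pcot_coords_of_cov[of "?w z" i x] by (simp add: z cov_components)
    show "z \<in> ?D \<inter> ?k -` O' \<longleftrightarrow> z \<in> {z. snd z \<noteq> 0 \<and> pcot_of z \<in> h ` O'}"
    proof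
      assume a: "z \<in> ?D \<inter> ?k -` O'"
      then have zD: "z \<in> ?D" and kO: "?k z \<in> O'" by auto
      have "pcot_of z = h (?k z)" unfolding k[OF zD]
        by (rule h_coords[symmetric]) (use zD pcot_of_dom[of \<alpha> i x] z in auto)
      moreover have "snd z \<noteq> 0" using zD by auto
      ultimately show "z \<in> {z. snd z \<noteq> 0 \<and> pcot_of z \<in> h ` O'}" using kO by blast
    next
      assume "z \<in> {z. snd z \<noteq> 0 \<and> pcot_of z \<in> h ` O'}"
      then obtain y where y: "y \<in> O'" "pcot_of z = h y" by blast
      have "pcot_of z \<in> pcot_chart_dom i" unfolding y(2) by (rule h_dom)
      then obtain \<beta> where "\<beta> \<in> span {\<alpha>}" "blinfun_apply \<beta> (axis i 1) \<noteq> 0"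
        by (auto simp: z pcot_of_def pcot_chart_dom_def)
      then have zD: "z \<in> ?D" by (auto simp: z span_singleton blinfun.scaleR_left)
      have "?k z = y" unfolding k[OF zD] y(2) by (rule coords_h)
      then show "z \<in> ?D \<inter> ?k -` O'" using zD y(1) by blast
    qed
  qed
  moreover have "h ` O' \<subseteq> pcot_carrier"
  proof -
    have "(pcot_chart_dom i :: 'k pcot set) \<subseteq> pcot_carrier" by (auto simp: pcot_chart_dom_def)
    then show ?thesis using h_dom by blast
  qed
  ultimately show ?thesis by (simp add: openin_pcot_top)
qed

lemma openin_dom: "openin pcot_top (pcot_chart_dom i :: 'k pcot set)"
proof -
  have "h ` UNIV = pcot_chart_dom i" using h_dom h_coords by (metis image_subset_iff rangeI subsetI subset_antisym UNIV_I)
  then show ?thesis using openin_h_image[OF open_UNIV] by simp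
qed

lemma is_chart_ch: "is_chart pcot_top ch"
proof -
  have top: "topspace (subtopology pcot_top (pcot_chart_dom i)) = (pcot_chart_dom i :: 'k pcot set)"
    by (rule topspace_subtopology_subset[OF openin_subset[OF openin_dom]])
  have "homeomorphic_maps (subtopology pcot_top (pcot_chart_dom i)) euclidean (A \<circ> pcot_coords i) h"
    unfolding homeomorphic_maps_def continuous_map top
  proof (intro conjI ballI allI impI)
    fix O' :: "'e set" assume "openin euclidean O'"
    then have "openin pcot_top (h ` O')" using openin_h_image by (simp add: open_openin[symmetric])
    moreover have "{x \<in> pcot_chart_dom i. (A \<circ> pcot_coords i) x \<in> O'} = h ` O'"
    proof
      show "{x \<in> pcot_chart_dom i. (A \<circ> pcot_coords i) x \<in> O'} \<subseteq> h ` O'"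
      proof
        fix x assume "x \<in> {x \<in> pcot_chart_dom i. (A \<circ> pcot_coords i) x \<in> O'}"
        then show "x \<in> h ` O'" using h_coords[of x] by (intro image_eqI[of _ _ "A (pcot_coords i x)"]) auto
      qed
      show "h ` O' \<subseteq> {x \<in> pcot_chart_dom i. (A \<circ> pcot_coords i) x \<in> O'}" using h_dom coords_h by auto
    qed
    ultimately show "openin (subtopology pcot_top (pcot_chart_dom i)) {x \<in> pcot_chart_dom i. (A \<circ> pcot_coords i) x \<in> O'}"
      unfolding openin_open_subtopology[OF openin_dom] using h_dom by auto
  next
    fix W :: "'k pcot set" assume "openin (subtopology pcot_top (pcot_chart_dom i)) W"
    then have "openin pcot_top W" unfolding openin_open_subtopology[OF openin_dom] by (rule conjunct1)
    from open_h_preimage[OF this] show "openin euclidean {x \<in> topspace euclidean. h x \<in> W}"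
      by (simp add: open_openin[symmetric])
  qed (use h_dom h_coords coords_h in auto)
  then have "homeomorphic_map (subtopology pcot_top (pcot_chart_dom i)) euclidean (A \<circ> pcot_coords i)"
    unfolding homeomorphic_map_maps by blast
  then show ?thesis
    using openin_dom ch_UNIV unfolding is_chart_def by simp
qed

lemma ch_in_atlas: "ch \<in> atlas (pcot_mfd :: ('k pcot, 'e) mfd)"
proof -
  have "bij_betw A (UNIV \<times> {v. v $ i = 0}) UNIV"
    by (rule bij_betwI[of _ _ _ B]) (use AB B_i BA in \<open>auto simp: mem_Times_iff\<close>)
  then show ?thesis using lin_A by (auto simp: pcot_mfd_def)
qed

end

lemma pcot_chart_exists:
  fixes A :: "(real^'k::finite) \<times> (real^'k) \<Rightarrow> 'e::euclidean_space"
  assumes A: "linear A" "bij_betw A (UNIV \<times> {v. v $ i = 0}) UNIV"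
  shows "\<exists>B. pcot_chart i A B"
proof -
  let ?V = "UNIV \<times> {v :: real^'k. v $ i = 0}"
  have "subspace ?V" by (rule subspaceI) (auto simp: zero_prod_def)
  then obtain B where B: "range B \<subseteq> ?V" "linear B" "\<forall>y\<in>A ` ?V. A (B y) = y"
    using linear_exists_right_inverse_on[OF A(1)] by blast
  have AV: "A ` ?V = UNIV" using A(2) by (simp add: bij_betw_def)
  have AB: "A (B y) = y" for y using bspec[OF B(3), of y] AV by simp
  have Bi: "snd (B y) $ i = 0" for y using B(1) by (auto simp: mem_Times_iff image_subset_iff)
  have "B (A (x, u)) = (x, u)" if "u $ i = 0" for x u
  proof (rule inj_onD[OF bij_betw_imp_inj_on[OF A(2)]])
    show "A (B (A (x, u))) = A (x, u)" by (rule AB)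
    show "B (A (x, u)) \<in> ?V" using B(1) by blast
    show "(x, u) \<in> ?V" using that by simp
  qed
  then have "pcot_chart i A B" unfolding pcot_chart_def using A(1) B(2) AB Bi by blast
  then show ?thesis by blast
qed

lemma pcot_atlasE:
  assumes "c \<in> atlas (pcot_mfd :: ('k::finite pcot, 'e::euclidean_space) mfd)"
  obtains i A B where "pcot_chart i A B" "c = (pcot_chart_dom i, A \<circ> pcot_coords i)"
proof -
  obtain i A where c: "c = (pcot_chart_dom i, A \<circ> pcot_coords i)" "linear A" "bij_betw A (UNIV \<times> {v. v $ i = 0}) UNIV"
    using assms by (auto simp: pcot_mfd_def)
  from pcot_chart_exists[OF c(2,3)] show ?thesis using that c(1) by blast
qed

lemma mtop_pcot [simp]: "mtop pcot_mfd = pcot_top"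
  by (simp add: pcot_mfd_def)

text \<open>Passing to chart \<open>j\<close> divides the spanning covector by its component
  \<open>j\<close>, which is nonzero on the overlap; everything else is affine.\<close>

lemma pcot_transition_smooth:
  fixes A :: "(real^'k::finite) \<times> (real^'k) \<Rightarrow> 'e::euclidean_space"
  assumes c: "pcot_chart i A B" and d: "pcot_chart j A' B'"
  shows "smooth_on ((A \<circ> pcot_coords i) ` (pcot_chart_dom i \<inter> pcot_chart_dom j))
      (transition (pcot_chart_dom i, A \<circ> pcot_coords i) (pcot_chart_dom j, A' \<circ> pcot_coords j))"
proof -
  interpret c: pcot_chart i A B by (rule c)
  interpret d: pcot_chart j A' B' by (rule d)
  let ?S = "{y. c.wv y $ j \<noteq> 0}"
  have S: "(A \<circ> pcot_coords i) ` (pcot_chart_dom i \<inter> pcot_chart_dom j) \<subseteq> ?S"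
  proof
    fix y assume "y \<in> (A \<circ> pcot_coords i) ` (pcot_chart_dom i \<inter> pcot_chart_dom j)"
    then have "c.h y \<in> pcot_chart_dom j" using c.h_coords by auto
    then obtain \<beta> where "\<beta> \<in> span {cov (c.wv y)}" "blinfun_apply \<beta> (axis j 1) \<noteq> 0"
      by (auto simp: c.h_def pcot_of_def pcot_chart_dom_def)
    then show "y \<in> ?S" by (auto simp: span_singleton blinfun.scaleR_left)
  qed
  have sw: "smooth_on T c.wv" if "open T" for T
    unfolding c.wv_def by (intro smooth_on_add smooth_on_const smooth_on_linear c.bl that)
  have oS: "open ?S"
    using smooth_on_imp_continuous[OF sw[OF open_UNIV]]
    by (intro open_Collect_neq continuous_intros) auto
  have swj: "smooth_on ?S (\<lambda>y. c.wv y $ j)"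
    by (rule smooth_on_bounded_linear[OF oS bounded_linear_vec_nth sw[OF oS]])
  have "smooth_on ?S (\<lambda>y. A' (fst (B y), inverse (c.wv y $ j) *\<^sub>R c.wv y - axis j 1))"
    by (intro smooth_on_bounded_linear[OF oS d.bl(1)] smooth_on_Pair oS smooth_on_linear c.bl smooth_on_diff
        smooth_on_scaleR smooth_on_const smooth_on_inverse swj sw) auto
  then have "smooth_on ?S (transition (pcot_chart_dom i, A \<circ> pcot_coords i) (pcot_chart_dom j, A' \<circ> pcot_coords j))"
    by (rule smooth_on_cong[OF oS])
      (simp add: transition_def c.chart_inv_ch c.h_def pcot_coords_of_cov divide_inverse)
  then show ?thesis using S by (rule smooth_on_subset)
qed

lemma charted_pcot: "charted (pcot_mfd :: ('k::finite pcot, 'e::euclidean_space) mfd)"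
proof
  fix c assume "c \<in> atlas (pcot_mfd :: ('k pcot, 'e) mfd)"
  then obtain i A B where c: "pcot_chart i A B" "c = (pcot_chart_dom i, A \<circ> pcot_coords i)" by (rule pcot_atlasE)
  show "is_chart (mtop (pcot_mfd :: ('k pcot, 'e) mfd)) c"
    using pcot_chart.is_chart_ch[OF c(1)] by (simp add: c(2))
  fix d assume "d \<in> atlas (pcot_mfd :: ('k pcot, 'e) mfd)"
  then obtain j A' B' where d: "pcot_chart j A' B'" "d = (pcot_chart_dom j, A' \<circ> pcot_coords j)" by (rule pcot_atlasE)
  show "smooth_on (snd c ` (fst c \<inter> fst d)) (transition c d)"
    using pcot_transition_smooth[OF c(1) d(1)] by (simp add: c(2) d(2))
qed

text \<open>In every chart of the atlas the bundle projection is a linear map, hence its own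
  derivative; transitions preserve base points, so the chart chosen inside
  \<open>tangent_map\<close> can be exchanged for \<open>ch\<close>.\<close>

lemma (in pcot_chart) proj_tangent:
  assumes z: "z \<in> pcot_chart_dom i" and \<zeta>: "\<zeta> \<in> tangent_space (pcot_mfd :: ('k pcot, 'e) mfd) z"
  shows "pcot_proj_tangent z \<zeta> = fst (B (\<zeta> ch))"
proof -
  interpret P: charted "pcot_mfd :: ('k pcot, 'e) mfd" by (rule charted_pcot)
  have cz: "ch \<in> charts_at (pcot_mfd :: ('k pcot, 'e) mfd) z" using ch_in_atlas z by (simp add: charts_at_def)
  define c' where "c' = (SOME c. c \<in> charts_at (pcot_mfd :: ('k pcot, 'e) mfd) z)"
  have c'z: "c' \<in> charts_at (pcot_mfd :: ('k pcot, 'e) mfd) z" unfolding c'_def using cz by (rule someI)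
  have "c' \<in> atlas (pcot_mfd :: ('k pcot, 'e) mfd)" using P.charts_atD[OF c'z] by blast
  then obtain j A' B' where d: "pcot_chart j A' B'" "c' = (pcot_chart_dom j, A' \<circ> pcot_coords j)" by (rule pcot_atlasE)
  interpret d: pcot_chart j A' B' by (rule d)
  have base: "fst (d.h y) = fst (B' y)" "fst (h y) = fst (B y)" for y by (simp_all add: d.h_def h_def pcot_of_def)
  have E: "id \<circ> fst \<circ> chart_inv c' = (\<lambda>y. fst (B' y))"
    unfolding d(2) d.chart_inv_ch by (simp add: fun_eq_iff base)
  have "frechet_derivative (\<lambda>y. fst (B' y)) (at x) = (\<lambda>y. fst (B' y))" for x
    using frechet_derivative_at[OF bounded_linear_imp_has_derivative[OF d.bl(3)]] by metis
  then have 1: "pcot_proj_tangent z \<zeta> = fst (B' (\<zeta> c'))"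
    unfolding pcot_proj_tangent_def tangent_map_def Let_def c'_def[symmetric]
    by (simp add: charts_at_def eucl_mfd_def E[unfolded id_comp] id_comp)
  have "((\<lambda>y. fst (B' (transition ch c' y))) has_derivative (\<lambda>v. fst (B' (P.D_trans ch c' z v)))) (at (snd ch z))"
    by (rule bounded_linear.has_derivative[OF d.bl(3) P.D_trans_has[OF cz c'z]])
  then have "((\<lambda>y. fst (B y)) has_derivative (\<lambda>v. fst (B' (P.D_trans ch c' z v)))) (at (snd ch z))"
  proof (rule has_derivative_transform_within_open[OF _ P.open_overlap[OF ch_in_atlas] P.overlap[OF cz c'z]])
    show "c' \<in> atlas (pcot_mfd :: ('k pcot, 'e) mfd)" by fact
    fix y assume "y \<in> snd ch ` (fst ch \<inter> fst c')"
    then obtain q where q: "q \<in> pcot_chart_dom i" "q \<in> pcot_chart_dom j" "y = A (pcot_coords i q)" by (auto simp: d(2))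
    have "transition ch c' y = A' (pcot_coords j q)"
      unfolding q(3) using P.transition_snd[OF ch_in_atlas, of q c'] q(1) by (simp add: d(2))
    then have "d.h (transition ch c' y) = q" using d.h_coords[OF q(2)] by simp
    moreover have "h y = q" using h_coords[OF q(1)] q(3) by simp
    ultimately show "fst (B' (transition ch c' y)) = fst (B y)" using base by metis
  qed
  from has_derivative_unique[OF this bounded_linear_imp_has_derivative[OF bl(3)]]
  have "fst (B' (P.D_trans ch c' z v)) = fst (B v)" for v by metis
  then show ?thesis using 1 P.tangent_change[OF \<zeta> cz c'z] by simp
qed

section \<open>Contact diffeomorphisms to the projectivized cotangent bundle\<close>

text \<open>A count of dimensions, \<open>CARD('k) + (CARD('k) - 1)\<close>; it provides a chart for
  the index \<open>i\<close> found in the normal form.\<close>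

lemma hyperplane_identification:
  assumes "DIM('e::euclidean_space) + 1 = 2 * CARD('k::finite)"
  obtains A :: "(real^'k) \<times> (real^'k) \<Rightarrow> 'e::euclidean_space" where "linear A" "bij_betw A (UNIV \<times> {v. v $ i = 0}) UNIV"
proof -
  let ?W = "{v :: real^'k. v $ i = 0}"
  have W: "?W = {v. axis i 1 \<bullet> v = 0}" by (simp add: inner_axis' )
  have sW: "subspace ?W" by (rule subspaceI) auto
  have "dim ?W = CARD('k) - 1"
    unfolding W by (subst dim_hyperplane) (simp_all add: axis_eq_0_iff)
  then have "dim ((UNIV :: (real^'k) set) \<times> ?W) = dim (UNIV :: 'e set)"
    using dim_Times[OF subspace_UNIV sW, where 'a="real^'k"] assms by (simp add: dim_UNIV)
  then obtain A :: "(real^'k) \<times> (real^'k) \<Rightarrow> 'e" where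
    "linear A" "A ` (UNIV \<times> ?W) = UNIV" "inj_on A (UNIV \<times> ?W)"
    using subspace_isomorphism[OF subspace_Times[OF subspace_UNIV sW] subspace_UNIV] by metis
  then show ?thesis using that by (simp add: bij_betw_def)
qed

text \<open>In charts the tangent map is \<open>v \<mapsto> (Df v, Dlam v)\<close>, the projection
  to the base is its first component, and the line over a point is spanned by \<open>lam\<close>. So
  the two conditions of the normal form are exactly those defining the vertical and the contact
  distribution.\<close>

theorem theorem4p3:
  fixes M :: "('a, 'e::euclidean_space) mfd"
    and H HR :: "('a, 'e) distrib"
    and n :: nat
  assumes "contact_manifold n M H"
    and "lagrangian_subbundle n M H HR"
    and "integrable_subbundle M HR"
    and "CARD('k::finite) = n + 1"
  shows "\<forall>p\<in>topspace (mtop M). \<exists>U V. \<exists>\<Phi> :: 'a \<Rightarrow> 'k pcot.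
           p \<in> U \<and>
           diffeo_on M U (pcot_mfd :: ('k pcot, 'e) mfd) V \<Phi> \<and>
           (\<forall>q\<in>U. tangent_map M (pcot_mfd :: ('k pcot, 'e) mfd) \<Phi> q ` H q = canonical_contact (\<Phi> q) \<and>
                  tangent_map M (pcot_mfd :: ('k pcot, 'e) mfd) \<Phi> q ` HR q = vertical_subbundle (\<Phi> q))"
proof
  fix p assume p: "p \<in> topspace (mtop M)"
  let ?P = "pcot_mfd :: ('k pcot, 'e) mfd"
  have sm: "smooth_manifold M" and DIM: "DIM('e) = 2 * n + 1" and subH: "subbundle M (2 * n) H"
    and nd: "\<And>p \<xi>. p \<in> topspace (mtop M) \<Longrightarrow> \<xi> \<in> H p \<Longrightarrow> (\<And>\<eta>. \<eta> \<in> H p \<Longrightarrow> levi_bracket M H p \<xi> \<eta> = H p) \<Longrightarrow> \<xi> = (\<lambda>_. 0)"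
    using assms(1) by (auto simp: contact_manifold_def)
  have subR: "subbundle M n HR" and RH: "\<And>p. p \<in> topspace (mtop M) \<Longrightarrow> HR p \<subseteq> H p"
    using assms(2) by (auto simp: lagrangian_subbundle_def)
  have cM: "charted M" and cov: "(\<Union>c\<in>atlas M. fst c) = topspace (mtop M)"
    using sm by (auto simp: smooth_manifold_def charted_def)
  interpret M: charted M by (rule cM)
  interpret P: charted ?P by (rule charted_pcot)

  \<comment> \<open>A chart and local frames around \<open>p\<close>\<close>
  obtain c where c: "c \<in> atlas M" "p \<in> fst c" using p unfolding cov[symmetric] by (rule UN_E)
  obtain U1 Z where U1: "p \<in> U1" "openin (mtop M) U1" "\<And>i. i < 2 * n \<Longrightarrow> smooth_vector_field M U1 (Z i)"
    "\<And>q c. q \<in> U1 \<Longrightarrow> c \<in> charts_at M q \<Longrightarrow> (\<lambda>\<xi>. \<xi> c) ` H q = span ((\<lambda>i. Z i q c) ` {..<2 * n})"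
    by (rule M.subbundle_frame[OF subH p]) ((rule that; assumption) | assumption)+
  obtain U2 X where U2: "p \<in> U2" "openin (mtop M) U2" "\<And>i. i < n \<Longrightarrow> smooth_vector_field M U2 (X i)"
    "\<And>q c. q \<in> U2 \<Longrightarrow> c \<in> charts_at M q \<Longrightarrow> (\<lambda>\<xi>. \<xi> c) ` HR q = span ((\<lambda>i. X i q c) ` {..<n})"
    by (rule M.subbundle_frame[OF subR p]) ((rule that; assumption) | assumption)+
  let ?Z = "\<lambda>i. vf_rep c (Z i)" and ?X = "\<lambda>i. vf_rep c (X i)"
  let ?S = "snd c ` (U1 \<inter> U2 \<inter> fst c)" and ?y0 = "snd c p"
  have S: "open ?S" "?y0 \<in> ?S"
    using M.open_chart_image[OF c(1) openin_Int[OF U1(2) U2(2)]] U1(1) U2(1) c by auto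
  have inS: "q \<in> U1 \<and> q \<in> U2" if qS: "q \<in> fst c" "snd c q \<in> ?S" for q
  proof -
    obtain q' where "q' \<in> U1" "q' \<in> U2" "q' \<in> fst c" "snd c q = snd c q'" using qS(2) by auto
    then show ?thesis using inj_onD[OF M.chart_inj[OF c(1)], of q q'] qS(1) by simp
  qed
  have ch: "c \<in> charts_at M q" if "q \<in> fst c" for q using c that by (simp add: charts_at_def)
  have cH: "span ((\<lambda>i. ?Z i (snd c q)) ` {..<2 * n}) = (\<lambda>\<xi>. \<xi> c) ` H q"
    and cR: "span ((\<lambda>i. ?X i (snd c q)) ` {..<n}) = (\<lambda>\<xi>. \<xi> c) ` HR q"
    if "q \<in> fst c" "snd c q \<in> ?S" for q
    unfolding M.vf_rep_snd[OF c(1) that(1)]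
    by (rule U1(4)[OF conjunct1[OF inS[OF that]] ch[OF that(1)], symmetric],
        rule U2(4)[OF conjunct2[OF inS[OF that]] ch[OF that(1)], symmetric])
  have pt: "\<exists>q. q \<in> fst c \<and> y = snd c q" if "y \<in> ?S" for y using that by blast
  have sub1: "?S \<subseteq> snd c ` (U1 \<inter> fst c)" and sub2: "?S \<subseteq> snd c ` (U2 \<inter> fst c)" by blast+

  \<comment> \<open>The normal form in the chart\<close>
  have D2: "DIM('e) + 1 = 2 * CARD('k)" using DIM assms(4) by simp
  obtain V and f lam :: "'e \<Rightarrow> real^'k" and i where V: "open V" "?y0 \<in> V" "V \<subseteq> ?S" "smooth_on V f" "smooth_on V lam"
    "\<And>y. y \<in> V \<Longrightarrow> lam y $ i = 1"
    "\<And>y v. y \<in> V \<Longrightarrow> v \<in> span ((\<lambda>i. ?X i y) ` {..<n}) \<longleftrightarrow> frechet_derivative f (at y) v = 0"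
    "\<And>y v. y \<in> V \<Longrightarrow> v \<in> span ((\<lambda>i. ?Z i y) ` {..<2 * n}) \<longleftrightarrow> lam y \<bullet> frechet_derivative f (at y) v = 0"
    "\<And>y v. y \<in> V \<Longrightarrow> frechet_derivative f (at y) v = 0 \<Longrightarrow> frechet_derivative lam (at y) v = 0 \<Longrightarrow> v = 0"
  proof (rule local_normal_form[where X="?X" and Z="?Z" and n=n and 'k='k, OF S])
    show "smooth_on ?S (?X i)" if "i < n" for i
      by (rule smooth_on_subset[OF M.smooth_vf_rep[OF U2(3)[OF that] c(1)] sub2])
    show "smooth_on ?S (?Z i)" if "i < 2 * n" for i
      by (rule smooth_on_subset[OF M.smooth_vf_rep[OF U1(3)[OF that] c(1)] sub1])
    show "dim (span ((\<lambda>i. ?X i ?y0) ` {..<n})) = n"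
      unfolding cR[OF c(2) S(2)] by (rule M.subbundle_fibre(2)[OF subR ch[OF c(2)]])
    show "dim (span ((\<lambda>i. ?Z i ?y0) ` {..<2 * n})) = 2 * n"
      unfolding cH[OF c(2) S(2)] by (rule M.subbundle_fibre(2)[OF subH ch[OF c(2)]])
    show "span ((\<lambda>i. ?X i y) ` {..<n}) \<subseteq> span ((\<lambda>i. ?Z i y) ` {..<2 * n})" if y: "y \<in> ?S" for y
    proof -
      obtain q where q: "q \<in> fst c" "y = snd c q" using pt[OF y] by blast
      have "HR q \<subseteq> H q" using RH M.chart_topspace[OF c(1)] q(1) by blast
      have yq: "snd c q \<in> ?S" using y unfolding q(2) .
      show ?thesis unfolding q(2) cR[OF q(1) yq] cH[OF q(1) yq] by (rule image_mono) fact
    qed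
    show "frechet_derivative (?X i) (at y) (?X j y) - frechet_derivative (?X j) (at y) (?X i y) \<in> span ((\<lambda>i. ?X i y) ` {..<n})"
      if ij: "i < n" "j < n" and y: "y \<in> ?S" for i j y
    proof -
      obtain q where q: "q \<in> fst c" "y = snd c q" using pt[OF y] by blast
      have yq: "snd c q \<in> ?S" using y unfolding q(2) .
      have qU: "q \<in> U2" using inS[OF q(1) yq] by (rule conjunct2)
      have sec: "section_on M HR U2 (X i)" if "i < n" for i
        unfolding section_on_def
      proof (intro conjI ballI U2(3)[OF that])
        fix r assume r: "r \<in> U2"
        have "r \<in> (\<Union>c\<in>atlas M. fst c)" unfolding cov using openin_subset[OF U2(2)] r by (rule subsetD)
        then obtain e where "e \<in> atlas M" "r \<in> fst e" by (rule UN_E)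
        then have e: "e \<in> charts_at M r" by (simp add: charts_at_def)
        have "X i r \<in> tangent_space M r" using U2(3)[OF that] r by (simp add: smooth_vector_field_def)
        moreover have "X i r e \<in> (\<lambda>\<xi>. \<xi> e) ` HR r"
          unfolding U2(4)[OF r e] by (rule span_base) (use that in blast)
        ultimately show "X i r \<in> HR r" by (rule M.subbundle_memI[OF subR e])
      qed
      \<comment> \<open>The order \<open>X j\<close>, \<open>X i\<close> matches the coordinate
        formula for the bracket, DY(X) - DX(Y).\<close>
      have "lie_bracket M (X j) (X i) q \<in> HR q"
        using assms(3)[unfolded integrable_subbundle_def, rule_format, OF conjI[OF sec[OF ij(2)] sec[OF ij(1)]] qU] .
      then have "lie_bracket M (X j) (X i) q c \<in> (\<lambda>\<xi>. \<xi> c) ` HR q" by (rule imageI)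
      moreover have "lie_bracket M (X j) (X i) q c =
          frechet_derivative (?X i) (at y) (?X j y) - frechet_derivative (?X j) (at y) (?X i y)"
        unfolding q(2) M.vf_rep_snd[OF c(1) q(1)] lie_bracket_def using ch[OF q(1)] by (rule if_P)
      ultimately show ?thesis unfolding q(2) cR[OF q(1) yq] by (simp only:)
    qed
    show "v = 0"
      if a: "open W" "W \<subseteq> ?S" "\<And>y. y \<in> W \<Longrightarrow> linear (\<alpha> y)" "\<And>w. smooth_on W (\<lambda>y. \<alpha> y w)"
        "\<And>y w. y \<in> W \<Longrightarrow> \<alpha> y w = (0::real) \<longleftrightarrow> w \<in> span ((\<lambda>i. ?Z i y) ` {..<2 * n})" "y \<in> W"
        "v \<in> span ((\<lambda>i. ?Z i y) ` {..<2 * n})"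
        "\<And>w. w \<in> span ((\<lambda>i. ?Z i y) ` {..<2 * n}) \<Longrightarrow>
          frechet_derivative (\<lambda>y. \<alpha> y w) (at y) v = frechet_derivative (\<lambda>y. \<alpha> y v) (at y) w"
      for W \<alpha> y v
    proof -
      obtain q where q: "q \<in> fst c" "y = snd c q" using pt a(2,6) by blast
      have yS: "snd c q \<in> ?S" using a(2,6) q(2) by blast
      note cHq = cH[OF q(1) yS]
      show ?thesis
      proof (rule M.contact_nondegenerate[OF subH cov nd ch[OF q(1)] a(1) _ _ a(3,4)])
        show "snd c q \<in> W" using a(6) q(2) by simp
        show "W \<subseteq> snd c ` fst c" using a(2) by blast
        show "\<alpha> z w = 0 \<longleftrightarrow> w \<in> (\<lambda>\<xi>. \<xi> c) ` H (chart_inv c z)" if z: "z \<in> W" for z w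
        proof -
          obtain r where r: "r \<in> fst c" "z = snd c r" using pt a(2) z by blast
          have "snd c r \<in> ?S" using a(2) z r(2) by blast
          from cH[OF r(1) this] show ?thesis
            using a(5)[OF z, of w] unfolding r(2) M.chart_inv_snd[OF c(1) r(1)] by (simp only:)
        qed
        show "v \<in> (\<lambda>\<xi>. \<xi> c) ` H q" using a(7) unfolding q(2) cHq .
        show "frechet_derivative (\<lambda>y. \<alpha> y w) (at (snd c q)) v = frechet_derivative (\<lambda>y. \<alpha> y v) (at (snd c q)) w"
          if "w \<in> (\<lambda>\<xi>. \<xi> c) ` H q" for w
          using a(8)[of w] that unfolding q(2) cHq .
      qed
    qed
  qed (use DIM assms(4) that in auto)

  \<comment> \<open>The coordinate expression of the map and its local inverse\<close>
  obtain A :: "(real^'k) \<times> (real^'k) \<Rightarrow> 'e" where A: "linear A" "bij_betw A (UNIV \<times> {v. v $ i = 0}) UNIV"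
    using hyperplane_identification[OF D2] by blast
  obtain B where B: "pcot_chart i A B" using pcot_chart_exists[OF A] by blast
  interpret pc: pcot_chart i A B by (rule B)
  let ?d = "pc.ch"
  let ?Df = "\<lambda>y. frechet_derivative f (at y)" and ?Dl = "\<lambda>y. frechet_derivative lam (at y)"
  \<comment> \<open>Subtracting \<open>axis i 1\<close> moves the normalized covector into the
    hyperplane of fibre coordinates, where \<open>B\<close> inverts \<open>A\<close>.\<close>
  define g where "g y = A (f y, lam y - axis i 1)" for y
  have smg: "smooth_on V g"
    unfolding g_def by (intro smooth_on_bounded_linear[OF V(1) pc.bl(1)] smooth_on_Pair smooth_on_diff smooth_on_const V)
  \<comment> \<open>Component \<open>i\<close> of \<open>lam\<close> is constantly 1, so derivatives
    of \<open>lam\<close> lie in that hyperplane and \<open>B\<close> recovers the pair of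
    derivatives from the derivative of \<open>g\<close>.\<close>
  have Dl_i: "?Dl y v $ i = 0" if y: "y \<in> V" for y v
  proof -
    have "((\<lambda>y. lam y $ i) has_derivative (\<lambda>v. ?Dl y v $ i)) (at y)"
      by (rule bounded_linear.has_derivative[OF bounded_linear_vec_nth smooth_onD[OF V(5) y]])
    moreover have "((\<lambda>y. lam y $ i) has_derivative (\<lambda>v. 0)) (at y)"
      by (rule has_derivative_transform_within_open[where f="\<lambda>_. 1", OF has_derivative_const V(1) y]) (simp add: V(6))
    ultimately show ?thesis using has_derivative_unique by metis
  qed
  have Dg: "frechet_derivative g (at y) v = A (?Df y v, ?Dl y v)" if y: "y \<in> V" for y v
  proof -
    have "((\<lambda>y. (f y, lam y - axis i 1)) has_derivative (\<lambda>v. (?Df y v, ?Dl y v - 0))) (at y)"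
      by (intro has_derivative_Pair has_derivative_diff has_derivative_const smooth_onD[OF V(4) y] smooth_onD[OF V(5) y])
    from bounded_linear.has_derivative[OF pc.bl(1) this]
    have "(g has_derivative (\<lambda>v. A (?Df y v, ?Dl y v))) (at y)" by (simp add: g_def[abs_def])
    from fun_cong[OF frechet_derivative_at[OF this], of v] show ?thesis by simp
  qed
  have BDg: "B (frechet_derivative g (at y) v) = (?Df y v, ?Dl y v)" if y: "y \<in> V" for y v
    unfolding Dg[OF y] by (rule pc.BA[OF Dl_i[OF y]])
  have injg: "v = 0" if "frechet_derivative g (at ?y0) v = 0" for v
    using BDg[OF V(2), of v] that V(9)[OF V(2), of v] linear_0[OF pc.lin_B] by (simp add: zero_prod_def)
  obtain N N' g' where N: "open N" "N \<subseteq> V" "?y0 \<in> N" "open N'" "homeomorphism N N' g g'" "smooth_on N' g'"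
    "\<And>x v. x \<in> N \<Longrightarrow> frechet_derivative g' (at (g x)) (frechet_derivative g (at x) v) = v"
    "\<And>x v. x \<in> N \<Longrightarrow> frechet_derivative g (at x) (frechet_derivative g' (at (g x)) v) = v"
    by (rule smooth_inverse_function_theorem[OF V(1) smg V(2)]) (use injg that in blast)+
  have gg': "g y \<in> N'" "g' (g y) = y" if "y \<in> N" for y using N(5) that unfolding homeomorphism_def by blast+
  have g'g: "g' z \<in> N" "g (g' z) = z" if "z \<in> N'" for z using N(5) that unfolding homeomorphism_def by blast+

  \<comment> \<open>The diffeomorphism between open sets\<close>
  define U where "U = {q \<in> fst c. snd c q \<in> N}"
  define V' where "V' = {z \<in> fst ?d. snd ?d z \<in> N'}"
  define \<Phi> where "\<Phi> q = pcot_of (f (snd c q), cov (lam (snd c q)))" for q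
  have oU: "openin (mtop M) U" unfolding U_def by (rule M.openin_chart_preimage[OF c(1) N(1)])
  have oV': "openin (mtop ?P) V'" unfolding V'_def by (rule P.openin_chart_preimage[OF pc.ch_in_atlas N(4)])
  have Uc: "U \<subseteq> fst c" and V'd: "V' \<subseteq> fst ?d" by (auto simp: U_def V'_def)
  have UN: "snd c q \<in> N" and UV: "snd c q \<in> V" if "q \<in> U" for q using that N(2) by (auto simp: U_def)
  have NS: "y \<in> ?S" if "y \<in> N" for y using that N(2) V(3) by blast
  have \<Phi>1: "\<Phi> q \<in> fst ?d" and \<Phi>2: "snd ?d (\<Phi> q) = g (snd c q)" if q: "q \<in> U" for q
  proof -
    have l: "lam (snd c q) $ i = 1" by (rule V(6)[OF UV[OF q]])
    show "\<Phi> q \<in> fst ?d" unfolding \<Phi>_def fst_conv by (rule pcot_of_dom) (simp add: l)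
    show "snd ?d (\<Phi> q) = g (snd c q)" unfolding \<Phi>_def g_def snd_conv o_apply pcot_coords_of[OF l] ..
  qed
  have imU: "snd c ` U = N"
  proof
    show "snd c ` U \<subseteq> N" using UN by blast
    show "N \<subseteq> snd c ` U" using NS pt unfolding U_def by blast
  qed
  have imV': "snd ?d ` V' = N'"
  proof
    show "snd ?d ` V' \<subseteq> N'" unfolding V'_def by blast
    show "N' \<subseteq> snd ?d ` V'"
    proof
      fix z assume z: "z \<in> N'"
      have h: "snd ?d (pc.h z) = z" unfolding snd_conv o_apply by (rule pc.coords_h)
      have "pc.h z \<in> V'" unfolding V'_def mem_Collect_eq h fst_conv using pc.h_dom z by (rule conjI)
      then show "z \<in> snd ?d ` V'" by (rule image_eqI[where f="snd ?d" and x="pc.h z", OF h[symmetric]])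
    qed
  qed
  have inj\<Phi>: "inj_on \<Phi> U"
  proof (rule inj_onI)
    fix q r assume qr: "q \<in> U" "r \<in> U" "\<Phi> q = \<Phi> r"
    have "g' (snd ?d (\<Phi> q)) = g' (snd ?d (\<Phi> r))" unfolding qr(3) ..
    then have "snd c q = snd c r"
      unfolding \<Phi>2[OF qr(1)] \<Phi>2[OF qr(2)] gg'(2)[OF UN[OF qr(1)]] gg'(2)[OF UN[OF qr(2)]] .
    then show "q = r" by (rule inj_onD[OF M.chart_inj[OF c(1)] _ subsetD[OF Uc qr(1)] subsetD[OF Uc qr(2)]])
  qed
  have im\<Phi>: "\<Phi> ` U = V'"
  proof
    show "\<Phi> ` U \<subseteq> V'"
    proof
      fix z assume "z \<in> \<Phi> ` U"
      then obtain q where q: "z = \<Phi> q" "q \<in> U" by (rule imageE)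
      show "z \<in> V'" unfolding V'_def mem_Collect_eq q(1) \<Phi>2[OF q(2)] using \<Phi>1[OF q(2)] gg'(1)[OF UN[OF q(2)]] by (rule conjI)
    qed
    show "V' \<subseteq> \<Phi> ` U"
    proof
      fix z assume z: "z \<in> V'"
      then have zN: "snd ?d z \<in> N'" and zd: "z \<in> fst ?d" unfolding V'_def by blast+
      obtain q where q: "g' (snd ?d z) = snd c q" "q \<in> U" using g'g(1)[OF zN] unfolding imU[symmetric] by (rule imageE)
      have "snd ?d (\<Phi> q) = snd ?d z" unfolding \<Phi>2[OF q(2)] q(1)[symmetric] by (rule g'g(2)[OF zN])
      then have "\<Phi> q = z" by (rule inj_onD[OF P.chart_inj[OF pc.ch_in_atlas] _ \<Phi>1[OF q(2)] zd])
      then show "z \<in> \<Phi> ` U" using q(2) by blast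
    qed
  qed
  have inv1: "inv_into U \<Phi> z \<in> U" and inv2: "\<Phi> (inv_into U \<Phi> z) = z" if "z \<in> V'" for z
    using that inv_into_into[of z \<Phi> U] f_inv_into_f[of z \<Phi> U] by (simp_all add: im\<Phi>)
  have sgU: "smooth_on (snd c ` U) g" unfolding imU by (rule smooth_on_subset[OF smg N(2)])
  have smV: "smooth_map_on ?P V' M (inv_into U \<Phi>)"
  proof (rule chart_smooth_map[OF charted_pcot cM pc.ch_in_atlas c(1) oV' V'd])
    show "smooth_on (snd ?d ` V') g'" unfolding imV' by (rule N(6))
    fix z assume z: "z \<in> V'"
    show "inv_into U \<Phi> z \<in> fst c" using inv1[OF z] Uc by blast
    show "snd c (inv_into U \<Phi> z) = g' (snd ?d z)"
      using gg'(2)[OF UN[OF inv1[OF z]]] unfolding \<Phi>2[OF inv1[OF z], symmetric] inv2[OF z] by (rule sym)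
  qed
  have diffeo: "diffeo_on M U ?P V' \<Phi>"
    unfolding diffeo_on_def bij_betw_def
    using oU oV' inj\<Phi> im\<Phi> chart_smooth_map[OF cM charted_pcot c(1) pc.ch_in_atlas oU Uc sgU \<Phi>1 \<Phi>2] smV by blast

  \<comment> \<open>The images of the two distributions\<close>
  have tangent: "tangent_map M ?P \<Phi> q ` H q = canonical_contact (\<Phi> q)" (is ?H)
      "tangent_map M ?P \<Phi> q ` HR q = vertical_subbundle (\<Phi> q)" (is ?R) if q: "q \<in> U" for q
  proof -
    let ?y = "snd c q"
    let ?T = "tangent_map M ?P \<Phi> q"
    have yN: "?y \<in> N" and yV: "?y \<in> V" and yS: "?y \<in> ?S" using UN[OF q] UV[OF q] NS by auto
    have qc: "q \<in> fst c" using q Uc by blast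
    have dq: "?d \<in> charts_at ?P (\<Phi> q)" using pc.ch_in_atlas \<Phi>1[OF q] by (simp add: charts_at_def)
    have T: "?T \<xi> \<in> tangent_space ?P (\<Phi> q)" "?T \<xi> ?d = frechet_derivative g (at ?y) (\<xi> c)"
      if \<xi>: "\<xi> \<in> tangent_space M q" for \<xi>
    proof -
      have t: "?T \<xi> = P.tvec_of (\<Phi> q) ?d (frechet_derivative g (at ?y) (\<xi> c))"
        by (rule chart_tangent_map[OF cM charted_pcot c(1) pc.ch_in_atlas oU Uc sgU \<Phi>1 \<Phi>2 q \<xi>])
      show "?T \<xi> \<in> tangent_space ?P (\<Phi> q)" unfolding t by (rule P.tvec_of_in[OF dq])
      show "?T \<xi> ?d = frechet_derivative g (at ?y) (\<xi> c)" unfolding t by (rule P.tvec_of_same[OF dq])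
    qed
    have proj: "pcot_proj_tangent (\<Phi> q) \<zeta> = ?Df ?y v"
      if "\<zeta> \<in> tangent_space ?P (\<Phi> q)" "\<zeta> ?d = frechet_derivative g (at ?y) v" for \<zeta> v
      using pc.proj_tangent[OF _ that(1)] \<Phi>1[OF q] BDg[OF yV, of v] that(2) by simp
    \<comment> \<open>The line is spanned by \<open>cov (lam ?y)\<close>, so being annihilated by
      all of its elements is a single equation.\<close>
    have ann: "(\<forall>\<alpha>\<in>snd (\<Phi> q). blinfun_apply \<alpha> w = 0) \<longleftrightarrow> lam ?y \<bullet> w = 0" for w
      unfolding \<Phi>_def pcot_of_def
      by (auto simp: span_singleton blinfun.scaleR_left intro: bspec[of _ _ "1 *\<^sub>R cov (lam ?y)"])
    have HT: "\<xi> \<in> tangent_space M q" if "\<xi> \<in> H q" for \<xi> using M.subbundle_tangent[OF subH ch[OF qc] that] .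
    have RT: "\<xi> \<in> tangent_space M q" if "\<xi> \<in> HR q" for \<xi> using M.subbundle_tangent[OF subR ch[OF qc] that] .
    have Hy: "v \<in> (\<lambda>\<xi>. \<xi> c) ` H q \<longleftrightarrow> lam ?y \<bullet> ?Df ?y v = 0" for v
      using V(8)[OF yV, of v] unfolding cH[OF qc yS] .
    have Ry: "v \<in> (\<lambda>\<xi>. \<xi> c) ` HR q \<longleftrightarrow> ?Df ?y v = 0" for v
      using V(7)[OF yV, of v] unfolding cR[OF qc yS] .
    \<comment> \<open>The derivative of \<open>g\<close> is onto at points of \<open>N\<close>; this
      yields the inclusions of the canonical distributions in the images.\<close>
    have surj: "\<exists>v. \<zeta> ?d = frechet_derivative g (at ?y) v" for \<zeta>
      using N(8)[OF yN, of "\<zeta> ?d"] by metis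
    have lift: "\<zeta> = ?T \<xi>" if "\<zeta> \<in> tangent_space ?P (\<Phi> q)" "\<xi> \<in> tangent_space M q"
      "\<zeta> ?d = frechet_derivative g (at ?y) (\<xi> c)" for \<zeta> \<xi>
      using P.tangent_eqI[OF that(1) T(1)[OF that(2)] dq] T(2)[OF that(2)] that(3) by simp
    show ?H
    proof
      show "?T ` H q \<subseteq> canonical_contact (\<Phi> q)"
      proof
        fix \<zeta> assume "\<zeta> \<in> ?T ` H q"
        then obtain \<xi> where \<xi>: "\<xi> \<in> H q" "\<zeta> = ?T \<xi>" by (rule imageE)
        have "lam ?y \<bullet> ?Df ?y (\<xi> c) = 0" using Hy[of "\<xi> c"] \<xi>(1) by blast
        then show "\<zeta> \<in> canonical_contact (\<Phi> q)"
          unfolding canonical_contact_def \<xi>(2) mem_Collect_eq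
          using T(1)[OF HT[OF \<xi>(1)]] proj[OF T[OF HT[OF \<xi>(1)]]] ann by simp
      qed
      show "canonical_contact (\<Phi> q) \<subseteq> ?T ` H q"
      proof
        fix \<zeta> :: "('k pcot, 'e) tvec" assume "\<zeta> \<in> canonical_contact (\<Phi> q)"
        then have \<zeta>: "\<zeta> \<in> tangent_space ?P (\<Phi> q)" "lam ?y \<bullet> pcot_proj_tangent (\<Phi> q) \<zeta> = 0"
          unfolding canonical_contact_def mem_Collect_eq ann by auto
        obtain v where v: "\<zeta> ?d = frechet_derivative g (at ?y) v" using surj by blast
        have "v \<in> (\<lambda>\<xi>. \<xi> c) ` H q" unfolding Hy using \<zeta>(2) unfolding proj[OF \<zeta>(1) v] .
        then obtain \<xi> where \<xi>: "v = \<xi> c" "\<xi> \<in> H q" by (rule imageE)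
        have "\<zeta> = ?T \<xi>" by (rule lift[OF \<zeta>(1) HT[OF \<xi>(2)]]) (use v \<xi>(1) in simp)
        then show "\<zeta> \<in> ?T ` H q" using \<xi>(2) by (rule image_eqI)
      qed
    qed
    show ?R
    proof
      show "?T ` HR q \<subseteq> vertical_subbundle (\<Phi> q)"
      proof
        fix \<zeta> assume "\<zeta> \<in> ?T ` HR q"
        then obtain \<xi> where \<xi>: "\<xi> \<in> HR q" "\<zeta> = ?T \<xi>" by (rule imageE)
        have "?Df ?y (\<xi> c) = 0" using Ry[of "\<xi> c"] \<xi>(1) by blast
        then show "\<zeta> \<in> vertical_subbundle (\<Phi> q)"
          unfolding vertical_subbundle_def \<xi>(2) mem_Collect_eq
          using T(1)[OF RT[OF \<xi>(1)]] proj[OF T[OF RT[OF \<xi>(1)]]] by simp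
      qed
      show "vertical_subbundle (\<Phi> q) \<subseteq> ?T ` HR q"
      proof
        fix \<zeta> :: "('k pcot, 'e) tvec" assume "\<zeta> \<in> vertical_subbundle (\<Phi> q)"
        then have \<zeta>: "\<zeta> \<in> tangent_space ?P (\<Phi> q)" "pcot_proj_tangent (\<Phi> q) \<zeta> = 0"
          unfolding vertical_subbundle_def mem_Collect_eq by auto
        obtain v where v: "\<zeta> ?d = frechet_derivative g (at ?y) v" using surj by blast
        have "v \<in> (\<lambda>\<xi>. \<xi> c) ` HR q" unfolding Ry using \<zeta>(2) unfolding proj[OF \<zeta>(1) v] .
        then obtain \<xi> where \<xi>: "v = \<xi> c" "\<xi> \<in> HR q" by (rule imageE)
        have "\<zeta> = ?T \<xi>" by (rule lift[OF \<zeta>(1) RT[OF \<xi>(2)]]) (use v \<xi>(1) in simp)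
        then show "\<zeta> \<in> ?T ` HR q" using \<xi>(2) by (rule image_eqI)
      qed
    qed
  qed
  have "p \<in> U" using c N(3) by (simp add: U_def)
  then show "\<exists>U V. \<exists>\<Phi> :: 'a \<Rightarrow> 'k pcot.
           p \<in> U \<and>
           diffeo_on M U (pcot_mfd :: ('k pcot, 'e) mfd) V \<Phi> \<and>
           (\<forall>q\<in>U. tangent_map M (pcot_mfd :: ('k pcot, 'e) mfd) \<Phi> q ` H q = canonical_contact (\<Phi> q) \<and>
                  tangent_map M (pcot_mfd :: ('k pcot, 'e) mfd) \<Phi> q ` HR q = vertical_subbundle (\<Phi> q))"
    using diffeo tangent by blast
qed

end
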